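(* Let $\varphi\colon M\to N$ be a morphism of commutative monoids. The following are equivalent. (1) $\varphi$ is a flat epimorphism of finite presentation. (2) $\varphi$ is isomorphic as an $M$-algebra to a localization of $M$ at an element, i.e. there are $a\in M$ and an isomorphism of $M$-algebras $N\cong M_a$. (3) The map $\operatorname{Spec}_{\mathbb{F}_1}N\to\operatorname{Spec}_{\mathbb{F}_1}M$ induced by $\varphi$ is an open immersion of affine geometrical $\mathbb{F}_1$-schemes.
   Context: "Monoid" means commutative monoid with unit; $M^\times$ is the group of invertible elements of $M$. Epimorphism means epimorphism in the category of monoids. For a monoid $M$, an $M$-module is a set with an action of $M$; an $M$-algebra is a monoid $N$ with a monoid map $M\to N$. For $M$-modules $S,T$, $S\otimes_M T$ is $S\times T$ modulo the equivalence relation generated by $(ms,t)\sim(s,mt)$. A map of monoids $A\to B$ is flat if the functor $-\otimes_A B$ from $A$-modules to $B$-modules commutes with finite limits (it always commutes with colimits). It is of finite presentation if for every direct system $\{C_i\}$ of $A$-algebras the canonical map $\varinjlim\operatorname{Hom}_{A\text{-Alg}}(B,C_i)\to\operatorname{Hom}_{A\text{-Alg}}(B,\varinjlim C_i)$ is bijective. For a subset $S\subset M$, the localization $M\to S^{-1}M$ is the universal monoid map sending $S$ into invertible elements; $M_a$ is the localization at $\{a\}$ and $M_\mathfrak{p}$ the localization at $M\setminus\mathfrak{p}$. A subset $I\subset M$ is an ideal if $IM=I$ (the empty set is allowed) and is prime if $M\setminus I$ is a submonoid. $\operatorname{Spec}_{\mathbb{F}_1} M$ is the set of prime ideals with closed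 sets $V(I)=\{\mathfrak{p}: I\subset\mathfrak{p}\}$, $I\subset M$, and basic open sets $D(a)=\{\mathfrak{p}: a\notin\mathfrak{p}\}$, together with its canonical sheaf of monoids $\mathcal{O}$ satisfying $\mathcal{O}(D(a))=M_a$ and $\mathcal{O}_\mathfrak{p}=M_\mathfrak{p}$. A monoidal space is a topological space with a sheaf of monoids; a morphism $(X,\mathcal{O}_X)\to(Y,\mathcal{O}_Y)$ is a continuous map $f$ with a map of sheaves of monoids $f^\sharp:\mathcal{O}_Y\to f_*\mathcal{O}_X$ whose stalk maps $g:\mathcal{O}_{Y,f(x)}\to\mathcal{O}_{X,x}$ are local, i.e. $g^{-1}(\mathcal{O}_{X,x}^\times)=\mathcal{O}_{Y,f(x)}^\times$. Affine geometrical $\mathbb{F}_1$-schemes are the monoidal spaces isomorphic to some $\operatorname{Spec}_{\mathbb{F}_1}M$; $\operatorname{Spec}_{\mathbb{F}_1}$ is a contravariant functor from monoids to monoidal spaces. A morphism of monoidal spaces is an open immersion if it is the composite of an isomorphism and an open inclusion $(U,\mathcal{O}_Y|_U)\hookrightarrow(Y,\mathcal{O}_Y)$. *)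

theory Defs
  imports
    "HOL-Algebra.Coset"
    "HOL-Analysis.Abstract_Topology"
    "HOL-Library.Equipollence"
begin

section \<open>Monoids and algebras over a monoid\<close>

text \<open>Homomorphisms of monoids preserve the unit, which \<^const>\<open>hom\<close> does not demand.\<close>

definition monoid_hom :: "'a monoid \<Rightarrow> 'b monoid \<Rightarrow> ('a \<Rightarrow> 'b) set" where
  "monoid_hom A B = {h \<in> hom A B. h \<one>\<^bsub>A\<^esub> = \<one>\<^bsub>B\<^esub>}"

text \<open>An \<open>A\<close>-algebra is a monoid \<open>B\<close> with a structure map \<open>\<beta>\<close> from \<open>A\<close>.\<close>

definition monoid_algebra :: "'a monoid \<Rightarrow> 'b monoid \<Rightarrow> ('a \<Rightarrow> 'b) \<Rightarrow> bool" where
  "monoid_algebra A B \<beta> \<longleftrightarrow> comm_monoid A \<and> comm_monoid B \<and> \<beta> \<in> monoid_hom A B"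

definition algebra_hom ::
    "'a monoid \<Rightarrow> 'b monoid \<Rightarrow> ('a \<Rightarrow> 'b) \<Rightarrow> 'c monoid \<Rightarrow> ('a \<Rightarrow> 'c) \<Rightarrow> ('b \<Rightarrow> 'c) set" where
  "algebra_hom A B \<beta> C \<gamma> = {h \<in> monoid_hom B C. \<forall>a\<in>carrier A. h (\<beta> a) = \<gamma> a}"

definition algebra_isomorphic ::
    "'a monoid \<Rightarrow> 'b monoid \<Rightarrow> ('a \<Rightarrow> 'b) \<Rightarrow> 'c monoid \<Rightarrow> ('a \<Rightarrow> 'c) \<Rightarrow> bool" where
  "algebra_isomorphic A B \<beta> C \<gamma> \<longleftrightarrow>
     (\<exists>h\<in>algebra_hom A B \<beta> C \<gamma>. bij_betw h (carrier B) (carrier C))"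

text \<open>
  The notions of epimorphism, flatness and finite presentation quantify over all monoids, modules
  or direct systems.  As HOL has no quantifier over types, these definitions take a type \<open>'u\<close> as
  an argument and let the test objects have their carriers (and index sets) in \<open>'u\<close>; theorems
  are meant to be stated for every type \<open>'u\<close> that is large enough, so that \<open>'u\<close> plays the role of an
  arbitrary universe.
\<close>

definition epimorphism :: "'u itself \<Rightarrow> 'a monoid \<Rightarrow> 'b monoid \<Rightarrow> ('a \<Rightarrow> 'b) \<Rightarrow> bool" where
  "epimorphism _ A B \<phi> \<longleftrightarrow>
     (\<forall>(P :: 'u monoid) g h.
        comm_monoid P \<and> g \<in> monoid_hom B P \<and> h \<in> monoid_hom B P \<and>
        (\<forall>a\<in>carrier A. g (\<phi> a) = h (\<phi> a)) \<longrightarrow>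
        (\<forall>b\<in>carrier B. g b = h b))"


section \<open>Modules, finite limits and flatness\<close>

record ('a, 's) mset =
  pts :: "'s set"
  act :: "'a \<Rightarrow> 's \<Rightarrow> 's"

definition is_module :: "'a monoid \<Rightarrow> ('a, 's) mset \<Rightarrow> bool" where
  "is_module A S \<longleftrightarrow>
     (\<forall>a\<in>carrier A. \<forall>x\<in>pts S. act S a x \<in> pts S) \<and>
     (\<forall>x\<in>pts S. act S \<one>\<^bsub>A\<^esub> x = x) \<and>
     (\<forall>a\<in>carrier A. \<forall>b\<in>carrier A. \<forall>x\<in>pts S. act S (a \<otimes>\<^bsub>A\<^esub> b) x = act S a (act S b x))"

definition module_hom ::
    "'a monoid \<Rightarrow> ('a, 's) mset \<Rightarrow> ('a, 't) mset \<Rightarrow> ('s \<Rightarrow> 't) set" where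
  "module_hom A S T =
     {h \<in> pts S \<rightarrow> pts T. \<forall>a\<in>carrier A. \<forall>x\<in>pts S. h (act S a x) = act T a (h x)}"

definition module_iso ::
    "'a monoid \<Rightarrow> ('a, 's) mset \<Rightarrow> ('a, 't) mset \<Rightarrow> ('s \<Rightarrow> 't) set" where
  "module_iso A S T = {h \<in> module_hom A S T. bij_betw h (pts S) (pts T)}"

definition restrict_scalars :: "'a monoid \<Rightarrow> 'b monoid \<Rightarrow> ('a \<Rightarrow> 'b) \<Rightarrow> ('a, 'b) mset" where
  "restrict_scalars A B \<phi> = \<lparr>pts = carrier B, act = (\<lambda>a b. \<phi> a \<otimes>\<^bsub>B\<^esub> b)\<rparr>"

definition tensor_step ::
    "'a monoid \<Rightarrow> ('a, 's) mset \<Rightarrow> ('a, 't) mset \<Rightarrow> 's \<times> 't \<Rightarrow> 's \<times> 't \<Rightarrow> bool" where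
  "tensor_step A S T p q \<longleftrightarrow>
     (\<exists>a\<in>carrier A. \<exists>x\<in>pts S. \<exists>y\<in>pts T. p = (act S a x, y) \<and> q = (x, act T a y))"

definition tensor_class ::
    "'a monoid \<Rightarrow> ('a, 's) mset \<Rightarrow> ('a, 't) mset \<Rightarrow> 's \<Rightarrow> 't \<Rightarrow> ('s \<times> 't) set" where
  "tensor_class A S T x y =
     {q \<in> pts S \<times> pts T. equivclp (tensor_step A S T) (x, y) q}"

definition tensor ::
    "'a monoid \<Rightarrow> ('a, 's) mset \<Rightarrow> ('a, 't) mset \<Rightarrow> ('s \<times> 't) set set" where
  "tensor A S T = {tensor_class A S T x y | x y. x \<in> pts S \<and> y \<in> pts T}"

text \<open>The functor \<open>S \<mapsto> S \<otimes>\<^sub>A B\<close> from \<open>A\<close>-modules to \<open>B\<close>-modules, on objects and on morphisms.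
  Operations on classes are given by unions over representatives, as usual for quotients.\<close>

definition base_change ::
    "'a monoid \<Rightarrow> 'b monoid \<Rightarrow> ('a \<Rightarrow> 'b) \<Rightarrow> ('a, 's) mset \<Rightarrow> ('b, ('s \<times> 'b) set) mset" where
  "base_change A B \<phi> S =
     \<lparr>pts = tensor A S (restrict_scalars A B \<phi>),
      act = (\<lambda>c p. \<Union>(x, b)\<in>p. tensor_class A S (restrict_scalars A B \<phi>) x (c \<otimes>\<^bsub>B\<^esub> b))\<rparr>"

definition base_change_map ::
    "'a monoid \<Rightarrow> 'b monoid \<Rightarrow> ('a \<Rightarrow> 'b) \<Rightarrow> ('a, 't) mset \<Rightarrow> ('s \<Rightarrow> 't)
      \<Rightarrow> ('s \<times> 'b) set \<Rightarrow> ('t \<times> 'b) set" where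
  "base_change_map A B \<phi> T h p =
     (\<Union>(x, b)\<in>p. tensor_class A T (restrict_scalars A B \<phi>) (h x) b)"

record 'j cat =
  ob :: "'j set"
  ar :: "'j set"
  src :: "'j \<Rightarrow> 'j"
  tgt :: "'j \<Rightarrow> 'j"
  idt :: "'j \<Rightarrow> 'j"
  cmp :: "'j \<Rightarrow> 'j \<Rightarrow> 'j"

definition finite_category :: "'j cat \<Rightarrow> bool" where
  "finite_category J \<longleftrightarrow>
     finite (ob J) \<and> finite (ar J) \<and>
     (\<forall>f\<in>ar J. src J f \<in> ob J \<and> tgt J f \<in> ob J) \<and>
     (\<forall>x\<in>ob J. idt J x \<in> ar J \<and> src J (idt J x) = x \<and> tgt J (idt J x) = x) \<and>
     (\<forall>f\<in>ar J. \<forall>g\<in>ar J. src J g = tgt J f \<longrightarrow>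
        cmp J g f \<in> ar J \<and> src J (cmp J g f) = src J f \<and> tgt J (cmp J g f) = tgt J g) \<and>
     (\<forall>f\<in>ar J. cmp J f (idt J (src J f)) = f \<and> cmp J (idt J (tgt J f)) f = f) \<and>
     (\<forall>f\<in>ar J. \<forall>g\<in>ar J. \<forall>h\<in>ar J. src J g = tgt J f \<and> src J h = tgt J g \<longrightarrow>
        cmp J h (cmp J g f) = cmp J (cmp J h g) f)"

text \<open>A functor from \<open>J\<close> to \<open>A\<close>-modules, with object part \<open>D\<close> and arrow part \<open>d\<close>.\<close>

definition module_diagram ::
    "'a monoid \<Rightarrow> 'j cat \<Rightarrow> ('j \<Rightarrow> ('a, 's) mset) \<Rightarrow> ('j \<Rightarrow> 's \<Rightarrow> 's) \<Rightarrow> bool" where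
  "module_diagram A J D d \<longleftrightarrow>
     (\<forall>j\<in>ob J. is_module A (D j)) \<and>
     (\<forall>f\<in>ar J. d f \<in> module_hom A (D (src J f)) (D (tgt J f))) \<and>
     (\<forall>j\<in>ob J. \<forall>x\<in>pts (D j). d (idt J j) x = x) \<and>
     (\<forall>f\<in>ar J. \<forall>g\<in>ar J. src J g = tgt J f \<longrightarrow>
        (\<forall>x\<in>pts (D (src J f)). d (cmp J g f) x = d g (d f x)))"

definition module_limit ::
    "'j cat \<Rightarrow> ('j \<Rightarrow> ('a, 's) mset) \<Rightarrow> ('j \<Rightarrow> 's \<Rightarrow> 's) \<Rightarrow> ('a, 'j \<Rightarrow> 's) mset" where
  "module_limit J D d =
     \<lparr>pts = {x \<in> \<Pi>\<^sub>E j\<in>ob J. pts (D j). \<forall>f\<in>ar J. d f (x (src J f)) = x (tgt J f)},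
      act = (\<lambda>a x. \<lambda>j\<in>ob J. act (D j) a (x j))\<rparr>"

text \<open>Every finite category is isomorphic to one whose objects and arrows are natural numbers.
  The comparison map \<open>(lim D) \<otimes>\<^sub>A B \<rightarrow> lim (D \<otimes>\<^sub>A B)\<close> is induced by the projections of the limit.\<close>

definition flat :: "'u itself \<Rightarrow> 'a monoid \<Rightarrow> 'b monoid \<Rightarrow> ('a \<Rightarrow> 'b) \<Rightarrow> bool" where
  "flat _ A B \<phi> \<longleftrightarrow>
     (\<forall>(J :: nat cat) (D :: nat \<Rightarrow> ('a, 'u) mset) d.
        finite_category J \<and> module_diagram A J D d \<longrightarrow>
        (\<lambda>p. \<lambda>j\<in>ob J. base_change_map A B \<phi> (D j) (\<lambda>x. x j) p)
          \<in> module_iso B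
              (base_change A B \<phi> (module_limit J D d))
              (module_limit J (\<lambda>j. base_change A B \<phi> (D j))
                 (\<lambda>f. base_change_map A B \<phi> (D (tgt J f)) (d f))))"


section \<open>Direct systems and finite presentation\<close>

definition directed_set :: "'i set \<Rightarrow> ('i \<Rightarrow> 'i \<Rightarrow> bool) \<Rightarrow> bool" where
  "directed_set I leq \<longleftrightarrow>
     I \<noteq> {} \<and> (\<forall>i\<in>I. leq i i) \<and>
     (\<forall>i\<in>I. \<forall>j\<in>I. \<forall>k\<in>I. leq i j \<and> leq j k \<longrightarrow> leq i k) \<and>
     (\<forall>i\<in>I. \<forall>j\<in>I. \<exists>k\<in>I. leq i k \<and> leq j k)"

definition direct_system ::
    "'a monoid \<Rightarrow> 'i set \<Rightarrow> ('i \<Rightarrow> 'i \<Rightarrow> bool) \<Rightarrow> ('i \<Rightarrow> 'c monoid) \<Rightarrow> ('i \<Rightarrow> 'a \<Rightarrow> 'c)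
      \<Rightarrow> ('i \<Rightarrow> 'i \<Rightarrow> 'c \<Rightarrow> 'c) \<Rightarrow> bool" where
  "direct_system A I leq C \<gamma> t \<longleftrightarrow>
     directed_set I leq \<and>
     (\<forall>i\<in>I. monoid_algebra A (C i) (\<gamma> i)) \<and>
     (\<forall>i\<in>I. \<forall>j\<in>I. leq i j \<longrightarrow> t i j \<in> algebra_hom A (C i) (\<gamma> i) (C j) (\<gamma> j)) \<and>
     (\<forall>i\<in>I. \<forall>x\<in>carrier (C i). t i i x = x) \<and>
     (\<forall>i\<in>I. \<forall>j\<in>I. \<forall>k\<in>I. leq i j \<and> leq j k \<longrightarrow>
        (\<forall>x\<in>carrier (C i). t i k x = t j k (t i j x)))"

definition dlim_class ::
    "'i set \<Rightarrow> ('i \<Rightarrow> 'i \<Rightarrow> bool) \<Rightarrow> ('i \<Rightarrow> 'x set) \<Rightarrow> ('i \<Rightarrow> 'i \<Rightarrow> 'x \<Rightarrow> 'x) \<Rightarrow> 'i \<Rightarrow> 'x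
      \<Rightarrow> ('i \<times> 'x) set" where
  "dlim_class I leq X t i x =
     {(j, y). j \<in> I \<and> y \<in> X j \<and> (\<exists>k\<in>I. leq i k \<and> leq j k \<and> t i k x = t j k y)}"

definition dlim ::
    "'i set \<Rightarrow> ('i \<Rightarrow> 'i \<Rightarrow> bool) \<Rightarrow> ('i \<Rightarrow> 'x set) \<Rightarrow> ('i \<Rightarrow> 'i \<Rightarrow> 'x \<Rightarrow> 'x) \<Rightarrow> ('i \<times> 'x) set set" where
  "dlim I leq X t = {dlim_class I leq X t i x | i x. i \<in> I \<and> x \<in> X i}"

definition dlim_monoid ::
    "'i set \<Rightarrow> ('i \<Rightarrow> 'i \<Rightarrow> bool) \<Rightarrow> ('i \<Rightarrow> 'c monoid) \<Rightarrow> ('i \<Rightarrow> 'i \<Rightarrow> 'c \<Rightarrow> 'c)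
      \<Rightarrow> ('i \<times> 'c) set monoid" where
  "dlim_monoid I leq C t =
     \<lparr>carrier = dlim I leq (\<lambda>i. carrier (C i)) t,
      mult = (\<lambda>p q. \<Union>(i, x)\<in>p. \<Union>(j, y)\<in>q. \<Union>k\<in>{k \<in> I. leq i k \<and> leq j k}.
                dlim_class I leq (\<lambda>i. carrier (C i)) t k (t i k x \<otimes>\<^bsub>C k\<^esub> t j k y)),
      one = (\<Union>i\<in>I. dlim_class I leq (\<lambda>i. carrier (C i)) t i \<one>\<^bsub>C i\<^esub>)\<rparr>"

definition dlim_structure_map ::
    "'i set \<Rightarrow> ('i \<Rightarrow> 'i \<Rightarrow> bool) \<Rightarrow> ('i \<Rightarrow> 'c monoid) \<Rightarrow> ('i \<Rightarrow> 'a \<Rightarrow> 'c)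
      \<Rightarrow> ('i \<Rightarrow> 'i \<Rightarrow> 'c \<Rightarrow> 'c) \<Rightarrow> 'a \<Rightarrow> ('i \<times> 'c) set" where
  "dlim_structure_map I leq C \<gamma> t a =
     (\<Union>i\<in>I. dlim_class I leq (\<lambda>i. carrier (C i)) t i (\<gamma> i a))"

text \<open>Hom sets consist of extensional functions, so that their elements are determined by their
  values on the carrier of the source.\<close>

definition Hom_Alg ::
    "'a monoid \<Rightarrow> 'b monoid \<Rightarrow> ('a \<Rightarrow> 'b) \<Rightarrow> 'c monoid \<Rightarrow> ('a \<Rightarrow> 'c) \<Rightarrow> ('b \<Rightarrow> 'c) set" where
  "Hom_Alg A B \<beta> C \<gamma> = algebra_hom A B \<beta> C \<gamma> \<inter> extensional (carrier B)"

definition finite_presentation ::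
    "'u itself \<Rightarrow> 'a monoid \<Rightarrow> 'b monoid \<Rightarrow> ('a \<Rightarrow> 'b) \<Rightarrow> bool" where
  "finite_presentation _ A B \<phi> \<longleftrightarrow>
     (\<forall>(I :: 'u set) leq (C :: 'u \<Rightarrow> 'u monoid) \<gamma> t.
        direct_system A I leq C \<gamma> t \<longrightarrow>
        bij_betw
          (\<lambda>p. \<lambda>b\<in>carrier B. \<Union>(i, h)\<in>p. dlim_class I leq (\<lambda>i. carrier (C i)) t i (h b))
          (dlim I leq (\<lambda>i. Hom_Alg A B \<phi> (C i) (\<gamma> i)) (\<lambda>i j h. \<lambda>b\<in>carrier B. t i j (h b)))
          (Hom_Alg A B \<phi> (dlim_monoid I leq C t) (dlim_structure_map I leq C \<gamma> t)))"


section \<open>Localization\<close>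

definition gen_submonoid :: "'a monoid \<Rightarrow> 'a set \<Rightarrow> 'a set" where
  "gen_submonoid M S = (\<lambda>H. submonoid H M) hull S"

definition loc_rel :: "'a monoid \<Rightarrow> 'a set \<Rightarrow> (('a \<times> 'a) \<times> ('a \<times> 'a)) set" where
  "loc_rel M S =
     {((m, s), (n, t)). m \<in> carrier M \<and> n \<in> carrier M \<and> s \<in> gen_submonoid M S \<and> t \<in> gen_submonoid M S \<and>
        (\<exists>u\<in>gen_submonoid M S. u \<otimes>\<^bsub>M\<^esub> (t \<otimes>\<^bsub>M\<^esub> m) = u \<otimes>\<^bsub>M\<^esub> (s \<otimes>\<^bsub>M\<^esub> n))}"

definition loc_frac :: "'a monoid \<Rightarrow> 'a set \<Rightarrow> 'a \<Rightarrow> 'a \<Rightarrow> ('a \<times> 'a) set" where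
  "loc_frac M S m s = loc_rel M S `` {(m, s)}"

definition localization :: "'a monoid \<Rightarrow> 'a set \<Rightarrow> ('a \<times> 'a) set monoid" where
  "localization M S =
     \<lparr>carrier = (carrier M \<times> gen_submonoid M S) // loc_rel M S,
      mult = (\<lambda>p q. \<Union>(m, s)\<in>p. \<Union>(n, t)\<in>q. loc_frac M S (m \<otimes>\<^bsub>M\<^esub> n) (s \<otimes>\<^bsub>M\<^esub> t)),
      one = loc_frac M S \<one>\<^bsub>M\<^esub> \<one>\<^bsub>M\<^esub>\<rparr>"

definition loc_map :: "'a monoid \<Rightarrow> 'a set \<Rightarrow> 'a \<Rightarrow> ('a \<times> 'a) set" where
  "loc_map M S m = loc_frac M S m \<one>\<^bsub>M\<^esub>"

text \<open>The map \<open>S\<^sup>-\<^sup>1M \<rightarrow> T\<^sup>-\<^sup>1N\<close> induced by a map \<open>\<phi>\<close> from \<open>M\<close> to \<open>N\<close> with \<open>\<phi>(S) \<subseteq> T\<close>.\<close>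

definition loc_induced :: "'b monoid \<Rightarrow> 'b set \<Rightarrow> ('a \<Rightarrow> 'b) \<Rightarrow> ('a \<times> 'a) set \<Rightarrow> ('b \<times> 'b) set" where
  "loc_induced N T \<phi> p = (\<Union>(m, s)\<in>p. loc_frac N T (\<phi> m) (\<phi> s))"


section \<open>Monoidal spaces\<close>

text \<open>A topological space with a presheaf of monoids: \<open>sect X U\<close> are the sections over \<open>U\<close> and
  \<open>restr X U V\<close> restricts sections from \<open>U\<close> to \<open>V \<subseteq> U\<close>.  Only open sets are relevant.\<close>

record ('p, 's) mspace =
  spc :: "'p topology"
  sect :: "'p set \<Rightarrow> 's monoid"
  restr :: "'p set \<Rightarrow> 'p set \<Rightarrow> 's \<Rightarrow> 's"

definition monoid_presheaf :: "('p, 's) mspace \<Rightarrow> bool" where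
  "monoid_presheaf X \<longleftrightarrow>
     (\<forall>U. openin (spc X) U \<longrightarrow> comm_monoid (sect X U)) \<and>
     (\<forall>U V. openin (spc X) U \<and> openin (spc X) V \<and> V \<subseteq> U \<longrightarrow>
        restr X U V \<in> monoid_hom (sect X U) (sect X V)) \<and>
     (\<forall>U. openin (spc X) U \<longrightarrow> (\<forall>s\<in>carrier (sect X U). restr X U U s = s)) \<and>
     (\<forall>U V W. openin (spc X) U \<and> openin (spc X) V \<and> openin (spc X) W \<and> W \<subseteq> V \<and> V \<subseteq> U \<longrightarrow>
        (\<forall>s\<in>carrier (sect X U). restr X V W (restr X U V s) = restr X U W s))"

definition monoidal_space :: "('p, 's) mspace \<Rightarrow> bool" where
  "monoidal_space X \<longleftrightarrow>
     monoid_presheaf X \<and>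
     (\<forall>\<U> \<sigma>.
        (\<forall>U\<in>\<U>. openin (spc X) U \<and> \<sigma> U \<in> carrier (sect X U)) \<and>
        (\<forall>U\<in>\<U>. \<forall>V\<in>\<U>. restr X U (U \<inter> V) (\<sigma> U) = restr X V (U \<inter> V) (\<sigma> V)) \<longrightarrow>
        (\<exists>!s. s \<in> carrier (sect X (\<Union>\<U>)) \<and> (\<forall>U\<in>\<U>. restr X (\<Union>\<U>) U s = \<sigma> U)))"

definition germ :: "('p, 's) mspace \<Rightarrow> 'p \<Rightarrow> 'p set \<Rightarrow> 's \<Rightarrow> ('p set \<times> 's) set" where
  "germ X x U s =
     {(V, t). openin (spc X) V \<and> x \<in> V \<and> t \<in> carrier (sect X V) \<and>
        (\<exists>W. openin (spc X) W \<and> x \<in> W \<and> W \<subseteq> U \<inter> V \<and> restr X U W s = restr X V W t)}"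

definition stalk :: "('p, 's) mspace \<Rightarrow> 'p \<Rightarrow> ('p set \<times> 's) set monoid" where
  "stalk X x =
     \<lparr>carrier = {germ X x U s | U s. openin (spc X) U \<and> x \<in> U \<and> s \<in> carrier (sect X U)},
      mult = (\<lambda>p q. \<Union>(U, s)\<in>p. \<Union>(V, t)\<in>q.
                germ X x (U \<inter> V) (restr X U (U \<inter> V) s \<otimes>\<^bsub>sect X (U \<inter> V)\<^esub> restr X V (U \<inter> V) t)),
      one = germ X x (topspace (spc X)) \<one>\<^bsub>sect X (topspace (spc X))\<^esub>\<rparr>"

text \<open>Data of a morphism \<open>X \<rightarrow> Y\<close>: the map \<open>base f\<close> on points, and for each open \<open>V\<close> of \<open>Y\<close>
  the map \<open>shf f V\<close> from sections of \<open>Y\<close> over \<open>V\<close> to sections of \<open>X\<close> over the preimage of \<open>V\<close>.\<close>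

record ('p, 's, 'q, 't) mspace_map =
  base :: "'p \<Rightarrow> 'q"
  shf :: "'q set \<Rightarrow> 't \<Rightarrow> 's"

definition preim :: "('p, 's) mspace \<Rightarrow> ('p, 's, 'q, 't) mspace_map \<Rightarrow> 'q set \<Rightarrow> 'p set" where
  "preim X f V = {x \<in> topspace (spc X). base f x \<in> V}"

definition stalk_map ::
    "('p, 's) mspace \<Rightarrow> ('p, 's, 'q, 't) mspace_map \<Rightarrow> 'p \<Rightarrow> ('q set \<times> 't) set \<Rightarrow> ('p set \<times> 's) set" where
  "stalk_map X f x p = (\<Union>(V, t)\<in>p. germ X x (preim X f V) (shf f V t))"

definition mspace_morphism ::
    "('p, 's) mspace \<Rightarrow> ('q, 't) mspace \<Rightarrow> ('p, 's, 'q, 't) mspace_map \<Rightarrow> bool" where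
  "mspace_morphism X Y f \<longleftrightarrow>
     monoidal_space X \<and> monoidal_space Y \<and>
     continuous_map (spc X) (spc Y) (base f) \<and>
     (\<forall>V. openin (spc Y) V \<longrightarrow> shf f V \<in> monoid_hom (sect Y V) (sect X (preim X f V))) \<and>
     (\<forall>V W. openin (spc Y) V \<and> openin (spc Y) W \<and> W \<subseteq> V \<longrightarrow>
        (\<forall>t\<in>carrier (sect Y V).
           shf f W (restr Y V W t) = restr X (preim X f V) (preim X f W) (shf f V t))) \<and>
     (\<forall>x\<in>topspace (spc X).
        {p \<in> carrier (stalk Y (base f x)). stalk_map X f x p \<in> Units (stalk X x)}
          = Units (stalk Y (base f x)))"

definition mspace_map_eq ::
    "('p, 's) mspace \<Rightarrow> ('q, 't) mspace \<Rightarrow> ('p, 's, 'q, 't) mspace_map \<Rightarrow>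
      ('p, 's, 'q, 't) mspace_map \<Rightarrow> bool" where
  "mspace_map_eq X Y f g \<longleftrightarrow>
     (\<forall>x\<in>topspace (spc X). base f x = base g x) \<and>
     (\<forall>V. openin (spc Y) V \<longrightarrow> (\<forall>t\<in>carrier (sect Y V). shf f V t = shf g V t))"

definition mspace_id :: "('p, 's, 'p, 's) mspace_map" where
  "mspace_id = \<lparr>base = (\<lambda>x. x), shf = (\<lambda>V t. t)\<rparr>"

text \<open>The composite \<open>X \<rightarrow> Y \<rightarrow> Z\<close> of \<open>f\<close> followed by \<open>g\<close>.\<close>

definition mspace_comp ::
    "('q, 't) mspace \<Rightarrow> ('q, 't, 'r, 'v) mspace_map \<Rightarrow> ('p, 's, 'q, 't) mspace_map \<Rightarrow>
      ('p, 's, 'r, 'v) mspace_map" where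
  "mspace_comp Y g f =
     \<lparr>base = (\<lambda>x. base g (base f x)), shf = (\<lambda>W t. shf f (preim Y g W) (shf g W t))\<rparr>"

definition mspace_iso ::
    "('p, 's) mspace \<Rightarrow> ('q, 't) mspace \<Rightarrow> ('p, 's, 'q, 't) mspace_map \<Rightarrow> bool" where
  "mspace_iso X Y f \<longleftrightarrow>
     mspace_morphism X Y f \<and>
     (\<exists>g. mspace_morphism Y X g \<and>
        mspace_map_eq X X (mspace_comp Y g f) mspace_id \<and>
        mspace_map_eq Y Y (mspace_comp X f g) mspace_id)"

definition open_subspace :: "('p, 's) mspace \<Rightarrow> 'p set \<Rightarrow> ('p, 's) mspace" where
  "open_subspace Y U = \<lparr>spc = subtopology (spc Y) U, sect = sect Y, restr = restr Y\<rparr>"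

definition open_inclusion :: "('p, 's) mspace \<Rightarrow> 'p set \<Rightarrow> ('p, 's, 'p, 's) mspace_map" where
  "open_inclusion Y U = \<lparr>base = (\<lambda>x. x), shf = (\<lambda>V. restr Y V (U \<inter> V))\<rparr>"

definition open_immersion ::
    "('p, 's) mspace \<Rightarrow> ('q, 't) mspace \<Rightarrow> ('p, 's, 'q, 't) mspace_map \<Rightarrow> bool" where
  "open_immersion X Y f \<longleftrightarrow>
     mspace_morphism X Y f \<and>
     (\<exists>U g. openin (spc Y) U \<and> mspace_iso X (open_subspace Y U) g \<and>
        mspace_map_eq X Y f (mspace_comp (open_subspace Y U) (open_inclusion Y U) g))"


section \<open>The spectrum of a monoid\<close>

definition prime_ideal :: "'a monoid \<Rightarrow> 'a set \<Rightarrow> bool" where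
  "prime_ideal M p \<longleftrightarrow>
     p \<subseteq> carrier M \<and> p <#>\<^bsub>M\<^esub> carrier M = p \<and> submonoid (carrier M - p) M"

definition Spec_points :: "'a monoid \<Rightarrow> 'a set set" where
  "Spec_points M = {p. prime_ideal M p}"

definition Spec_topology :: "'a monoid \<Rightarrow> 'a set topology" where
  "Spec_topology M =
     topology (\<lambda>U. \<exists>I\<subseteq>carrier M. U = Spec_points M - {p \<in> Spec_points M. I \<subseteq> p})"

text \<open>Sections of the structure sheaf are families of elements of the localizations \<open>M\<^sub>p\<close> at the
  prime ideals that are given locally by fractions.\<close>

definition Spec_sections :: "'a monoid \<Rightarrow> 'a set set \<Rightarrow> ('a set \<Rightarrow> ('a \<times> 'a) set) monoid" where
  "Spec_sections M U =
     \<lparr>carrier =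
        {s \<in> \<Pi>\<^sub>E p\<in>U. carrier (localization M (carrier M - p)).
           \<forall>p\<in>U. \<exists>V. openin (Spec_topology M) V \<and> p \<in> V \<and> V \<subseteq> U \<and>
             (\<exists>m\<in>carrier M. \<exists>a\<in>carrier M. \<forall>q\<in>V. a \<notin> q \<and> s q = loc_frac M (carrier M - q) m a)},
      mult = (\<lambda>s t. \<lambda>p\<in>U. s p \<otimes>\<^bsub>localization M (carrier M - p)\<^esub> t p),
      one = (\<lambda>p\<in>U. \<one>\<^bsub>localization M (carrier M - p)\<^esub>)\<rparr>"

definition Spec :: "'a monoid \<Rightarrow> ('a set, 'a set \<Rightarrow> ('a \<times> 'a) set) mspace" where
  "Spec M = \<lparr>spc = Spec_topology M, sect = Spec_sections M, restr = (\<lambda>U V s. restrict s V)\<rparr>"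

definition Spec_map ::
    "'a monoid \<Rightarrow> 'b monoid \<Rightarrow> ('a \<Rightarrow> 'b) \<Rightarrow>
      ('b set, 'b set \<Rightarrow> ('b \<times> 'b) set, 'a set, 'a set \<Rightarrow> ('a \<times> 'a) set) mspace_map" where
  "Spec_map M N \<phi> =
     \<lparr>base = (\<lambda>q. {m \<in> carrier M. \<phi> m \<in> q}),
      shf = (\<lambda>V s. \<lambda>q\<in>{q \<in> Spec_points N. {m \<in> carrier M. \<phi> m \<in> q} \<in> V}.
               loc_induced N (carrier N - q) \<phi> (s {m \<in> carrier M. \<phi> m \<in> q}))\<rparr>"


section \<open>Basic facts about localizations\<close>

lemma gen_submonoid_submonoid:
  assumes "comm_monoid M" and "S \<subseteq> carrier M"
  shows "submonoid (gen_submonoid M S) M"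
proof -
  interpret comm_monoid M by fact
  have "submonoid (carrier M) M" by (simp add: submonoid_def)
  then show ?thesis
    using assms(2) unfolding gen_submonoid_def hull_def
    by (auto simp: submonoid_def)
qed

lemma gen_submonoid_eq:
  assumes "submonoid H M"
  shows "gen_submonoid M H = H"
  using assms hull_same unfolding gen_submonoid_def by metis

lemma subset_gen_submonoid: "S \<subseteq> gen_submonoid M S"
  unfolding gen_submonoid_def by (rule hull_subset)

locale monoid_loc = comm_monoid M for M :: "'a monoid" (structure) +
  fixes S assumes S: "S \<subseteq> carrier M"
begin

abbreviation (input) "H \<equiv> gen_submonoid M S"

lemma H: "submonoid H M"
  using gen_submonoid_submonoid comm_monoid_axioms S by blast

lemma H_carrier [simp]: "s \<in> H \<Longrightarrow> s \<in> carrier M"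
  using H submonoid.subset by blast
lemma H_one [simp]: "\<one> \<in> H" using H submonoid.one_closed by blast
lemma H_mult [simp]: "s \<in> H \<Longrightarrow> t \<in> H \<Longrightarrow> s \<otimes> t \<in> H"
  using H submonoid.m_closed by metis

lemma loc_equiv: "equiv (carrier M \<times> H) (loc_rel M S)"
proof (rule equivI)
  show "loc_rel M S \<subseteq> (carrier M \<times> H) \<times> carrier M \<times> H" by (auto simp: loc_rel_def)
  show "refl_on (carrier M \<times> H) (loc_rel M S)"
    by (rule refl_onI) (auto simp: loc_rel_def intro!: bexI[of _ "\<one>"])
  show "sym (loc_rel M S)" by (rule symI) (force simp: loc_rel_def)
  show "trans (loc_rel M S)"
  proof (rule transI)
    fix x y z assume "(x, y) \<in> loc_rel M S" "(y, z) \<in> loc_rel M S"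
    then obtain a s b t c r u v where e: "x = (a,s)" "y = (b,t)" "z = (c,r)"
      "a \<in> carrier M" "b \<in> carrier M" "c \<in> carrier M" "s \<in> H" "t \<in> H" "r \<in> H" "u \<in> H" "v \<in> H"
      and 1: "u \<otimes> (t \<otimes> a) = u \<otimes> (s \<otimes> b)" and 2: "v \<otimes> (r \<otimes> b) = v \<otimes> (t \<otimes> c)"
      unfolding loc_rel_def by auto
    have "(u \<otimes> v \<otimes> t) \<otimes> (r \<otimes> a) = (v \<otimes> r) \<otimes> (u \<otimes> (t \<otimes> a))" using e by (simp add: m_ac)
    also have "\<dots> = (u \<otimes> s) \<otimes> (v \<otimes> (r \<otimes> b))" unfolding 1 using e by (simp add: m_ac)
    also have "\<dots> = (u \<otimes> v \<otimes> t) \<otimes> (s \<otimes> c)" unfolding 2 using e by (simp add: m_ac)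
    finally show "(x, z) \<in> loc_rel M S" using e unfolding loc_rel_def
      by (auto intro!: bexI[of _ "u \<otimes> v \<otimes> t"])
  qed
qed

lemma frac_eq_iff:
  assumes "m \<in> carrier M" "n \<in> carrier M" "s \<in> H" "t \<in> H"
  shows "loc_frac M S m s = loc_frac M S n t \<longleftrightarrow> (\<exists>u\<in>H. u \<otimes> (t \<otimes> m) = u \<otimes> (s \<otimes> n))"
  using eq_equiv_class_iff[OF loc_equiv, of "(m,s)" "(n,t)"] assms
  unfolding loc_frac_def loc_rel_def by auto

lemma mem_frac_iff:
  assumes "m \<in> carrier M" "s \<in> H"
  shows "(n, t) \<in> loc_frac M S m s \<longleftrightarrow> n \<in> carrier M \<and> t \<in> H \<and> loc_frac M S n t = loc_frac M S m s"
  using equiv_class_eq_iff[OF loc_equiv, of "(m,s)" "(n,t)"] assms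
  unfolding loc_frac_def by auto

lemma frac_self: "m \<in> carrier M \<Longrightarrow> s \<in> H \<Longrightarrow> (m, s) \<in> loc_frac M S m s"
  by (simp add: mem_frac_iff)

lemma frac_closed [simp]: "m \<in> carrier M \<Longrightarrow> s \<in> H \<Longrightarrow> loc_frac M S m s \<in> carrier (localization M S)"
  by (auto simp: localization_def loc_frac_def intro: quotientI)

lemma loc_cases:
  assumes "p \<in> carrier (localization M S)"
  obtains m s where "m \<in> carrier M" "s \<in> H" "p = loc_frac M S m s"
  using assms by (auto simp: localization_def loc_frac_def quotient_def)

lemma loc_one: "\<one>\<^bsub>localization M S\<^esub> = loc_frac M S \<one> \<one>" by (simp add: localization_def)

lemma UN_frac:
  assumes "m \<in> carrier M" "s \<in> H"
    and "\<And>n t. n \<in> carrier M \<Longrightarrow> t \<in> H \<Longrightarrow> loc_frac M S n t = loc_frac M S m s \<Longrightarrow> f n t = f m s"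
  shows "(\<Union>(n,t)\<in>loc_frac M S m s. f n t) = f m s"
proof -
  have "(\<Union>p\<in>loc_frac M S m s. case p of (n,t) \<Rightarrow> f n t) = (\<Union>p\<in>loc_frac M S m s. f m s)"
  proof (rule SUP_cong)
    fix p assume p: "p \<in> loc_frac M S m s"
    obtain n t where nt: "p = (n, t)" by (cases p)
    have "n \<in> carrier M" "t \<in> H" "loc_frac M S n t = loc_frac M S m s"
      using p mem_frac_iff[OF assms(1,2)] unfolding nt by blast+
    then have "f n t = f m s" by (rule assms(3))
    then show "(case p of (n,t) \<Rightarrow> f n t) = f m s" by (simp add: nt)
  qed simp
  then show ?thesis using frac_self[OF assms(1,2)] by auto
qed

lemma frac_cong_mult:
  assumes "m \<in> carrier M" "n \<in> carrier M" "s \<in> H" "t \<in> H"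
    "m' \<in> carrier M" "n' \<in> carrier M" "s' \<in> H" "t' \<in> H"
    "loc_frac M S m s = loc_frac M S m' s'" "loc_frac M S n t = loc_frac M S n' t'"
  shows "loc_frac M S (m \<otimes> n) (s \<otimes> t) = loc_frac M S (m' \<otimes> n') (s' \<otimes> t')"
proof -
  obtain u v where uv: "u \<in> H" "v \<in> H" "u \<otimes> (s' \<otimes> m) = u \<otimes> (s \<otimes> m')" "v \<otimes> (t' \<otimes> n) = v \<otimes> (t \<otimes> n')"
    using assms by (auto simp: frac_eq_iff)
  have "(u \<otimes> v) \<otimes> ((s' \<otimes> t') \<otimes> (m \<otimes> n)) = (u \<otimes> (s' \<otimes> m)) \<otimes> (v \<otimes> (t' \<otimes> n))"
    using assms uv(1,2) by (simp add: m_ac)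
  also have "\<dots> = (u \<otimes> v) \<otimes> ((s \<otimes> t) \<otimes> (m' \<otimes> n'))"
    unfolding uv(3,4) using assms uv(1,2) by (simp add: m_ac)
  finally show ?thesis using assms uv(1,2) by (auto simp: frac_eq_iff intro!: bexI[of _ "u \<otimes> v"])
qed

lemma frac_mult:
  assumes "m \<in> carrier M" "n \<in> carrier M" "s \<in> H" "t \<in> H"
  shows "loc_frac M S m s \<otimes>\<^bsub>localization M S\<^esub> loc_frac M S n t = loc_frac M S (m \<otimes> n) (s \<otimes> t)"
proof -
  have "(\<Union>(b, d)\<in>loc_frac M S n t. loc_frac M S (a \<otimes> b) (c \<otimes> d)) = loc_frac M S (a \<otimes> n) (c \<otimes> t)"
    if "a \<in> carrier M" "c \<in> H" for a c
    using that assms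
    by (intro UN_frac[where f = "\<lambda>b d. loc_frac M S (a \<otimes> b) (c \<otimes> d)"] frac_cong_mult) simp_all
  note inner = this
  have "(\<Union>(a, c)\<in>loc_frac M S m s. \<Union>(b, d)\<in>loc_frac M S n t. loc_frac M S (a \<otimes> b) (c \<otimes> d))
    = (\<Union>(a, c)\<in>loc_frac M S m s. loc_frac M S (a \<otimes> n) (c \<otimes> t))"
  proof (rule SUP_cong)
    fix p assume p: "p \<in> loc_frac M S m s"
    obtain a c where ac: "p = (a, c)" by (cases p)
    have "a \<in> carrier M" "c \<in> H"
      using p mem_frac_iff[OF assms(1,3)] unfolding ac by blast+
    then show "(case p of (a, c) \<Rightarrow> \<Union>(b, d)\<in>loc_frac M S n t. loc_frac M S (a \<otimes> b) (c \<otimes> d)) =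
       (case p of (a, c) \<Rightarrow> loc_frac M S (a \<otimes> n) (c \<otimes> t))"
      unfolding ac prod.case by (rule inner)
  qed simp
  also have "\<dots> = loc_frac M S (m \<otimes> n) (s \<otimes> t)"
    using assms
    by (intro UN_frac[where f = "\<lambda>a c. loc_frac M S (a \<otimes> n) (c \<otimes> t)"] frac_cong_mult) simp_all
  finally show ?thesis by (simp add: localization_def)
qed

lemma comm_monoid_localization: "comm_monoid (localization M S)"
  apply (rule comm_monoidI)
  by (auto elim!: loc_cases simp: frac_mult loc_one m_ac)

lemma loc_map_hom: "loc_map M S \<in> monoid_hom M (localization M S)"
  by (auto simp: monoid_hom_def hom_def loc_map_def frac_mult loc_one)

lemma frac_cancel: "m \<in> carrier M \<Longrightarrow> s \<in> H \<Longrightarrow> t \<in> H \<Longrightarrow> loc_frac M S (t \<otimes> m) (t \<otimes> s) = loc_frac M S m s"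
  by (auto simp: frac_eq_iff m_ac intro!: bexI[of _ \<one>])

lemma frac_diag: "s \<in> H \<Longrightarrow> loc_frac M S s s = loc_frac M S \<one> \<one>"
  by (auto simp: frac_eq_iff m_ac intro!: bexI[of _ \<one>])

lemma loc_map_Units:
  assumes "s \<in> H" shows "loc_map M S s \<in> Units (localization M S)"
proof -
  interpret L: comm_monoid "localization M S" by (rule comm_monoid_localization)
  have e: "loc_frac M S \<one> s \<otimes>\<^bsub>localization M S\<^esub> loc_map M S s = \<one>\<^bsub>localization M S\<^esub>"
    unfolding loc_map_def loc_one using assms frac_diag[OF assms] by (simp add: frac_mult)
  moreover have c: "loc_map M S s \<in> carrier (localization M S)" "loc_frac M S \<one> s \<in> carrier (localization M S)"
    using assms by (simp_all add: loc_map_def)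
  ultimately have "loc_map M S s \<otimes>\<^bsub>localization M S\<^esub> loc_frac M S \<one> s = \<one>\<^bsub>localization M S\<^esub>"
    using L.m_comm e by metis
  with e c show ?thesis unfolding Units_def by blast
qed

lemma localization_universal:
  fixes P :: "'c monoid"
  assumes "comm_monoid P" "f \<in> monoid_hom M P" "f ` S \<subseteq> Units P"
  shows "\<exists>!g. g \<in> monoid_hom (localization M S) P \<inter> extensional (carrier (localization M S)) \<and>
     (\<forall>m\<in>carrier M. g (loc_map M S m) = f m)"
proof -
  interpret P: comm_monoid P by fact
  let ?L = "localization M S"
  interpret L: comm_monoid ?L by (rule comm_monoid_localization)
  have fc: "f m \<in> carrier P" if "m \<in> carrier M" for m using assms(2) that by (auto simp: monoid_hom_def hom_def)
  have fm: "f (m \<otimes> n) = f m \<otimes>\<^bsub>P\<^esub> f n" if "m \<in> carrier M" "n \<in> carrier M" for m n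
    using assms(2) that by (auto simp: monoid_hom_def hom_def)
  have f1: "f \<one> = \<one>\<^bsub>P\<^esub>" using assms(2) by (auto simp: monoid_hom_def)
  have "submonoid {s \<in> carrier M. f s \<in> Units P} M"
    by (auto simp: submonoid_def fm f1)
  then have "H \<subseteq> {s \<in> carrier M. f s \<in> Units P}"
    unfolding gen_submonoid_def using S assms(3) by (intro hull_minimal) auto
  then have fH: "f s \<in> Units P" if "s \<in> H" for s using that by auto
  have wd: "f m \<otimes>\<^bsub>P\<^esub> inv\<^bsub>P\<^esub> f s = f n \<otimes>\<^bsub>P\<^esub> inv\<^bsub>P\<^esub> f t"
    if h: "loc_frac M S m s = loc_frac M S n t" "m \<in> carrier M" "n \<in> carrier M" "s \<in> H" "t \<in> H" for m n s t
  proof -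
    obtain u where u: "u \<in> H" "u \<otimes> (t \<otimes> m) = u \<otimes> (s \<otimes> n)" using h frac_eq_iff[of m n s t] by auto
    have "f u \<otimes>\<^bsub>P\<^esub> (f t \<otimes>\<^bsub>P\<^esub> f m) = f u \<otimes>\<^bsub>P\<^esub> (f s \<otimes>\<^bsub>P\<^esub> f n)"
      using arg_cong[OF u(2), of f] that u(1) by (simp add: fm)
    then have e: "f t \<otimes>\<^bsub>P\<^esub> f m = f s \<otimes>\<^bsub>P\<^esub> f n"
      using that u(1) fH fc P.Units_l_cancel by (metis H_carrier P.m_closed)
    have [simp]: "f m \<in> carrier P" "f n \<in> carrier P" "f s \<in> carrier P" "f t \<in> carrier P" "f s \<in> Units P" "f t \<in> Units P"
      using that fc fH by auto
    have "f m \<otimes>\<^bsub>P\<^esub> inv\<^bsub>P\<^esub> f s = (f t \<otimes>\<^bsub>P\<^esub> f m) \<otimes>\<^bsub>P\<^esub> (inv\<^bsub>P\<^esub> f s \<otimes>\<^bsub>P\<^esub> inv\<^bsub>P\<^esub> f t)"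
      by (simp add: P.m_ac)
    also have "\<dots> = f n \<otimes>\<^bsub>P\<^esub> inv\<^bsub>P\<^esub> f t"
    proof -
      have "f s \<otimes>\<^bsub>P\<^esub> (inv\<^bsub>P\<^esub> f s \<otimes>\<^bsub>P\<^esub> inv\<^bsub>P\<^esub> f t) = inv\<^bsub>P\<^esub> f t"
        by (simp add: P.m_assoc[symmetric])
      then show ?thesis unfolding e by (simp add: P.m_ac)
    qed
    finally show ?thesis .
  qed
  define g where "g = (\<lambda>p\<in>carrier ?L. THE x. \<exists>m\<in>carrier M. \<exists>s\<in>H. p = loc_frac M S m s \<and> x = f m \<otimes>\<^bsub>P\<^esub> inv\<^bsub>P\<^esub> f s)"
  have g: "g (loc_frac M S m s) = f m \<otimes>\<^bsub>P\<^esub> inv\<^bsub>P\<^esub> f s" if "m \<in> carrier M" "s \<in> H" for m s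
    unfolding g_def using that by (auto intro!: the_equality dest: wd)
  show ?thesis
  proof (rule ex1I[of _ g], intro conjI ballI IntI)
    show "g \<in> monoid_hom ?L P" unfolding monoid_hom_def hom_def
    proof (safe)
      fix p assume "p \<in> carrier ?L" then show "g p \<in> carrier P" by (auto elim!: loc_cases simp: g fc fH)
    next
      fix p q assume "p \<in> carrier ?L" "q \<in> carrier ?L"
      then obtain m s n t where [simp]: "m \<in> carrier M" "s \<in> H" "p = loc_frac M S m s" "n \<in> carrier M" "t \<in> H" "q = loc_frac M S n t"
        by (metis loc_cases)
      have [simp]: "f m \<in> carrier P" "f n \<in> carrier P" "f s \<in> carrier P" "f t \<in> carrier P" "f s \<in> Units P" "f t \<in> Units P"
        using fc fH by auto
      have c: "f s \<otimes>\<^bsub>P\<^esub> (inv\<^bsub>P\<^esub> f s \<otimes>\<^bsub>P\<^esub> x) = x" if "x \<in> carrier P" for x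
        using that by (simp add: P.m_assoc[symmetric])
      have "(f s \<otimes>\<^bsub>P\<^esub> f t) \<otimes>\<^bsub>P\<^esub> (inv\<^bsub>P\<^esub> f s \<otimes>\<^bsub>P\<^esub> inv\<^bsub>P\<^esub> f t)
          = (f s \<otimes>\<^bsub>P\<^esub> inv\<^bsub>P\<^esub> f s) \<otimes>\<^bsub>P\<^esub> (f t \<otimes>\<^bsub>P\<^esub> inv\<^bsub>P\<^esub> f t)"
        by (simp add: P.m_ac del: P.Units_r_inv P.Units_l_inv)
      then have h: "(f s \<otimes>\<^bsub>P\<^esub> f t) \<otimes>\<^bsub>P\<^esub> (inv\<^bsub>P\<^esub> f s \<otimes>\<^bsub>P\<^esub> inv\<^bsub>P\<^esub> f t) = \<one>\<^bsub>P\<^esub>" by simp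
      have "inv\<^bsub>P\<^esub> (f s \<otimes>\<^bsub>P\<^esub> f t) = inv\<^bsub>P\<^esub> f s \<otimes>\<^bsub>P\<^esub> inv\<^bsub>P\<^esub> f t"
        by (rule P.inv_unique[OF P.Units_l_inv h]) simp_all
      then show "g (p \<otimes>\<^bsub>?L\<^esub> q) = g p \<otimes>\<^bsub>P\<^esub> g q"
        by (simp add: frac_mult g fm P.m_ac)
    next
      show "g \<one>\<^bsub>?L\<^esub> = \<one>\<^bsub>P\<^esub>" by (simp add: loc_one g f1)
    qed
    show "g \<in> extensional (carrier ?L)" by (simp add: g_def)
    show "g (loc_map M S m) = f m" if "m \<in> carrier M" for m using that fc by (simp add: loc_map_def g f1)
  next
    fix h assume h: "h \<in> monoid_hom ?L P \<inter> extensional (carrier ?L) \<and> (\<forall>m\<in>carrier M. h (loc_map M S m) = f m)"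
    show "h = g"
    proof (rule extensionalityI[of _ "carrier ?L"])
      show "h \<in> extensional (carrier ?L)" using h by auto
      show "g \<in> extensional (carrier ?L)" by (simp add: g_def)
      fix p assume "p \<in> carrier ?L"
      then obtain m s where [simp]: "m \<in> carrier M" "s \<in> H" "p = loc_frac M S m s" by (metis loc_cases)
      have "h p \<otimes>\<^bsub>P\<^esub> f s = h (p \<otimes>\<^bsub>?L\<^esub> loc_map M S s)"
        using h by (auto simp: monoid_hom_def hom_def loc_map_def)
      also have "p \<otimes>\<^bsub>?L\<^esub> loc_map M S s = loc_map M S m"
        using frac_cancel[of m \<one> s] by (simp add: loc_map_def frac_mult m_comm)
      finally have "h p \<otimes>\<^bsub>P\<^esub> f s = f m" using h by auto
      moreover have "h p \<in> carrier P" using h by (auto simp: monoid_hom_def hom_def)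
      ultimately have "h p = f m \<otimes>\<^bsub>P\<^esub> inv\<^bsub>P\<^esub> f s"
        using fH fc by (metis H_carrier P.Units_inv_closed P.Units_r_inv P.m_assoc P.r_one \<open>s \<in> H\<close>)
      then show "h p = g p" by (simp add: g)
    qed
  qed
qed

end


section \<open>Spectra are monoidal spaces and homomorphisms induce morphisms\<close>

locale spec_monoid = comm_monoid G for G :: "'a monoid" (structure)
begin

lemma prime_mult_closed: "prime_ideal G p \<Longrightarrow> i \<in> p \<Longrightarrow> j \<in> carrier G \<Longrightarrow> i \<otimes> j \<in> p"
  unfolding prime_ideal_def set_mult_def by blast

lemma prime_compl: "prime_ideal G p \<Longrightarrow> submonoid (carrier G - p) G"
  unfolding prime_ideal_def by blast

lemma prime_subset: "prime_ideal G p \<Longrightarrow> i \<in> p \<Longrightarrow> i \<in> carrier G"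
  unfolding prime_ideal_def by blast

lemma prime_mult_iff:
  assumes "prime_ideal G p" "i \<in> carrier G" "j \<in> carrier G"
  shows "i \<otimes> j \<in> p \<longleftrightarrow> i \<in> p \<or> j \<in> p"
  using assms prime_mult_closed[of p i j] prime_mult_closed[of p j i] m_comm[of i j]
    submonoid.m_closed[OF prime_compl, of p i j] by auto

lemma prime_one: "prime_ideal G p \<Longrightarrow> \<one> \<notin> p"
  using submonoid.one_closed[OF prime_compl] by blast

lemma istopology_Spec:
  "istopology (\<lambda>U. \<exists>I\<subseteq>carrier G. U = Spec_points G - {p \<in> Spec_points G. I \<subseteq> p})"
  unfolding istopology_def
proof (intro conjI allI impI)
  fix U V
  assume "\<exists>I\<subseteq>carrier G. U = Spec_points G - {p \<in> Spec_points G. I \<subseteq> p}"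
    and "\<exists>I\<subseteq>carrier G. V = Spec_points G - {p \<in> Spec_points G. I \<subseteq> p}"
  then obtain I J where I: "I \<subseteq> carrier G" "U = Spec_points G - {p \<in> Spec_points G. I \<subseteq> p}"
    and J: "J \<subseteq> carrier G" "V = Spec_points G - {p \<in> Spec_points G. J \<subseteq> p}" by blast
  have "I <#> J \<subseteq> p \<longleftrightarrow> I \<subseteq> p \<or> J \<subseteq> p" if "p \<in> Spec_points G" for p
    using that I(1) J(1) prime_mult_iff[of p] unfolding Spec_points_def set_mult_def by blast
  then have "U \<inter> V = Spec_points G - {p \<in> Spec_points G. I <#> J \<subseteq> p}"
    unfolding I(2) J(2) by blast
  moreover have "I <#> J \<subseteq> carrier G" using I(1) J(1) by (auto simp: set_mult_def)
  ultimately show "\<exists>I\<subseteq>carrier G. U \<inter> V = Spec_points G - {p \<in> Spec_points G. I \<subseteq> p}"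
    by blast
next
  fix \<K> assume "\<forall>K\<in>\<K>. \<exists>I\<subseteq>carrier G. K = Spec_points G - {p \<in> Spec_points G. I \<subseteq> p}"
  then obtain I where I: "\<And>K. K \<in> \<K> \<Longrightarrow> I K \<subseteq> carrier G \<and> K = Spec_points G - {p \<in> Spec_points G. I K \<subseteq> p}"
    by metis
  show "\<exists>I\<subseteq>carrier G. \<Union>\<K> = Spec_points G - {p \<in> Spec_points G. I \<subseteq> p}"
    using I by (intro exI[of _ "\<Union>(I ` \<K>)"]) blast
qed

lemma openin_Spec:
  "openin (Spec_topology G) U \<longleftrightarrow> (\<exists>I\<subseteq>carrier G. U = Spec_points G - {p \<in> Spec_points G. I \<subseteq> p})"
  unfolding Spec_topology_def topology_inverse'[OF istopology_Spec] ..

lemma topspace_Spec: "topspace (Spec_topology G) = Spec_points G"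
proof -
  have "openin (Spec_topology G) (Spec_points G)"
    unfolding openin_Spec using prime_one
    by (intro exI[of _ "{\<one>}"]) (auto simp: Spec_points_def)
  moreover have "U \<subseteq> Spec_points G" if "openin (Spec_topology G) U" for U
    using that unfolding openin_Spec by blast
  ultimately show ?thesis
    unfolding topspace_def by blast
qed

lemma openin_D: "a \<in> carrier G \<Longrightarrow> openin (Spec_topology G) {p \<in> Spec_points G. a \<notin> p}"
  unfolding openin_Spec by (intro exI[of _ "{a}"]) auto

abbreviation (input) "L p \<equiv> localization G (carrier G - p)"
abbreviation (input) "fr p \<equiv> loc_frac G (carrier G - p)"

lemma monoid_loc: "monoid_loc G (carrier G - p)"
  by unfold_locales auto

lemma gen_prime: "prime_ideal G p \<Longrightarrow> gen_submonoid G (carrier G - p) = carrier G - p"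
  using gen_submonoid_eq prime_compl by blast

lemma L_comm_monoid: "comm_monoid (L p)"
  using monoid_loc.comm_monoid_localization[OF monoid_loc] .

lemma L_mult: "\<lbrakk>prime_ideal G p; m \<in> carrier G; n \<in> carrier G; a \<in> carrier G; b \<in> carrier G; a \<notin> p; b \<notin> p\<rbrakk>
   \<Longrightarrow> fr p m a \<otimes>\<^bsub>L p\<^esub> fr p n b = fr p (m \<otimes> n) (a \<otimes> b)"
  using monoid_loc.frac_mult[OF monoid_loc, of m n a p b] gen_prime[of p] by auto

lemma L_closed: "\<lbrakk>prime_ideal G p; m \<in> carrier G; a \<in> carrier G; a \<notin> p\<rbrakk> \<Longrightarrow> fr p m a \<in> carrier (L p)"
  using monoid_loc.frac_closed[OF monoid_loc, of m a p] gen_prime[of p] by auto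

lemma L_one: "\<one>\<^bsub>L p\<^esub> = fr p \<one> \<one>" by (simp add: localization_def)

lemma L_eq_iff: "\<lbrakk>prime_ideal G p; m \<in> carrier G; n \<in> carrier G; a \<in> carrier G; b \<in> carrier G; a \<notin> p; b \<notin> p\<rbrakk>
   \<Longrightarrow> fr p m a = fr p n b \<longleftrightarrow> (\<exists>u\<in>carrier G - p. u \<otimes> (b \<otimes> m) = u \<otimes> (a \<otimes> n))"
  using monoid_loc.frac_eq_iff[OF monoid_loc, of m n a p b] gen_prime[of p] by auto

lemma L_cases:
  assumes "prime_ideal G p" "x \<in> carrier (L p)"
  obtains m a where "m \<in> carrier G" "a \<in> carrier G" "a \<notin> p" "x = fr p m a"
  using monoid_loc.loc_cases[OF monoid_loc assms(2)] gen_prime[OF assms(1)] by (metis DiffD1 DiffD2)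

lemma L_unit:
  assumes p: "prime_ideal G p" and c: "m \<in> carrier G" "a \<in> carrier G" "a \<notin> p"
  shows "fr p m a \<in> Units (L p) \<longleftrightarrow> m \<notin> p"
proof
  interpret L: comm_monoid "L p" by (rule L_comm_monoid)
  assume "fr p m a \<in> Units (L p)"
  then obtain y where "y \<in> carrier (L p)" "fr p m a \<otimes>\<^bsub>L p\<^esub> y = \<one>\<^bsub>L p\<^esub>" unfolding Units_def by blast
  then obtain n b where nb: "n \<in> carrier G" "b \<in> carrier G" "b \<notin> p" and e: "fr p m a \<otimes>\<^bsub>L p\<^esub> fr p n b = fr p \<one> \<one>"
    using L_cases[OF p] L_one by metis
  then have "fr p (m \<otimes> n) (a \<otimes> b) = fr p \<one> \<one>" using L_mult[OF p] c by simp
  then obtain u where u: "u \<in> carrier G - p" "u \<otimes> (\<one> \<otimes> (m \<otimes> n)) = u \<otimes> (a \<otimes> b \<otimes> \<one>)"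
    using L_eq_iff[OF p, of "m \<otimes> n" \<one> "a \<otimes> b" \<one>] c nb prime_one[OF p] prime_mult_iff[OF p] by auto
  then have "u \<otimes> (m \<otimes> n) = u \<otimes> (a \<otimes> b)" using c nb by simp
  then show "m \<notin> p" using u(1) c nb prime_mult_iff[OF p] by (metis Diff_iff m_closed)
next
  interpret L: comm_monoid "L p" by (rule L_comm_monoid)
  assume m: "m \<notin> p"
  have ma: "a \<otimes> m \<notin> p" "m \<otimes> a \<notin> p" using m c prime_mult_iff[OF p] by auto
  have "fr p (m \<otimes> a) (a \<otimes> m) = fr p \<one> \<one>"
    using L_eq_iff[OF p, of "m \<otimes> a" \<one> "a \<otimes> m" \<one>] c ma prime_one[OF p]
    by (auto intro!: bexI[of _ \<one>] simp: m_comm)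
  then have e: "fr p m a \<otimes>\<^bsub>L p\<^esub> fr p a m = \<one>\<^bsub>L p\<^esub>"
    using L_mult[OF p, of m a a m] c m by (simp add: L_one)
  have cl: "fr p m a \<in> carrier (L p)" "fr p a m \<in> carrier (L p)" using L_closed[OF p] c m by auto
  then have "fr p a m \<otimes>\<^bsub>L p\<^esub> fr p m a = \<one>\<^bsub>L p\<^esub>" using e L.m_comm by metis
  then show "fr p m a \<in> Units (L p)" using e cl unfolding Units_def by blast
qed

abbreviation (input) "opn \<equiv> openin (Spec_topology G)"
abbreviation (input) "Sc U \<equiv> Spec_sections G U"

lemma opn_pt: "opn U \<Longrightarrow> p \<in> U \<Longrightarrow> prime_ideal G p"
  using openin_subset[of "Spec_topology G" U] topspace_Spec by (auto simp: Spec_points_def)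

lemma secI:
  assumes "s \<in> extensional U"
    "\<And>p. p \<in> U \<Longrightarrow> \<exists>V m a. opn V \<and> p \<in> V \<and> V \<subseteq> U \<and> m \<in> carrier G \<and> a \<in> carrier G \<and> (\<forall>q\<in>V. a \<notin> q \<and> s q = fr q m a)"
  shows "s \<in> carrier (Sc U)"
proof -
  have "s p \<in> carrier (L p)" if "p \<in> U" for p
  proof -
    from assms(2)[OF that] obtain V m a where h: "opn V \<and> p \<in> V \<and> V \<subseteq> U \<and> m \<in> carrier G \<and> a \<in> carrier G \<and> (\<forall>q\<in>V. a \<notin> q \<and> s q = fr q m a)"
      by (elim exE)
    then have "p \<in> V" by simp
    with h have "a \<notin> p" "s p = fr p m a" by simp_all
    with h show ?thesis using L_closed[of p m a] opn_pt[of V p] by simp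
  qed
  then have "s \<in> (\<Pi>\<^sub>E p\<in>U. carrier (L p))" using assms(1) by (auto simp: PiE_def)
  moreover have "\<forall>p\<in>U. \<exists>V. opn V \<and> p \<in> V \<and> V \<subseteq> U \<and>
             (\<exists>m\<in>carrier G. \<exists>a\<in>carrier G. \<forall>q\<in>V. a \<notin> q \<and> s q = fr q m a)"
    using assms(2) unfolding Bex_def by (simp add: conj_assoc)
  ultimately show ?thesis unfolding Spec_sections_def partial_object.simps by blast
qed

lemma locI:
  assumes "opn V" "p \<in> V" "V \<subseteq> U" "m \<in> carrier G" "a \<in> carrier G" "\<And>q. q \<in> V \<Longrightarrow> a \<notin> q \<and> s q = fr q m a"
  shows "\<exists>V m a. opn V \<and> p \<in> V \<and> V \<subseteq> U \<and> m \<in> carrier G \<and> a \<in> carrier G \<and> (\<forall>q\<in>V. a \<notin> q \<and> s q = fr q m a)"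
  by (rule exI[of _ V], rule exI[of _ m], rule exI[of _ a]) (simp add: assms)

lemma secE:
  assumes "s \<in> carrier (Sc U)" "p \<in> U"
  shows "\<exists>V m a. opn V \<and> p \<in> V \<and> V \<subseteq> U \<and> m \<in> carrier G \<and> a \<in> carrier G \<and> (\<forall>q\<in>V. a \<notin> q \<and> s q = fr q m a)"
proof -
  have "\<forall>p\<in>U. \<exists>V. opn V \<and> p \<in> V \<and> V \<subseteq> U \<and>
             (\<exists>m\<in>carrier G. \<exists>a\<in>carrier G. \<forall>q\<in>V. a \<notin> q \<and> s q = fr q m a)"
    using assms(1) unfolding Spec_sections_def partial_object.simps by blast
  then have "\<exists>V. opn V \<and> p \<in> V \<and> V \<subseteq> U \<and>
             (\<exists>m\<in>carrier G. \<exists>a\<in>carrier G. \<forall>q\<in>V. a \<notin> q \<and> s q = fr q m a)"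
    using assms(2) by (rule bspec)
  then show ?thesis unfolding Bex_def by (simp add: conj_assoc)
qed

lemma sec_pt: "s \<in> carrier (Sc U) \<Longrightarrow> p \<in> U \<Longrightarrow> s p \<in> carrier (L p)"
  unfolding Spec_sections_def by auto

lemma sec_ext: "s \<in> carrier (Sc U) \<Longrightarrow> s \<in> extensional U"
  unfolding Spec_sections_def by (auto simp: PiE_def)

lemma sec_mult_pt: "p \<in> U \<Longrightarrow> (s \<otimes>\<^bsub>Sc U\<^esub> t) p = s p \<otimes>\<^bsub>L p\<^esub> t p"
  by (simp add: Spec_sections_def)

lemma sec_one_pt: "p \<in> U \<Longrightarrow> \<one>\<^bsub>Sc U\<^esub> p = fr p \<one> \<one>"
  by (simp add: Spec_sections_def L_one)

lemma sec_mult_ext: "s \<otimes>\<^bsub>Sc U\<^esub> t \<in> extensional U" "\<one>\<^bsub>Sc U\<^esub> \<in> extensional U"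
  by (simp_all add: Spec_sections_def)

lemma sec_mult_closed:
  assumes U: "opn U" and s: "s \<in> carrier (Sc U)" and t: "t \<in> carrier (Sc U)"
  shows "s \<otimes>\<^bsub>Sc U\<^esub> t \<in> carrier (Sc U)"
proof (rule secI[OF sec_mult_ext(1)])
  fix p assume p: "p \<in> U"
  obtain V m a where V: "opn V" "p \<in> V" "V \<subseteq> U" "m \<in> carrier G" "a \<in> carrier G"
    "\<forall>q\<in>V. a \<notin> q \<and> s q = fr q m a" using secE[OF s p] by (elim exE conjE)
  obtain W n b where W: "opn W" "p \<in> W" "W \<subseteq> U" "n \<in> carrier G" "b \<in> carrier G"
    "\<forall>q\<in>W. b \<notin> q \<and> t q = fr q n b" using secE[OF t p] by (elim exE conjE)
  have "a \<otimes> b \<notin> q \<and> (s \<otimes>\<^bsub>Sc U\<^esub> t) q = fr q (m \<otimes> n) (a \<otimes> b)" if "q \<in> V \<inter> W" for q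
  proof -
    have q: "prime_ideal G q" "q \<in> U" using that V opn_pt by auto
    show ?thesis using that V W q L_mult[OF q(1)] prime_mult_iff[OF q(1)] by (simp add: sec_mult_pt)
  qed
  moreover have "opn (V \<inter> W)" using V W by blast
  ultimately show "\<exists>V m a. opn V \<and> p \<in> V \<and> V \<subseteq> U \<and> m \<in> carrier G \<and> a \<in> carrier G \<and> (\<forall>q\<in>V. a \<notin> q \<and> (s \<otimes>\<^bsub>Sc U\<^esub> t) q = fr q m a)"
    using V(1-5) W(1-5) by (intro locI[of "V \<inter> W" _ _ "m \<otimes> n" "a \<otimes> b"]) (simp_all add: le_infI1)
qed

lemma sec_one_closed:
  assumes U: "opn U" shows "\<one>\<^bsub>Sc U\<^esub> \<in> carrier (Sc U)"
proof (rule secI[OF sec_mult_ext(2)])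
  fix p assume p: "p \<in> U"
  show "\<exists>V m a. opn V \<and> p \<in> V \<and> V \<subseteq> U \<and> m \<in> carrier G \<and> a \<in> carrier G \<and> (\<forall>q\<in>V. a \<notin> q \<and> \<one>\<^bsub>Sc U\<^esub> q = fr q m a)"
    by (rule locI[of U _ _ \<one> \<one>]) (use U p opn_pt[OF U] prime_one sec_one_pt in simp_all)
qed

lemma sec_comm_monoid:
  assumes U: "opn U" shows "comm_monoid (Sc U)"
proof (rule comm_monoidI)
  fix x y z assume x: "x \<in> carrier (Sc U)" and y: "y \<in> carrier (Sc U)"
  show "x \<otimes>\<^bsub>Sc U\<^esub> y \<in> carrier (Sc U)" using U x y by (rule sec_mult_closed)
  show "x \<otimes>\<^bsub>Sc U\<^esub> y = y \<otimes>\<^bsub>Sc U\<^esub> x"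
    by (rule extensionalityI[OF sec_mult_ext(1) sec_mult_ext(1)])
       (use x y in \<open>simp add: sec_mult_pt sec_pt comm_monoid.m_comm[OF L_comm_monoid]\<close>)
  assume z: "z \<in> carrier (Sc U)"
  show "x \<otimes>\<^bsub>Sc U\<^esub> y \<otimes>\<^bsub>Sc U\<^esub> z = x \<otimes>\<^bsub>Sc U\<^esub> (y \<otimes>\<^bsub>Sc U\<^esub> z)"
    by (rule extensionalityI[OF sec_mult_ext(1) sec_mult_ext(1)])
       (use x y z in \<open>simp add: sec_mult_pt sec_pt monoid.m_assoc[OF comm_monoid.axioms(1)[OF L_comm_monoid]]\<close>)
next
  show "\<one>\<^bsub>Sc U\<^esub> \<in> carrier (Sc U)" using U by (rule sec_one_closed)
  fix x assume x: "x \<in> carrier (Sc U)"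
  show "\<one>\<^bsub>Sc U\<^esub> \<otimes>\<^bsub>Sc U\<^esub> x = x"
    by (rule extensionalityI[OF sec_mult_ext(1) sec_ext[OF x]])
       (use x in \<open>simp add: sec_mult_pt sec_one_pt sec_pt L_one[symmetric] monoid.l_one[OF comm_monoid.axioms(1)[OF L_comm_monoid]]\<close>)
qed

lemma sec_restrict:
  assumes s: "s \<in> carrier (Sc U)" and V: "opn V" "V \<subseteq> U"
  shows "restrict s V \<in> carrier (Sc V)"
proof (rule secI)
  fix p assume p: "p \<in> V"
  obtain W n b where W: "opn W" "p \<in> W" "W \<subseteq> U" "n \<in> carrier G" "b \<in> carrier G"
    "\<forall>q\<in>W. b \<notin> q \<and> s q = fr q n b" using secE[OF s subsetD[OF V(2) p]] by (elim exE conjE)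
  then show "\<exists>W m a. opn W \<and> p \<in> W \<and> W \<subseteq> V \<and> m \<in> carrier G \<and> a \<in> carrier G \<and> (\<forall>q\<in>W. a \<notin> q \<and> restrict s V q = fr q m a)"
    using p V by (intro locI[of "V \<inter> W" _ _ n b]) (simp_all add: openin_Int)
qed simp

lemma monoidal_space_Spec: "monoidal_space (Spec G)"
proof -
  have pre: "monoid_presheaf (Spec G)"
    unfolding monoid_presheaf_def Spec_def mspace.simps
  proof (intro conjI allI impI ballI)
    fix U V assume UV: "opn U \<and> opn V \<and> V \<subseteq> U"
    show "(\<lambda>s. restrict s V) \<in> monoid_hom (Sc U) (Sc V)"
      unfolding monoid_hom_def hom_def
    proof (safe)
      fix s assume "s \<in> carrier (Sc U)" then show "restrict s V \<in> carrier (Sc V)" using UV sec_restrict by blast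
    next
      fix s t
      show "restrict (s \<otimes>\<^bsub>Sc U\<^esub> t) V = restrict s V \<otimes>\<^bsub>Sc V\<^esub> restrict t V"
        by (rule extensionalityI[OF _ sec_mult_ext(1)]) (use UV in \<open>auto simp: sec_mult_pt\<close>)
    next
      show "restrict \<one>\<^bsub>Sc U\<^esub> V = \<one>\<^bsub>Sc V\<^esub>"
        by (rule extensionalityI[OF _ sec_mult_ext(2)]) (use UV in \<open>auto simp: sec_one_pt\<close>)
    qed
  next
    fix U s assume "opn U" "s \<in> carrier (Sc U)"
    then show "restrict s U = s" using sec_ext extensional_restrict by blast
  next
    fix U V W s assume "opn U \<and> opn V \<and> opn W \<and> W \<subseteq> V \<and> V \<subseteq> U"
    then show "restrict (restrict s V) W = restrict s W" by (simp add: Int_absorb1)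
  qed (rule sec_comm_monoid)
  show ?thesis unfolding monoidal_space_def
  proof (intro conjI pre allI impI)
    fix \<U> \<sigma>
    assume "(\<forall>U\<in>\<U>. openin (spc (Spec G)) U \<and> \<sigma> U \<in> carrier (sect (Spec G) U)) \<and>
        (\<forall>U\<in>\<U>. \<forall>V\<in>\<U>. restr (Spec G) U (U \<inter> V) (\<sigma> U) = restr (Spec G) V (U \<inter> V) (\<sigma> V))"
    then have o: "\<And>U. U \<in> \<U> \<Longrightarrow> opn U" and \<sigma>: "\<And>U. U \<in> \<U> \<Longrightarrow> \<sigma> U \<in> carrier (Sc U)"
      and c: "\<And>U V. U \<in> \<U> \<Longrightarrow> V \<in> \<U> \<Longrightarrow> restrict (\<sigma> U) (U \<inter> V) = restrict (\<sigma> V) (U \<inter> V)"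
      unfolding Spec_def by auto
    define s where "s = (\<lambda>p\<in>\<Union>\<U>. \<sigma> (SOME U. U \<in> \<U> \<and> p \<in> U) p)"
    have s: "s p = \<sigma> U p" if "U \<in> \<U>" "p \<in> U" for U p
    proof -
      define V where "V = (SOME U. U \<in> \<U> \<and> p \<in> U)"
      have V: "V \<in> \<U> \<and> p \<in> V" unfolding V_def using someI[of "\<lambda>U. U \<in> \<U> \<and> p \<in> U" U] that by blast
      have "\<sigma> U p = \<sigma> V p" using fun_cong[OF c[of U V], of p] V that by simp
      then show ?thesis using that V by (auto simp: s_def V_def)
    qed
    show "\<exists>!s. s \<in> carrier (sect (Spec G) (\<Union>\<U>)) \<and> (\<forall>U\<in>\<U>. restr (Spec G) (\<Union>\<U>) U s = \<sigma> U)"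
      unfolding Spec_def mspace.simps
    proof (rule ex1I[of _ s], intro conjI ballI)
      show "s \<in> carrier (Sc (\<Union>\<U>))"
      proof (rule secI)
        show "s \<in> extensional (\<Union>\<U>)" by (simp add: s_def)
        fix p assume "p \<in> \<Union>\<U>"
        then obtain U where U: "U \<in> \<U>" "p \<in> U" by blast
        obtain W n b where W: "opn W" "p \<in> W" "W \<subseteq> U" "n \<in> carrier G" "b \<in> carrier G"
    "\<forall>q\<in>W. b \<notin> q \<and> \<sigma> U q = fr q n b" using secE[OF \<sigma>[OF U(1)] U(2)] by (elim exE conjE)
        then show "\<exists>V m a. opn V \<and> p \<in> V \<and> V \<subseteq> \<Union>\<U> \<and> m \<in> carrier G \<and> a \<in> carrier G \<and> (\<forall>q\<in>V. a \<notin> q \<and> s q = fr q m a)"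
          using s[OF U(1)] U by (intro locI[of W _ _ n b]) (simp_all, blast+)
      qed
      fix U assume U: "U \<in> \<U>"
      show "restrict s U = \<sigma> U"
        by (rule extensionalityI[OF _ sec_ext[OF \<sigma>[OF U]]]) (use s[OF U] in auto)
    next
      fix t assume t: "t \<in> carrier (Sc (\<Union>\<U>)) \<and> (\<forall>U\<in>\<U>. restrict t U = \<sigma> U)"
      show "t = s"
      proof (rule extensionalityI[of _ "\<Union>\<U>"])
        show "t \<in> extensional (\<Union>\<U>)" using t sec_ext by blast
        show "s \<in> extensional (\<Union>\<U>)" by (simp add: s_def)
        fix p assume "p \<in> \<Union>\<U>"
        then obtain U where U: "U \<in> \<U>" "p \<in> U" by blast
        then have "restrict t U p = \<sigma> U p" using t by metis
        then show "t p = s p" using s U by simp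
      qed
    qed
  qed
qed

end

context spec_monoid begin

lemma germ_Spec_mem:
  "(V, t) \<in> germ (Spec G) x U s \<longleftrightarrow> opn V \<and> x \<in> V \<and> t \<in> carrier (Sc V) \<and>
     (\<exists>W. opn W \<and> x \<in> W \<and> W \<subseteq> U \<inter> V \<and> restrict s W = restrict t W)"
  unfolding germ_def Spec_def by simp

lemma germ_Spec_pt: 
  assumes "(V, t) \<in> germ (Spec G) x U s" shows "t x = s x"
proof -
  from assms obtain W where "x \<in> W" "restrict s W = restrict t W" unfolding germ_Spec_mem by blast
  then show ?thesis by (metis restrict_apply')
qed

lemma germ_Spec_sub:
  assumes "opn W" "x \<in> W" "W \<subseteq> U" "W \<subseteq> V" "\<And>p. p \<in> W \<Longrightarrow> s p = t p"
  shows "germ (Spec G) x U s \<subseteq> germ (Spec G) x V t"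
proof (clarify)
  fix V' t' assume "(V', t') \<in> germ (Spec G) x U s"
  then obtain W' where h: "opn V'" "x \<in> V'" "t' \<in> carrier (Sc V')" "opn W'" "x \<in> W'" "W' \<subseteq> U \<inter> V'"
    and e: "restrict s W' = restrict t' W'" unfolding germ_Spec_mem by blast
  have "restrict t (W \<inter> W') = restrict t' (W \<inter> W')"
    using assms(5) e by (intro restrict_ext) (metis IntD1 IntD2 restrict_apply')
  moreover have "opn (W \<inter> W')" using assms(1) h(4) by (rule openin_Int)
  ultimately show "(V', t') \<in> germ (Spec G) x V t"
    unfolding germ_Spec_mem using h assms by (intro conjI exI[of _ "W \<inter> W'"]) auto
qed

lemma germ_Spec_eq:
  assumes "opn W" "x \<in> W" "W \<subseteq> U" "W \<subseteq> V" "\<And>p. p \<in> W \<Longrightarrow> s p = t p"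
  shows "germ (Spec G) x U s = germ (Spec G) x V t"
  using germ_Spec_sub[of W x U V s t] germ_Spec_sub[of W x V U t s] assms by fastforce

lemma germ_Spec_self:
  assumes "opn U" "x \<in> U" "s \<in> carrier (Sc U)" shows "(U, s) \<in> germ (Spec G) x U s"
  unfolding germ_Spec_mem using assms by blast

lemma stalk_Spec_carrier:
  "carrier (stalk (Spec G) x) = {germ (Spec G) x U s | U s. opn U \<and> x \<in> U \<and> s \<in> carrier (Sc U)}"
  unfolding stalk_def by (simp add: Spec_def)

lemma stalk_Spec_one: "\<one>\<^bsub>stalk (Spec G) x\<^esub> = germ (Spec G) x (Spec_points G) \<one>\<^bsub>Sc (Spec_points G)\<^esub>"
  unfolding stalk_def by (simp add: Spec_def topspace_Spec)

lemma stalk_Spec_mult_UN: "p \<otimes>\<^bsub>stalk (Spec G) x\<^esub> q = (\<Union>(U, s)\<in>p. \<Union>(V, t)\<in>q.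
     germ (Spec G) x (U \<inter> V) (restrict s (U \<inter> V) \<otimes>\<^bsub>Sc (U \<inter> V)\<^esub> restrict t (U \<inter> V)))"
  unfolding stalk_def by (simp add: Spec_def)

lemma stalk_Spec_mult:
  assumes U: "opn U" "x \<in> U" "s \<in> carrier (Sc U)" and V: "opn V" "x \<in> V" "t \<in> carrier (Sc V)"
  shows "germ (Spec G) x U s \<otimes>\<^bsub>stalk (Spec G) x\<^esub> germ (Spec G) x V t =
    germ (Spec G) x (U \<inter> V) (restrict s (U \<inter> V) \<otimes>\<^bsub>Sc (U \<inter> V)\<^esub> restrict t (U \<inter> V))" (is "_ = ?R")
proof -
  have c: "germ (Spec G) x (U' \<inter> V') (restrict s' (U' \<inter> V') \<otimes>\<^bsub>Sc (U' \<inter> V')\<^esub> restrict t' (U' \<inter> V')) = ?R"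
    if us: "(U', s') \<in> germ (Spec G) x U s" and vt: "(V', t') \<in> germ (Spec G) x V t" for U' s' V' t'
  proof -
    from us obtain W where W: "opn W" "x \<in> W" "W \<subseteq> U \<inter> U'" "restrict s W = restrict s' W"
      unfolding germ_Spec_mem by blast
    from vt obtain W' where W': "opn W'" "x \<in> W'" "W' \<subseteq> V \<inter> V'" "restrict t W' = restrict t' W'"
      unfolding germ_Spec_mem by blast
    show ?thesis
    proof (rule germ_Spec_eq[of "W \<inter> W'"])
      fix p assume p: "p \<in> W \<inter> W'"
      have "s p = s' p" "t p = t' p" using W(4) W'(4) p by (metis IntD1 IntD2 restrict_apply')+
      then show "(restrict s' (U' \<inter> V') \<otimes>\<^bsub>Sc (U' \<inter> V')\<^esub> restrict t' (U' \<inter> V')) p =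
           (restrict s (U \<inter> V) \<otimes>\<^bsub>Sc (U \<inter> V)\<^esub> restrict t (U \<inter> V)) p"
        using p W(3) W'(3) by (subst (1 2) sec_mult_pt) auto
    qed (use W W' in \<open>auto simp: openin_Int\<close>)
  qed
  show ?thesis unfolding stalk_Spec_mult_UN
    using c germ_Spec_self[OF U] germ_Spec_self[OF V] by blast
qed

lemma stalk_Spec_unit:
  assumes U: "opn U" "x \<in> U" "s \<in> carrier (Sc U)"
  shows "germ (Spec G) x U s \<in> Units (stalk (Spec G) x) \<longleftrightarrow> s x \<in> Units (L x)"
proof
  have px: "prime_ideal G x" using U opn_pt by blast
  have oP: "opn (Spec_points G)" using openin_topspace[of "Spec_topology G"] by (simp add: topspace_Spec)
  have xP: "x \<in> Spec_points G" using px by (simp add: Spec_points_def)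
  interpret L: comm_monoid "L x" by (rule L_comm_monoid)
  {
    assume "germ (Spec G) x U s \<in> Units (stalk (Spec G) x)"
    then obtain V t where V: "opn V" "x \<in> V" "t \<in> carrier (Sc V)"
      and e: "germ (Spec G) x U s \<otimes>\<^bsub>stalk (Spec G) x\<^esub> germ (Spec G) x V t = \<one>\<^bsub>stalk (Spec G) x\<^esub>"
      unfolding Units_def stalk_Spec_carrier by blast
    have "(Spec_points G, \<one>\<^bsub>Sc (Spec_points G)\<^esub>) \<in> \<one>\<^bsub>stalk (Spec G) x\<^esub>"
      unfolding stalk_Spec_one using oP xP sec_one_closed by (intro germ_Spec_self) auto
    then have "\<one>\<^bsub>Sc (Spec_points G)\<^esub> x = (restrict s (U \<inter> V) \<otimes>\<^bsub>Sc (U \<inter> V)\<^esub> restrict t (U \<inter> V)) x"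
      unfolding e[symmetric] stalk_Spec_mult[OF U V] by (rule germ_Spec_pt)
    then have m: "s x \<otimes>\<^bsub>L x\<^esub> t x = \<one>\<^bsub>L x\<^esub>"
      using U V xP by (simp add: sec_one_pt sec_mult_pt L_one)
    moreover have c: "s x \<in> carrier (L x)" "t x \<in> carrier (L x)" using U V sec_pt by auto
    ultimately have "t x \<otimes>\<^bsub>L x\<^esub> s x = \<one>\<^bsub>L x\<^esub>" using L.m_comm by metis
    then show "s x \<in> Units (L x)" using m c unfolding Units_def by blast
  }
  assume u: "s x \<in> Units (L x)"
  obtain V m a where V: "opn V" "x \<in> V" "V \<subseteq> U" "m \<in> carrier G" "a \<in> carrier G"
    "\<forall>q\<in>V. a \<notin> q \<and> s q = fr q m a" using secE[OF U(3,2)] by (elim exE conjE)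
  have mx: "m \<notin> x" using u L_unit[OF px V(4,5)] V(2,6) by simp
  define W where "W = V \<inter> {p \<in> Spec_points G. m \<notin> p}"
  have W: "opn W" "x \<in> W" "W \<subseteq> U" unfolding W_def using V mx xP openin_D[OF V(4)] by (auto simp: openin_Int)
  define t where "t = (\<lambda>q\<in>W. fr q a m)"
  have t: "t \<in> carrier (Sc W)"
  proof (rule secI)
    fix p assume "p \<in> W"
    then show "\<exists>V m a. opn V \<and> p \<in> V \<and> V \<subseteq> W \<and> m \<in> carrier G \<and> a \<in> carrier G \<and> (\<forall>q\<in>V. a \<notin> q \<and> t q = fr q m a)"
      using V W by (intro locI[of W _ _ a m]) (auto simp: t_def W_def)
  qed (simp add: t_def)
  have pt: "s p \<otimes>\<^bsub>L p\<^esub> t p = \<one>\<^bsub>Sc (Spec_points G)\<^esub> p" "t p \<otimes>\<^bsub>L p\<^esub> s p = \<one>\<^bsub>Sc (Spec_points G)\<^esub> p" if p: "p \<in> W" for p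
  proof -
    interpret Lp: comm_monoid "L p" by (rule L_comm_monoid)
    have pp: "prime_ideal G p" "p \<in> Spec_points G" using opn_pt[OF W(1) p] by (auto simp: Spec_points_def)
    have pm: "m \<notin> p" "a \<notin> p" "s p = fr p m a" "t p = fr p a m" using p V(6) by (auto simp: W_def t_def)
    have nn: "a \<otimes> m \<notin> p" using prime_mult_iff[OF pp(1)] pm V by auto
    have "fr p (m \<otimes> a) (a \<otimes> m) = fr p \<one> \<one>"
      using L_eq_iff[OF pp(1), of "m \<otimes> a" \<one> "a \<otimes> m" \<one>] V nn prime_one[OF pp(1)]
      by (auto intro!: bexI[of _ \<one>] simp: m_comm)
    then show e: "s p \<otimes>\<^bsub>L p\<^esub> t p = \<one>\<^bsub>Sc (Spec_points G)\<^esub> p"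
      using pm V L_mult[OF pp(1)] pp(2) by (simp add: sec_one_pt)
    have "s p \<in> carrier (L p)" "t p \<in> carrier (L p)" using pm V L_closed[OF pp(1)] by auto
    then show "t p \<otimes>\<^bsub>L p\<^esub> s p = \<one>\<^bsub>Sc (Spec_points G)\<^esub> p" using e Lp.m_comm by metis
  qed
  have "germ (Spec G) x U s \<otimes>\<^bsub>stalk (Spec G) x\<^esub> germ (Spec G) x W t = \<one>\<^bsub>stalk (Spec G) x\<^esub>"
    unfolding stalk_Spec_mult[OF U W(1,2) t] stalk_Spec_one
    by (rule germ_Spec_eq[of W]) (use W openin_subset[OF W(1)] pt in \<open>auto simp: topspace_Spec sec_mult_pt\<close>)
  moreover have "germ (Spec G) x W t \<otimes>\<^bsub>stalk (Spec G) x\<^esub> germ (Spec G) x U s = \<one>\<^bsub>stalk (Spec G) x\<^esub>"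
    unfolding stalk_Spec_mult[OF W(1,2) t U] stalk_Spec_one
    by (rule germ_Spec_eq[of W]) (use W openin_subset[OF W(1)] pt in \<open>auto simp: topspace_Spec sec_mult_pt\<close>)
  ultimately show "germ (Spec G) x U s \<in> Units (stalk (Spec G) x)"
    unfolding Units_def stalk_Spec_carrier using U W t by blast
qed

end

locale spec_hom = M: spec_monoid M + N: spec_monoid N for M :: "'a monoid" and N :: "'b monoid" +
  fixes \<phi> assumes hom: "\<phi> \<in> monoid_hom M N"
begin

abbreviation (input) "b q \<equiv> {m \<in> carrier M. \<phi> m \<in> q}"

lemma hom_simps [simp]: "m \<in> carrier M \<Longrightarrow> \<phi> m \<in> carrier N"
  "m \<in> carrier M \<Longrightarrow> n \<in> carrier M \<Longrightarrow> \<phi> (m \<otimes>\<^bsub>M\<^esub> n) = \<phi> m \<otimes>\<^bsub>N\<^esub> \<phi> n"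
  "\<phi> \<one>\<^bsub>M\<^esub> = \<one>\<^bsub>N\<^esub>"
  using hom by (auto simp: monoid_hom_def hom_def)

lemma b_prime:
  assumes "prime_ideal N q" shows "prime_ideal M (b q)"
  unfolding prime_ideal_def
proof (intro conjI)
  show "b q \<subseteq> carrier M" by blast
  show "b q <#>\<^bsub>M\<^esub> carrier M = b q"
  proof
    show "b q <#>\<^bsub>M\<^esub> carrier M \<subseteq> b q"
      using N.prime_mult_closed[OF assms] by (auto simp: set_mult_def)
    show "b q \<subseteq> b q <#>\<^bsub>M\<^esub> carrier M"
      unfolding set_mult_def by (force intro!: bexI[of _ "\<one>\<^bsub>M\<^esub>"])
  qed
  show "submonoid (carrier M - b q) M"
    unfolding submonoid_def using N.prime_one[OF assms] N.prime_mult_iff[OF assms] by auto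
qed

lemma b_open:
  assumes "M.opn V" shows "N.opn {q \<in> Spec_points N. b q \<in> V}"
proof -
  from assms obtain I where I: "I \<subseteq> carrier M" "V = Spec_points M - {p \<in> Spec_points M. I \<subseteq> p}"
    unfolding M.openin_Spec by blast
  then have "{q \<in> Spec_points N. b q \<in> V} = Spec_points N - {q \<in> Spec_points N. \<phi> ` I \<subseteq> q}"
    using b_prime unfolding I(2) Spec_points_def by auto
  then show ?thesis unfolding N.openin_Spec using I(1) by (intro exI[of _ "\<phi> ` I"]) auto
qed

lemma induced_frac:
  assumes q: "prime_ideal N q" and c: "m \<in> carrier M" "a \<in> carrier M" "a \<notin> b q"
  shows "loc_induced N (carrier N - q) \<phi> (M.fr (b q) m a) = N.fr q (\<phi> m) (\<phi> a)"
  unfolding loc_induced_def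
proof (rule monoid_loc.UN_frac[OF M.monoid_loc])
  show "m \<in> carrier M" by fact
  show "a \<in> gen_submonoid M (carrier M - b q)" using M.gen_prime[OF b_prime[OF q]] c by auto
  fix n t assume n: "n \<in> carrier M" and t: "t \<in> gen_submonoid M (carrier M - b q)"
    and e: "M.fr (b q) n t = M.fr (b q) m a"
  have t': "t \<in> carrier M" "t \<notin> b q" using t M.gen_prime[OF b_prime[OF q]] by auto
  obtain u where u: "u \<in> carrier M - b q" "u \<otimes>\<^bsub>M\<^esub> (a \<otimes>\<^bsub>M\<^esub> n) = u \<otimes>\<^bsub>M\<^esub> (t \<otimes>\<^bsub>M\<^esub> m)"
    using e M.L_eq_iff[OF b_prime[OF q] n c(1) t'(1) c(2) t'(2) c(3)] by blast
  have "\<phi> u \<otimes>\<^bsub>N\<^esub> (\<phi> a \<otimes>\<^bsub>N\<^esub> \<phi> n) = \<phi> u \<otimes>\<^bsub>N\<^esub> (\<phi> t \<otimes>\<^bsub>N\<^esub> \<phi> m)"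
    using arg_cong[OF u(2), of \<phi>] u(1) c n t' by simp
  then show "N.fr q (\<phi> n) (\<phi> t) = N.fr q (\<phi> m) (\<phi> a)"
    using u(1) c n t' by (subst N.L_eq_iff[OF q]) auto
qed

abbreviation (input) "pull V s \<equiv> shf (Spec_map M N \<phi>) V s"
abbreviation (input) "pre V \<equiv> {q \<in> Spec_points N. b q \<in> V}"

lemma preim_eq: "preim (Spec N) (Spec_map M N \<phi>) V = pre V"
  by (auto simp: preim_def Spec_map_def Spec_def N.topspace_Spec)

lemma pull_pt: "q \<in> pre V \<Longrightarrow> pull V s q = loc_induced N (carrier N - q) \<phi> (s (b q))"
  unfolding Spec_map_def by simp

lemma pull_ext: "pull V s \<in> extensional (pre V)"
  unfolding Spec_map_def by simp

lemma pull_closed: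
  assumes V: "M.opn V" and s: "s \<in> carrier (M.Sc V)"
  shows "pull V s \<in> carrier (N.Sc (pre V))"
proof (rule N.secI[OF pull_ext])
  fix q assume q: "q \<in> pre V"
  obtain W m a where W: "M.opn W" "b q \<in> W" "W \<subseteq> V" "m \<in> carrier M" "a \<in> carrier M"
    "\<forall>p\<in>W. a \<notin> p \<and> s p = M.fr p m a" using M.secE[OF s, of "b q"] q by blast
  have "\<phi> a \<notin> q' \<and> pull V s q' = N.fr q' (\<phi> m) (\<phi> a)" if "q' \<in> pre W" for q'
  proof -
    have p: "prime_ideal N q'" "b q' \<in> W" "q' \<in> pre V" using that W(3) by (auto simp: Spec_points_def)
    note h = bspec[OF W(6) p(2)]
    have "pull V s q' = N.fr q' (\<phi> m) (\<phi> a)"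
      unfolding pull_pt[OF p(3)] conjunct2[OF h] by (rule induced_frac[OF p(1) W(4,5) conjunct1[OF h]])
    then show ?thesis using conjunct1[OF h] W(5) by simp
  qed
  then show "\<exists>V' m a. N.opn V' \<and> q \<in> V' \<and> V' \<subseteq> pre V \<and> m \<in> carrier N \<and> a \<in> carrier N \<and>
      (\<forall>q\<in>V'. a \<notin> q \<and> pull V s q = N.fr q m a)"
    using q W b_open[OF W(1)] by (intro N.locI[of "pre W" _ _ "\<phi> m" "\<phi> a"]) auto
qed

lemma pull_hom:
  assumes V: "M.opn V"
  shows "shf (Spec_map M N \<phi>) V \<in> monoid_hom (M.Sc V) (N.Sc (pre V))"
  unfolding monoid_hom_def hom_def
proof (safe)
  fix s assume "s \<in> carrier (M.Sc V)" then show "pull V s \<in> carrier (N.Sc (pre V))" using V pull_closed by blast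
next
  fix s t assume s: "s \<in> carrier (M.Sc V)" and t: "t \<in> carrier (M.Sc V)"
  show "pull V (s \<otimes>\<^bsub>M.Sc V\<^esub> t) = pull V s \<otimes>\<^bsub>N.Sc (pre V)\<^esub> pull V t"
  proof (rule extensionalityI[OF pull_ext N.sec_mult_ext(1)])
    fix q assume q: "q \<in> pre V"
    then have p: "prime_ideal N q" "b q \<in> V" by (auto simp: Spec_points_def)
    obtain m a where ma: "m \<in> carrier M" "a \<in> carrier M" "a \<notin> b q" "s (b q) = M.fr (b q) m a"
      using M.L_cases[OF b_prime[OF p(1)] M.sec_pt[OF s p(2)]] .
    obtain n c where nc: "n \<in> carrier M" "c \<in> carrier M" "c \<notin> b q" "t (b q) = M.fr (b q) n c"
      using M.L_cases[OF b_prime[OF p(1)] M.sec_pt[OF t p(2)]] .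
    have ac: "a \<otimes>\<^bsub>M\<^esub> c \<notin> b q" using ma nc M.prime_mult_iff[OF b_prime[OF p(1)]] by blast
    have "pull V (s \<otimes>\<^bsub>M.Sc V\<^esub> t) q = N.fr q (\<phi> (m \<otimes>\<^bsub>M\<^esub> n)) (\<phi> (a \<otimes>\<^bsub>M\<^esub> c))"
      unfolding pull_pt[OF q] M.sec_mult_pt[OF p(2)] ma(4) nc(4)
      using M.L_mult[OF b_prime[OF p(1)] ma(1) nc(1) ma(2) nc(2) ma(3) nc(3)] induced_frac[OF p(1) _ _ ac] ma nc by simp
    moreover have "pull V s q = N.fr q (\<phi> m) (\<phi> a)" "pull V t q = N.fr q (\<phi> n) (\<phi> c)"
      unfolding pull_pt[OF q] ma(4) nc(4) using induced_frac[OF p(1)] ma nc by auto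
    ultimately show "pull V (s \<otimes>\<^bsub>M.Sc V\<^esub> t) q = (pull V s \<otimes>\<^bsub>N.Sc (pre V)\<^esub> pull V t) q"
      unfolding N.sec_mult_pt[OF q] using ma nc N.L_mult[OF p(1)] by simp
  qed
next
  show "pull V \<one>\<^bsub>M.Sc V\<^esub> = \<one>\<^bsub>N.Sc (pre V)\<^esub>"
  proof (rule extensionalityI[OF pull_ext N.sec_mult_ext(2)])
    fix q assume q: "q \<in> pre V"
    then have p: "prime_ideal N q" "b q \<in> V" by (auto simp: Spec_points_def)
    show "pull V \<one>\<^bsub>M.Sc V\<^esub> q = \<one>\<^bsub>N.Sc (pre V)\<^esub> q"
      unfolding pull_pt[OF q] M.sec_one_pt[OF p(2)] N.sec_one_pt[OF q]
      using induced_frac[OF p(1), of "\<one>\<^bsub>M\<^esub>" "\<one>\<^bsub>M\<^esub>"] N.prime_one[OF p(1)] by simp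
  qed
qed

lemma Spec_map_morphism: "mspace_morphism (Spec N) (Spec M) (Spec_map M N \<phi>)"
  unfolding mspace_morphism_def
proof (intro conjI N.monoidal_space_Spec M.monoidal_space_Spec allI impI ballI)
  show "continuous_map (spc (Spec N)) (spc (Spec M)) (base (Spec_map M N \<phi>))"
    unfolding continuous_map_def
    using b_open b_prime
    by (auto simp: Spec_def Spec_map_def N.topspace_Spec M.topspace_Spec Spec_points_def)
next
  fix V assume "openin (spc (Spec M)) V"
  then show "shf (Spec_map M N \<phi>) V \<in> monoid_hom (sect (Spec M) V) (sect (Spec N) (preim (Spec N) (Spec_map M N \<phi>) V))"
    unfolding preim_eq using pull_hom[of V] by (simp add: Spec_def)
next
  fix V W t assume "openin (spc (Spec M)) V \<and> openin (spc (Spec M)) W \<and> W \<subseteq> V" 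
  then have VW: "W \<subseteq> V" by blast
  have "pull W (restrict t W) = restrict (pull V t) (pre W)"
    by (rule extensionalityI[OF pull_ext]) (use VW in \<open>auto simp: pull_pt\<close>)
  then show "shf (Spec_map M N \<phi>) W (restr (Spec M) V W t) =
       restr (Spec N) (preim (Spec N) (Spec_map M N \<phi>) V) (preim (Spec N) (Spec_map M N \<phi>) W) (shf (Spec_map M N \<phi>) V t)"
    unfolding preim_eq by (simp add: Spec_def)
next
  fix x assume "x \<in> topspace (spc (Spec N))"
  then have x: "x \<in> Spec_points N" "prime_ideal N x" by (auto simp: Spec_def N.topspace_Spec Spec_points_def)
  have bx: "base (Spec_map M N \<phi>) x = b x" by (simp add: Spec_map_def)
  have key: "stalk_map (Spec N) (Spec_map M N \<phi>) x (germ (Spec M) (b x) V s) \<in> Units (stalk (Spec N) x)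
     \<longleftrightarrow> germ (Spec M) (b x) V s \<in> Units (stalk (Spec M) (b x))"
    if V: "M.opn V" "b x \<in> V" "s \<in> carrier (M.Sc V)" for V s
  proof -
    have xV: "x \<in> pre V" using x V by simp
    have e: "germ (Spec N) x (pre V') (pull V' s') = germ (Spec N) x (pre V) (pull V s)"
      if "(V', s') \<in> germ (Spec M) (b x) V s" for V' s'
    proof -
      from that obtain W where W: "M.opn V'" "M.opn W" "b x \<in> W" "W \<subseteq> V \<inter> V'" "restrict s W = restrict s' W"
        unfolding M.germ_Spec_mem by blast
      show ?thesis
      proof (rule N.germ_Spec_eq[of "pre W"])
        fix q assume q: "q \<in> pre W"
        then have "b q \<in> W" by simp
        then have "s (b q) = s' (b q)" using W(5) by (metis restrict_apply')
        moreover have "q \<in> pre V" "q \<in> pre V'" using q W(4) by auto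
        ultimately show "pull V' s' q = pull V s q" by (simp add: pull_pt)
      qed (use W b_open x in auto)
    qed
    have st: "stalk_map (Spec N) (Spec_map M N \<phi>) x (germ (Spec M) (b x) V s) = germ (Spec N) x (pre V) (pull V s)"
      unfolding stalk_map_def preim_eq using e M.germ_Spec_self[OF V] by blast
    obtain m a where ma: "m \<in> carrier M" "a \<in> carrier M" "a \<notin> b x" "s (b x) = M.fr (b x) m a"
      using M.L_cases[OF b_prime[OF x(2)] M.sec_pt[OF V(3,2)]] .
    have "germ (Spec N) x (pre V) (pull V s) \<in> Units (stalk (Spec N) x) \<longleftrightarrow> pull V s x \<in> Units (N.L x)"
      by (rule N.stalk_Spec_unit[OF b_open[OF V(1)] xV pull_closed[OF V(1,3)]])
    also have "pull V s x = N.fr x (\<phi> m) (\<phi> a)"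
      unfolding pull_pt[OF xV] ma(4) by (rule induced_frac[OF x(2) ma(1-3)])
    also have "N.fr x (\<phi> m) (\<phi> a) \<in> Units (N.L x) \<longleftrightarrow> \<phi> m \<notin> x"
      using ma by (intro N.L_unit[OF x(2)]) auto
    also have "\<dots> \<longleftrightarrow> s (b x) \<in> Units (M.L (b x))"
      unfolding ma(4) using M.L_unit[OF b_prime[OF x(2)] ma(1-3)] ma(1) by simp
    also have "\<dots> \<longleftrightarrow> germ (Spec M) (b x) V s \<in> Units (stalk (Spec M) (b x))"
      using M.stalk_Spec_unit[OF V] by simp
    finally show ?thesis unfolding st .
  qed
  have "Units (stalk (Spec M) (b x)) \<subseteq> carrier (stalk (Spec M) (b x))" unfolding Units_def by blast
  then show "{p \<in> carrier (stalk (Spec M) (base (Spec_map M N \<phi>) x)).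
          stalk_map (Spec N) (Spec_map M N \<phi>) x p \<in> Units (stalk (Spec N) x)} =
         Units (stalk (Spec M) (base (Spec_map M N \<phi>) x))"
    unfolding bx using key M.stalk_Spec_carrier[of "b x"] by auto
qed

end

end

theory Submission
  imports Defs "HOL-Algebra.Divisibility"
begin

text \<open>
  All three conditions are compared with one concrete criterion, the locale \<open>loc_hom\<close>: there is a
  submonoid \<open>H\<close> of \<open>M\<close> such that \<open>\<phi>\<close> inverts \<open>H\<close>, every element of \<open>N\<close> is a fraction \<open>\<phi> m / \<phi> s\<close> with
  \<open>s \<in> H\<close>, and \<open>\<phi> m = \<phi> n\<close> forces \<open>u m = u n\<close> for some \<open>u \<in> H\<close>.  This says that \<open>N\<close> is the
  localization of \<open>M\<close> at \<open>H\<close>, and the second condition is the case where one element \<open>a\<close> generates \<open>H\<close>.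

  Flatness makes \<open>N\<close> a localization, and two diagrams of copies of \<open>M\<close> suffice to see it
  (\<open>flat_loc_hom\<close>).  The product \<open>M \<times> M\<close> shows that \<open>1\<close> and any \<open>x\<close> in \<open>N\<close> have the form \<open>\<phi> s z\<close> and
  \<open>\<phi> m z\<close> with the same \<open>z\<close>, so that \<open>x\<close> is the fraction \<open>\<phi> m / \<phi> s\<close>.  If \<open>\<phi> m = \<phi> n\<close>, the
  equalizer of the multiplications by \<open>m\<close> and \<open>n\<close> on \<open>M\<close> contains some \<open>u\<close> with \<open>\<phi> u\<close> invertible.  So
  \<open>N\<close> is the localization at the set \<open>H\<close> of all elements that \<open>\<phi>\<close> inverts, which is the direct limit
  of the \<open>M\<^sub>s\<close> with \<open>s \<in> H\<close>.  Finite presentation lifts the identity of \<open>N\<close> to an algebra map from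
  \<open>N\<close> to some \<open>M\<^sub>s\<close>, and it is an isomorphism because algebra maps out of a localization are unique
  (\<open>finitely_presented_single_element\<close>).

  Conversely, the elements of \<open>S \<otimes> N\<close> for a localization \<open>N\<close> are fractions \<open>x / u\<close> with \<open>x \<in> S\<close> and
  \<open>u \<in> H\<close>.  A finite limit involves finitely many fractions and finitely many equations between
  them, and a common multiple in \<open>H\<close> handles all of these at once (\<open>flat\<close>).  If \<open>a\<close> generates \<open>H\<close>,
  then there is at most one algebra map from \<open>N\<close> to an \<open>M\<close>-algebra, and there is one if and only if
  \<open>a\<close> becomes invertible; if \<open>a\<close> is invertible in a direct limit, then it is so at a finite stage
  (\<open>finite_presentation\<close>).

  On spectra, contraction of primes identifies \<open>Spec N\<close> with the open set of primes that avoid \<open>a\<close>,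
  and it identifies the stalks and the sections (\<open>Spec_open_immersion\<close>).  Conversely, \<open>Spec N\<close> has
  a point that lies in no proper open subset, the set of non-units.  If \<open>Spec N\<close> is an open subspace
  \<open>U\<close> of \<open>Spec M\<close>, let \<open>p\<^sub>0\<close> be the point of \<open>U\<close> corresponding to it.  Then \<open>p\<^sub>0\<close> is the largest prime
  in \<open>U\<close>, and a basic neighbourhood of \<open>p\<^sub>0\<close> inside \<open>U\<close> consists of the primes that avoid some \<open>a\<close>, so
  that the elements outside \<open>p\<^sub>0\<close> are the divisors of powers of \<open>a\<close>.  Reading sections at \<open>p\<^sub>0\<close> now shows
  that \<open>N\<close> is the localization at \<open>a\<close> (\<open>open_immersion_loc_hom\<close>).
\<close>

section \<open>Recognizing localizations\<close>

text \<open>A test for being the localization at \<open>H\<close> that refers to elements only.  It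
  transfers along isomorphisms of algebras, so that no later computation with fractions depends on the
  construction of localizations by equivalence classes.\<close>

locale loc_hom = spec_hom M N \<phi> for M :: "'a monoid" and N :: "'b monoid" and \<phi> +
  fixes H
  assumes submonoid_H: "submonoid H M"
    and units: "s \<in> H \<Longrightarrow> \<phi> s \<in> Units N"
    and fractions: "x \<in> carrier N \<Longrightarrow> \<exists>s\<in>H. \<exists>m\<in>carrier M. \<phi> s \<otimes>\<^bsub>N\<^esub> x = \<phi> m"
    and separated: "m \<in> carrier M \<Longrightarrow> n \<in> carrier M \<Longrightarrow> \<phi> m = \<phi> n \<Longrightarrow> \<exists>u\<in>H. u \<otimes>\<^bsub>M\<^esub> m = u \<otimes>\<^bsub>M\<^esub> n"
begin

lemma H_closed [simp]: "s \<in> H \<Longrightarrow> s \<in> carrier M"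
  using submonoid_H submonoid.subset by blast
lemma H_one [simp]: "\<one>\<^bsub>M\<^esub> \<in> H" using submonoid_H submonoid.one_closed by blast
lemma H_mult [simp]: "s \<in> H \<Longrightarrow> t \<in> H \<Longrightarrow> s \<otimes>\<^bsub>M\<^esub> t \<in> H"
  using submonoid_H submonoid.m_closed by metis

lemma unit_cancel:
  "s \<in> H \<Longrightarrow> x \<in> carrier N \<Longrightarrow> y \<in> carrier N \<Longrightarrow> \<phi> s \<otimes>\<^bsub>N\<^esub> x = \<phi> s \<otimes>\<^bsub>N\<^esub> y \<longleftrightarrow> x = y"
  using N.Units_l_cancel units by blast

end

lemma UN_pair_const:
  assumes "(x, y) \<in> P" "\<And>u v. (u, v) \<in> P \<Longrightarrow> F u v = w"
  shows "(\<Union>(u, v)\<in>P. F u v) = w"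
proof -
  have "(\<Union>p\<in>P. case_prod F p) = (\<Union>p\<in>P. w)"
    by (rule SUP_cong) (use assms(2) in auto)
  then show ?thesis using assms(1) by auto
qed

lemma loc_homI:
  assumes "spec_hom M N \<phi>" "submonoid H M" "\<And>s. s \<in> H \<Longrightarrow> \<phi> s \<in> Units N"
    "\<And>x. x \<in> carrier N \<Longrightarrow> \<exists>s\<in>H. \<exists>m\<in>carrier M. \<phi> s \<otimes>\<^bsub>N\<^esub> x = \<phi> m"
    "\<And>m n. m \<in> carrier M \<Longrightarrow> n \<in> carrier M \<Longrightarrow> \<phi> m = \<phi> n \<Longrightarrow> \<exists>u\<in>H. u \<otimes>\<^bsub>M\<^esub> m = u \<otimes>\<^bsub>M\<^esub> n"
  shows "loc_hom M N \<phi> H"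
  by (intro loc_hom.intro loc_hom_axioms.intro assms)

lemma spec_homI:
  assumes "comm_monoid M" "comm_monoid N" "\<phi> \<in> monoid_hom M N" shows "spec_hom M N \<phi>"
  using assms by (simp add: spec_hom_def spec_hom_axioms_def spec_monoid_def)

lemma monoid_hom_Units:
  assumes "comm_monoid A" "comm_monoid B" "f \<in> monoid_hom A B" "x \<in> Units A"
  shows "f x \<in> Units B"
proof -
  interpret A: comm_monoid A by fact
  interpret B: comm_monoid B by fact
  from assms(4) obtain y where y: "x \<in> carrier A" "y \<in> carrier A" "y \<otimes>\<^bsub>A\<^esub> x = \<one>\<^bsub>A\<^esub>" "x \<otimes>\<^bsub>A\<^esub> y = \<one>\<^bsub>A\<^esub>"
    unfolding Units_def by blast
  have "f (u \<otimes>\<^bsub>A\<^esub> v) = f u \<otimes>\<^bsub>B\<^esub> f v" "f u \<in> carrier B" if "u \<in> carrier A" "v \<in> carrier A" for u v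
    using assms(3) that by (auto simp: monoid_hom_def hom_def)
  note f = this
  have "f \<one>\<^bsub>A\<^esub> = \<one>\<^bsub>B\<^esub>" using assms(3) by (auto simp: monoid_hom_def)
  then have "f y \<otimes>\<^bsub>B\<^esub> f x = \<one>\<^bsub>B\<^esub>" "f x \<otimes>\<^bsub>B\<^esub> f y = \<one>\<^bsub>B\<^esub>"
    using f(1)[OF y(2,1)] f(1)[OF y(1,2)] y by simp_all
  then show ?thesis unfolding Units_def using f(2)[OF y(1,1)] f(2)[OF y(2,2)] by blast
qed

lemma monoid_hom_comp:
  assumes "f \<in> monoid_hom A B" "g \<in> monoid_hom B C" shows "(\<lambda>x. g (f x)) \<in> monoid_hom A C"
  using assms by (auto simp: monoid_hom_def hom_def Pi_def)

lemma algebra_hom_comp: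
  assumes "f \<in> algebra_hom A B \<beta> C \<gamma>" "g \<in> algebra_hom A C \<gamma> D \<delta>"
  shows "(\<lambda>x. g (f x)) \<in> algebra_hom A B \<beta> D \<delta>"
  using assms monoid_hom_comp by (auto simp: algebra_hom_def)

lemma algebra_hom_restrict:
  assumes "monoid B" "\<beta> \<in> monoid_hom A B" "f \<in> algebra_hom A B \<beta> C \<gamma>"
  shows "restrict f (carrier B) \<in> algebra_hom A B \<beta> C \<gamma>"
  using assms monoid.m_closed[OF assms(1)] monoid.one_closed[OF assms(1)]
  by (auto simp: algebra_hom_def monoid_hom_def hom_def Pi_def)

text \<open>A homomorphism is determined on \<open>N\<close> by its restriction along \<open>\<phi>\<close>, since \<open>\<phi> s x = \<phi> m\<close> can be
  solved for the image of \<open>x\<close>.  So \<open>\<phi>\<close> is an epimorphism, and algebra maps out of \<open>N\<close> are unique.\<close>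

lemma (in loc_hom) algebra_hom_unique:
  assumes P: "comm_monoid P" and f: "f \<in> monoid_hom N P" and g: "g \<in> monoid_hom N P"
    and e: "\<And>m. m \<in> carrier M \<Longrightarrow> f (\<phi> m) = g (\<phi> m)" and x: "x \<in> carrier N"
  shows "f x = g x"
proof -
  interpret P: comm_monoid P by fact
  obtain s m where s: "s \<in> H" "m \<in> carrier M" "\<phi> s \<otimes>\<^bsub>N\<^esub> x = \<phi> m" using fractions[OF x] by blast
  have "f (\<phi> s) \<in> Units P"
    using monoid_hom_Units[OF N.comm_monoid_axioms P f units[OF s(1)]] .
  moreover have "f (\<phi> s) \<otimes>\<^bsub>P\<^esub> f x = f (\<phi> s) \<otimes>\<^bsub>P\<^esub> g x"
  proof -
    have "f (\<phi> s) \<otimes>\<^bsub>P\<^esub> f x = f (\<phi> m)" "g (\<phi> s) \<otimes>\<^bsub>P\<^esub> g x = g (\<phi> m)"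
      using f g s x by (simp_all add: monoid_hom_def hom_def s(3)[symmetric])
    then show ?thesis using e s by simp
  qed
  moreover have "f x \<in> carrier P" "g x \<in> carrier P" using f g x by (auto simp: monoid_hom_def hom_def)
  ultimately show ?thesis using P.Units_l_cancel by blast
qed

lemma algebra_isomorphic_sym:
  assumes "monoid B" "\<beta> \<in> monoid_hom A B" "algebra_isomorphic A B \<beta> C \<gamma>"
  shows "algebra_isomorphic A C \<gamma> B \<beta>"
proof -
  interpret B: monoid B by fact
  from assms(3) obtain h where h: "h \<in> hom B C" "h \<one>\<^bsub>B\<^esub> = \<one>\<^bsub>C\<^esub>" "\<And>a. a \<in> carrier A \<Longrightarrow> h (\<beta> a) = \<gamma> a"
    "bij_betw h (carrier B) (carrier C)"
    unfolding algebra_isomorphic_def algebra_hom_def monoid_hom_def by blast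
  let ?k = "inv_into (carrier B) h"
  have kh: "?k (h x) = x" if "x \<in> carrier B" for x
    using that bij_betw_inv_into_left[OF h(4)] by blast
  have "?k \<in> hom C B"
  proof (rule homI)
    have c: "?k x \<in> carrier B \<and> h (?k x) = x" if "x \<in> carrier C" for x
      using that bij_betw_inv_into_right[OF h(4)] bij_betw_apply[OF bij_betw_inv_into[OF h(4)]] by blast
    fix x y assume x: "x \<in> carrier C" and y: "y \<in> carrier C"
    show "?k x \<in> carrier B" using c x by blast
    have "h (?k x \<otimes>\<^bsub>B\<^esub> ?k y) = x \<otimes>\<^bsub>C\<^esub> y" using c[OF x] c[OF y] hom_mult[OF h(1)] by metis
    then show "?k (x \<otimes>\<^bsub>C\<^esub> y) = ?k x \<otimes>\<^bsub>B\<^esub> ?k y"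
      using kh[of "?k x \<otimes>\<^bsub>B\<^esub> ?k y"] c[OF x] c[OF y] B.m_closed by metis
  qed
  moreover note kh
  moreover have "\<beta> a \<in> carrier B" if "a \<in> carrier A" for a
    using that assms(2) by (auto simp: monoid_hom_def hom_def)
  ultimately have "?k \<in> algebra_hom A C \<gamma> B \<beta>"
    unfolding algebra_hom_def monoid_hom_def using B.one_closed
    by (simp add: h(2)[symmetric] h(3)[symmetric])
  then show ?thesis using bij_betw_inv_into[OF h(4)] unfolding algebra_isomorphic_def by blast
qed

lemma loc_hom_loc_map:
  assumes "comm_monoid M" "S \<subseteq> carrier M"
  shows "loc_hom M (localization M S) (loc_map M S) (gen_submonoid M S)"
proof -
  interpret monoid_loc M S using assms by (simp add: monoid_loc_def monoid_loc_axioms_def)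
  interpret L: comm_monoid "localization M S" by (rule comm_monoid_localization)
  interpret spec_hom M "localization M S" "loc_map M S"
    by (intro spec_homI comm_monoid_axioms L.comm_monoid_axioms loc_map_hom)
  show ?thesis
  proof (rule loc_homI[OF spec_hom_axioms])
    show "submonoid H M" by (rule H)
    show "loc_map M S s \<in> Units (localization M S)" if "s \<in> H" for s using that by (rule loc_map_Units)
    fix x assume "x \<in> carrier (localization M S)"
    then obtain m s where m: "m \<in> carrier M" "s \<in> H" "x = loc_frac M S m s" by (rule loc_cases)
    then have "loc_map M S s \<otimes>\<^bsub>localization M S\<^esub> x = loc_map M S m"
      using frac_cancel[of m "\<one>\<^bsub>M\<^esub>" s] by (simp add: loc_map_def frac_mult)
    then show "\<exists>s\<in>H. \<exists>m\<in>carrier M. loc_map M S s \<otimes>\<^bsub>localization M S\<^esub> x = loc_map M S m"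
      using m by blast
  next
    fix m n assume "m \<in> carrier M" "n \<in> carrier M" "loc_map M S m = loc_map M S n"
    then show "\<exists>u\<in>H. u \<otimes>\<^bsub>M\<^esub> m = u \<otimes>\<^bsub>M\<^esub> n" by (simp add: loc_map_def frac_eq_iff)
  qed
qed

text \<open>The universal property gives an algebra map from the constructed localization to \<open>N\<close>; it is
  surjective by \<open>fractions\<close> and injective by \<open>separated\<close>.\<close>

lemma (in loc_hom) algebra_isomorphic_localization:
  assumes S: "S \<subseteq> carrier M" and HS: "H = gen_submonoid M S"
  shows "algebra_isomorphic M N \<phi> (localization M S) (loc_map M S)"
proof -
  interpret monoid_loc M S using S M.comm_monoid_axioms by (simp add: monoid_loc_def monoid_loc_axioms_def)
  interpret L: loc_hom M "localization M S" "loc_map M S" H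
    unfolding HS by (rule loc_hom_loc_map[OF M.comm_monoid_axioms S])
  have "\<phi> ` S \<subseteq> Units N" using units subset_gen_submonoid[of S M] unfolding HS by blast
  then obtain g where g: "g \<in> monoid_hom (localization M S) N" "\<And>m. m \<in> carrier M \<Longrightarrow> g (loc_map M S m) = \<phi> m"
    using localization_universal[OF N.comm_monoid_axioms hom] by blast
  then have gm: "g (x \<otimes>\<^bsub>localization M S\<^esub> y) = g x \<otimes>\<^bsub>N\<^esub> g y" "g x \<in> carrier N"
    if "x \<in> carrier (localization M S)" "y \<in> carrier (localization M S)" for x y
    using that by (auto simp: monoid_hom_def hom_def)
  have "inj_on g (carrier (localization M S))"
  proof (rule inj_onI)
    fix x y assume x: "x \<in> carrier (localization M S)" and y: "y \<in> carrier (localization M S)" and e: "g x = g y"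
    obtain s m where s: "s \<in> H" "m \<in> carrier M" "loc_map M S s \<otimes>\<^bsub>localization M S\<^esub> x = loc_map M S m"
      using L.fractions[OF x] by blast
    obtain t n where t: "t \<in> H" "n \<in> carrier M" "loc_map M S t \<otimes>\<^bsub>localization M S\<^esub> y = loc_map M S n"
      using L.fractions[OF y] by blast
    let ?l = "loc_map M S" and ?L = "localization M S"
    have 1: "?l (s \<otimes>\<^bsub>M\<^esub> t) \<otimes>\<^bsub>?L\<^esub> x = ?l (t \<otimes>\<^bsub>M\<^esub> m)"
      using s t x by (simp add: s(3)[symmetric] L.N.m_ac)
    have 2: "?l (s \<otimes>\<^bsub>M\<^esub> t) \<otimes>\<^bsub>?L\<^esub> y = ?l (s \<otimes>\<^bsub>M\<^esub> n)"
      using s t y by (simp add: t(3)[symmetric] L.N.m_ac)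
    have "g (?l (t \<otimes>\<^bsub>M\<^esub> m)) = g (?l (s \<otimes>\<^bsub>M\<^esub> n))"
      unfolding 1[symmetric] 2[symmetric]
      using s t x y e by (simp only: gm L.hom_simps(1) H_closed L.H_mult)
    then have "\<phi> (t \<otimes>\<^bsub>M\<^esub> m) = \<phi> (s \<otimes>\<^bsub>M\<^esub> n)"
      using g(2)[of "t \<otimes>\<^bsub>M\<^esub> m"] g(2)[of "s \<otimes>\<^bsub>M\<^esub> n"] s(1,2) t(1,2) by (simp del: L.hom_simps)
    then obtain u where u: "u \<in> H" "u \<otimes>\<^bsub>M\<^esub> (t \<otimes>\<^bsub>M\<^esub> m) = u \<otimes>\<^bsub>M\<^esub> (s \<otimes>\<^bsub>M\<^esub> n)"
      using separated s t H_closed M.m_closed by metis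
    have "?l u \<otimes>\<^bsub>?L\<^esub> ?l (t \<otimes>\<^bsub>M\<^esub> m) = ?l u \<otimes>\<^bsub>?L\<^esub> ?l (s \<otimes>\<^bsub>M\<^esub> n)"
      using arg_cong[OF u(2), of ?l] u(1) s t by (metis H_closed L.hom_simps(2) M.m_closed)
    then have "?l (t \<otimes>\<^bsub>M\<^esub> m) = ?l (s \<otimes>\<^bsub>M\<^esub> n)" using L.unit_cancel[OF u(1)] s t by simp
    then have "?l (s \<otimes>\<^bsub>M\<^esub> t) \<otimes>\<^bsub>?L\<^esub> x = ?l (s \<otimes>\<^bsub>M\<^esub> t) \<otimes>\<^bsub>?L\<^esub> y" using 1 2 by simp
    then show "x = y" using L.unit_cancel[of "s \<otimes>\<^bsub>M\<^esub> t"] s(1) t(1) x y by simp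
  qed
  moreover have "g ` carrier (localization M S) = carrier N"
  proof
    show "g ` carrier (localization M S) \<subseteq> carrier N" using gm by blast
    show "carrier N \<subseteq> g ` carrier (localization M S)"
    proof
      fix x assume x: "x \<in> carrier N"
      obtain s m where s: "s \<in> H" "m \<in> carrier M" "\<phi> s \<otimes>\<^bsub>N\<^esub> x = \<phi> m" using fractions[OF x] by blast
      have f: "loc_frac M S m s \<in> carrier (localization M S)" using s HS by simp
      have "loc_map M S s \<otimes>\<^bsub>localization M S\<^esub> loc_frac M S m s = loc_map M S m"
        using s HS frac_cancel[of m "\<one>\<^bsub>M\<^esub>" s] by (simp add: loc_map_def frac_mult)
      then have "g (loc_map M S s \<otimes>\<^bsub>localization M S\<^esub> loc_frac M S m s) = g (loc_map M S m)" by simp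
      then have "\<phi> s \<otimes>\<^bsub>N\<^esub> g (loc_frac M S m s) = \<phi> m"
        using gm f g(2) s by (metis H_closed L.hom_simps(1))
      then have "g (loc_frac M S m s) = x"
        using unit_cancel[OF s(1)] gm f x s(3) by metis
      then show "x \<in> g ` carrier (localization M S)" using f by blast
    qed
  qed
  ultimately have "algebra_isomorphic M (localization M S) (loc_map M S) N \<phi>"
    unfolding algebra_isomorphic_def algebra_hom_def bij_betw_def using g by blast
  then show ?thesis
    by (intro algebra_isomorphic_sym[OF _ L.hom]) (simp_all add: L.N.monoid_axioms)
qed

lemma algebra_isomorphic_loc_hom:
  assumes M: "comm_monoid M" and N: "comm_monoid N" and hom: "\<phi> \<in> monoid_hom M N"
    and iso: "algebra_isomorphic M N \<phi> P \<pi>" and P: "loc_hom M P \<pi> H"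
  shows "loc_hom M N \<phi> H"
proof -
  interpret P: loc_hom M P \<pi> H by fact
  interpret N: comm_monoid N by fact
  interpret spec_hom M N \<phi> by (rule spec_homI[OF M N hom])
  obtain h where h: "h \<in> monoid_hom N P" "\<And>m. m \<in> carrier M \<Longrightarrow> h (\<phi> m) = \<pi> m" "bij_betw h (carrier N) (carrier P)"
    using iso unfolding algebra_isomorphic_def algebra_hom_def by blast
  have hm: "h (x \<otimes>\<^bsub>N\<^esub> y) = h x \<otimes>\<^bsub>P\<^esub> h y" "h x \<in> carrier P" if "x \<in> carrier N" "y \<in> carrier N" for x y
    using h(1) that by (auto simp: monoid_hom_def hom_def)
  have hi: "x = y" if "h x = h y" "x \<in> carrier N" "y \<in> carrier N" for x y
    using h(3) that by (auto simp: bij_betw_def inj_on_def)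
  obtain k where k: "k \<in> monoid_hom P N" "\<And>m. m \<in> carrier M \<Longrightarrow> k (\<pi> m) = \<phi> m"
    using algebra_isomorphic_sym[OF N.monoid_axioms hom iso] unfolding algebra_isomorphic_def algebra_hom_def by blast
  show ?thesis
  proof (rule loc_homI[OF spec_hom_axioms])
    show "submonoid H M" by (rule P.submonoid_H)
    show "\<phi> s \<in> Units N" if "s \<in> H" for s
      using monoid_hom_Units[OF P.N.comm_monoid_axioms N k(1) P.units[OF that]] k(2) that by simp
    show "\<exists>s\<in>H. \<exists>m\<in>carrier M. \<phi> s \<otimes>\<^bsub>N\<^esub> x = \<phi> m" if x: "x \<in> carrier N" for x
    proof -
      obtain s m where s: "s \<in> H" "m \<in> carrier M" "\<pi> s \<otimes>\<^bsub>P\<^esub> h x = \<pi> m"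
        using P.fractions[of "h x"] hm x by blast
      then have "h (\<phi> s \<otimes>\<^bsub>N\<^esub> x) = h (\<phi> m)" using x h(2) hm by simp
      then show ?thesis using hi[of "\<phi> s \<otimes>\<^bsub>N\<^esub> x" "\<phi> m"] s x by auto
    qed
    show "\<exists>u\<in>H. u \<otimes>\<^bsub>M\<^esub> m = u \<otimes>\<^bsub>M\<^esub> n" if "m \<in> carrier M" "n \<in> carrier M" "\<phi> m = \<phi> n" for m n
      using P.separated[of m n] that h(2) by metis
  qed
qed

lemma (in loc_hom) lift:
  assumes P: "comm_monoid P" and f: "f \<in> monoid_hom M P" and S: "S \<subseteq> carrier M"
    and HS: "H = gen_submonoid M S" and fS: "f ` S \<subseteq> Units P"
  shows "\<exists>g. g \<in> algebra_hom M N \<phi> P f"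
proof -
  interpret monoid_loc M S using S M.comm_monoid_axioms by (simp add: monoid_loc_def monoid_loc_axioms_def)
  obtain g where "g \<in> algebra_hom M (localization M S) (loc_map M S) P f"
    using localization_universal[OF P f fS] unfolding algebra_hom_def by blast
  then show ?thesis
    using algebra_isomorphic_localization[OF S HS] algebra_hom_comp unfolding algebra_isomorphic_def by blast
qed

section \<open>Base change of modules\<close>

context spec_hom begin

abbreviation (input) "T X \<equiv> tensor_class M X (restrict_scalars M N \<phi>)"
abbreviation (input) "BC \<equiv> base_change M N \<phi>"

lemma tensor_class_eqI:
  assumes "equivclp (tensor_step M X (restrict_scalars M N \<phi>)) (x, \<beta>) (y, c)"
  shows "T X x \<beta> = T X y c"
proof -
  let ?E = "equivclp (tensor_step M X (restrict_scalars M N \<phi>))"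
  have "?E (x, \<beta>) q \<longleftrightarrow> ?E (y, c) q" for q
    using assms equivclp_sym equivclp_trans by metis
  then show ?thesis unfolding tensor_class_def by blast
qed

lemma tensor_class_mem:
  "(y, c) \<in> T X x \<beta> \<longleftrightarrow> y \<in> pts X \<and> c \<in> carrier N \<and> equivclp (tensor_step M X (restrict_scalars M N \<phi>)) (x, \<beta>) (y, c)"
  by (auto simp: tensor_class_def restrict_scalars_def)

lemma tensor_class_self: "x \<in> pts X \<Longrightarrow> \<beta> \<in> carrier N \<Longrightarrow> (x, \<beta>) \<in> T X x \<beta>"
  by (simp add: tensor_class_mem)

lemma tensor_slide:
  assumes "m \<in> carrier M" "x \<in> pts X" "\<beta> \<in> carrier N"
  shows "T X (act X m x) \<beta> = T X x (\<phi> m \<otimes>\<^bsub>N\<^esub> \<beta>)"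
proof (rule tensor_class_eqI, rule r_into_equivclp)
  show "tensor_step M X (restrict_scalars M N \<phi>) (act X m x, \<beta>) (x, \<phi> m \<otimes>\<^bsub>N\<^esub> \<beta>)"
    unfolding tensor_step_def restrict_scalars_def using assms by auto
qed

text \<open>The only way in which maps out of a tensor product are constructed below: a function of pairs that
  cannot tell the two sides of a generating relation apart is constant on classes.\<close>

lemma tensor_invariant:
  assumes inv: "\<And>m x \<beta>. \<lbrakk>m \<in> carrier M; x \<in> pts X; \<beta> \<in> carrier N\<rbrakk> \<Longrightarrow> F (act X m x) \<beta> = F x (\<phi> m \<otimes>\<^bsub>N\<^esub> \<beta>)"
    and mem: "(y, c) \<in> T X x \<beta>"
  shows "F y c = F x \<beta>"
proof -
  let ?E = "tensor_step M X (restrict_scalars M N \<phi>)"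
  have step: "case_prod F p = case_prod F q" if "?E p q" for p q
    using that inv unfolding tensor_step_def restrict_scalars_def by auto
  have "case_prod F (x, \<beta>) = case_prod F q" if "equivclp ?E (x, \<beta>) q" for q
    using that
  proof (induction rule: equivclp_induct)
    case (step q r)
    then show ?case using \<open>\<And>p q. ?E p q \<Longrightarrow> case_prod F p = case_prod F q\<close> by metis
  qed simp
  then show ?thesis using mem unfolding tensor_class_mem by fastforce
qed

lemma tensor_invariant_eq:
  assumes "\<And>m x \<beta>. \<lbrakk>m \<in> carrier M; x \<in> pts X; \<beta> \<in> carrier N\<rbrakk> \<Longrightarrow> F (act X m x) \<beta> = F x (\<phi> m \<otimes>\<^bsub>N\<^esub> \<beta>)"
    and "T X x \<beta> = T X y c" "y \<in> pts X" "c \<in> carrier N"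
  shows "F x \<beta> = F y c"
  using tensor_invariant[of X F y c x \<beta>] tensor_class_self[OF assms(3,4)] assms(1,2) by metis

lemma UN_tensor_class:
  assumes "\<And>m x \<beta>. \<lbrakk>m \<in> carrier M; x \<in> pts X; \<beta> \<in> carrier N\<rbrakk> \<Longrightarrow> F (act X m x) \<beta> = F x (\<phi> m \<otimes>\<^bsub>N\<^esub> \<beta>)"
    and "x \<in> pts X" "\<beta> \<in> carrier N"
  shows "(\<Union>(y, c)\<in>T X x \<beta>. F y c) = F x \<beta>"
proof -
  have e: "F y c = F x \<beta>" if "(y, c) \<in> T X x \<beta>" for y c
    by (rule tensor_invariant[OF assms(1) that])
  show ?thesis
    by (rule UN_pair_const[where w = "F x \<beta>", OF tensor_class_self[OF assms(2,3)]]) (rule e)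
qed

lemma pts_base_change: "pts (BC X) = {T X x \<beta> | x \<beta>. x \<in> pts X \<and> \<beta> \<in> carrier N}"
  by (simp add: base_change_def tensor_def restrict_scalars_def)

lemma act_base_change:
  assumes "x \<in> pts X" "\<beta> \<in> carrier N" "c \<in> carrier N"
  shows "act (BC X) c (T X x \<beta>) = T X x (c \<otimes>\<^bsub>N\<^esub> \<beta>)"
proof -
  have "(\<Union>(y, d)\<in>T X x \<beta>. T X y (c \<otimes>\<^bsub>N\<^esub> d)) = T X x (c \<otimes>\<^bsub>N\<^esub> \<beta>)"
    using assms by (intro UN_tensor_class) (auto simp: tensor_slide N.m_lcomm)
  then show ?thesis by (simp add: base_change_def)
qed

lemma base_change_map_class:
  assumes h: "h \<in> module_hom M X Y" and "x \<in> pts X" "\<beta> \<in> carrier N"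
  shows "base_change_map M N \<phi> Y h (T X x \<beta>) = T Y (h x) \<beta>"
  unfolding base_change_map_def
  using assms by (intro UN_tensor_class) (auto simp: tensor_slide module_hom_def Pi_iff)

end

lemma is_module_limit:
  assumes J: "finite_category J" and D: "module_diagram A J D d"
  shows "is_module A (module_limit J D d)"
    and "j \<in> ob J \<Longrightarrow> (\<lambda>x. x j) \<in> module_hom A (module_limit J D d) (D j)"
proof -
  have m: "is_module A (D j)" if "j \<in> ob J" for j using D that by (auto simp: module_diagram_def)
  have ar: "src J f \<in> ob J" "tgt J f \<in> ob J" "d f \<in> module_hom A (D (src J f)) (D (tgt J f))" if "f \<in> ar J" for f
    using D J that by (auto simp: module_diagram_def finite_category_def)
  show "is_module A (module_limit J D d)"
    unfolding is_module_def
  proof (intro conjI ballI)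
    fix a x assume a: "a \<in> carrier A" and x: "x \<in> pts (module_limit J D d)"
    then have xc: "x j \<in> pts (D j)" if "j \<in> ob J" for j using that by (auto simp: module_limit_def)
    have "act (D j) a (x j) \<in> pts (D j)" if "j \<in> ob J" for j
      using m[OF that] a xc[OF that] by (auto simp: is_module_def)
    moreover have "d f (act (D (src J f)) a (x (src J f))) = act (D (tgt J f)) a (x (tgt J f))" if "f \<in> ar J" for f
      using ar[OF that] a x xc that by (auto simp: module_hom_def module_limit_def)
    ultimately show "act (module_limit J D d) a x \<in> pts (module_limit J D d)"
      using ar by (auto simp: module_limit_def)
  next
    fix x assume x: "x \<in> pts (module_limit J D d)"
    have "act (D j) \<one>\<^bsub>A\<^esub> (x j) = x j" if "j \<in> ob J" for j
      using m[OF that] x that by (auto simp: is_module_def module_limit_def)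
    moreover have "x \<in> extensional (ob J)" using x by (auto simp: module_limit_def PiE_def)
    ultimately show "act (module_limit J D d) \<one>\<^bsub>A\<^esub> x = x"
      by (intro extensionalityI[of _ "ob J"]) (auto simp: module_limit_def)
  next
    fix a c x assume a: "a \<in> carrier A" "c \<in> carrier A" and x: "x \<in> pts (module_limit J D d)"
    then have "x j \<in> pts (D j)" if "j \<in> ob J" for j using that by (auto simp: module_limit_def)
    then have "act (D j) (a \<otimes>\<^bsub>A\<^esub> c) (x j) = act (D j) a (act (D j) c (x j))" if "j \<in> ob J" for j
      using m[OF that] that a by (simp add: is_module_def)
    then show "act (module_limit J D d) (a \<otimes>\<^bsub>A\<^esub> c) x = act (module_limit J D d) a (act (module_limit J D d) c x)"
      by (auto simp: module_limit_def)
  qed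
  show "(\<lambda>x. x j) \<in> module_hom A (module_limit J D d) (D j)" if "j \<in> ob J"
    using that by (auto simp: module_hom_def module_limit_def)
qed

section \<open>Localizations are flat\<close>

context loc_hom begin

abbreviation (input) "tfrac X x s \<equiv> T X x (inv\<^bsub>N\<^esub> \<phi> s)"

lemma inv_mult: "u \<in> H \<Longrightarrow> v \<in> H \<Longrightarrow> \<phi> u \<otimes>\<^bsub>N\<^esub> inv\<^bsub>N\<^esub> \<phi> (u \<otimes>\<^bsub>M\<^esub> v) = inv\<^bsub>N\<^esub> \<phi> v"
proof -
  assume u: "u \<in> H" and v: "v \<in> H"
  define i where "i = inv\<^bsub>N\<^esub> \<phi> (u \<otimes>\<^bsub>M\<^esub> v)"
  have i: "i \<in> carrier N" "\<phi> u \<otimes>\<^bsub>N\<^esub> \<phi> v \<otimes>\<^bsub>N\<^esub> i = \<one>\<^bsub>N\<^esub>"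
    using N.Units_r_inv[OF units[OF H_mult[OF u v]]] N.Units_inv_closed[OF units[OF H_mult[OF u v]]] u v
    unfolding i_def by simp_all
  have c: "\<phi> u \<in> carrier N" "\<phi> v \<in> carrier N" using u v by simp_all
  have "\<phi> v \<otimes>\<^bsub>N\<^esub> (\<phi> u \<otimes>\<^bsub>N\<^esub> i) = \<one>\<^bsub>N\<^esub>" "\<phi> u \<otimes>\<^bsub>N\<^esub> i \<otimes>\<^bsub>N\<^esub> \<phi> v = \<one>\<^bsub>N\<^esub>"
    using i c by (simp_all add: N.m_ac)
  then show ?thesis unfolding i_def[symmetric]
    using N.inv_unique'[of "\<phi> v" "\<phi> u \<otimes>\<^bsub>N\<^esub> i"] i(1) c by simp
qed

lemma act_act: "is_module M X \<Longrightarrow> m \<in> carrier M \<Longrightarrow> n \<in> carrier M \<Longrightarrow> x \<in> pts X \<Longrightarrow> act X m (act X n x) = act X (m \<otimes>\<^bsub>M\<^esub> n) x"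
  and act_closed: "is_module M X \<Longrightarrow> m \<in> carrier M \<Longrightarrow> x \<in> pts X \<Longrightarrow> act X m x \<in> pts X"
  by (simp_all add: is_module_def)

lemma frac_expand:
  assumes "x \<in> pts X" "u \<in> H" "v \<in> H"
  shows "tfrac X (act X u x) (u \<otimes>\<^bsub>M\<^esub> v) = tfrac X x v"
  using assms units[OF H_mult[OF assms(2,3)]] inv_mult[of u v] by (simp add: tensor_slide)

text \<open>Since \<open>\<beta> = \<phi> m / \<phi> s\<close>, the class of \<open>(x, \<beta>)\<close> is that of \<open>(m x, 1 / \<phi> s)\<close>.\<close>

lemma frac_cases:
  assumes X: "is_module M X" and p: "p \<in> pts (BC X)"
  obtains x s where "x \<in> pts X" "s \<in> H" "p = tfrac X x s"
proof -
  obtain x \<beta> where x: "x \<in> pts X" "\<beta> \<in> carrier N" "p = T X x \<beta>" using p unfolding pts_base_change by blast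
  obtain s m where s: "s \<in> H" "m \<in> carrier M" "\<phi> s \<otimes>\<^bsub>N\<^esub> \<beta> = \<phi> m" using fractions[OF x(2)] by blast
  have "tfrac X (act X m x) s = T X x (\<phi> m \<otimes>\<^bsub>N\<^esub> inv\<^bsub>N\<^esub> \<phi> s)"
    using s x units by (simp add: tensor_slide)
  also have "\<phi> m \<otimes>\<^bsub>N\<^esub> inv\<^bsub>N\<^esub> \<phi> s = \<beta>"
  proof -
    have "\<phi> s \<otimes>\<^bsub>N\<^esub> (\<phi> m \<otimes>\<^bsub>N\<^esub> inv\<^bsub>N\<^esub> \<phi> s) = \<phi> m \<otimes>\<^bsub>N\<^esub> (\<phi> s \<otimes>\<^bsub>N\<^esub> inv\<^bsub>N\<^esub> \<phi> s)"
      using s units[OF s(1)] by (simp add: N.m_lcomm del: N.Units_r_inv)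
    then have "\<phi> s \<otimes>\<^bsub>N\<^esub> (\<phi> m \<otimes>\<^bsub>N\<^esub> inv\<^bsub>N\<^esub> \<phi> s) = \<phi> s \<otimes>\<^bsub>N\<^esub> \<beta>" using s units[OF s(1)] by simp
    then show ?thesis using unit_cancel[OF s(1), of "\<phi> m \<otimes>\<^bsub>N\<^esub> inv\<^bsub>N\<^esub> \<phi> s" \<beta>] s x units[OF s(1)] by simp
  qed
  finally show thesis using that[of "act X m x" s] s x act_closed[OF X] by metis
qed

text \<open>Base change along a localization is the localization of modules: \<open>x / u = y / v\<close> holds exactly
  when \<open>w v x = w u y\<close> for some \<open>w \<in> H\<close>.\<close>

lemma frac_tensor_eq_iff:
  assumes X: "is_module M X" and x: "x \<in> pts X" "u \<in> H" and y: "y \<in> pts X" "v \<in> H"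
  shows "tfrac X x u = tfrac X y v \<longleftrightarrow> (\<exists>w\<in>H. act X (w \<otimes>\<^bsub>M\<^esub> v) x = act X (w \<otimes>\<^bsub>M\<^esub> u) y)"
proof
  assume "\<exists>w\<in>H. act X (w \<otimes>\<^bsub>M\<^esub> v) x = act X (w \<otimes>\<^bsub>M\<^esub> u) y"
  then obtain w where w: "w \<in> H" "act X (w \<otimes>\<^bsub>M\<^esub> v) x = act X (w \<otimes>\<^bsub>M\<^esub> u) y" by blast
  have "tfrac X x u = tfrac X (act X (w \<otimes>\<^bsub>M\<^esub> v) x) ((w \<otimes>\<^bsub>M\<^esub> v) \<otimes>\<^bsub>M\<^esub> u)"
    using frac_expand[of x X "w \<otimes>\<^bsub>M\<^esub> v" u] w x y by simp
  also have "(w \<otimes>\<^bsub>M\<^esub> v) \<otimes>\<^bsub>M\<^esub> u = (w \<otimes>\<^bsub>M\<^esub> u) \<otimes>\<^bsub>M\<^esub> v" using w(1) x(2) y(2) by (simp add: M.m_ac)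
  also have "tfrac X (act X (w \<otimes>\<^bsub>M\<^esub> v) x) ((w \<otimes>\<^bsub>M\<^esub> u) \<otimes>\<^bsub>M\<^esub> v) = tfrac X y v"
    unfolding w(2) using frac_expand[of y X "w \<otimes>\<^bsub>M\<^esub> u" v] w(1) x y by simp
  finally show "tfrac X x u = tfrac X y v" .
next
  assume e: "tfrac X x u = tfrac X y v"
  \<comment> \<open>The relation "the tensor of the two arguments equals \<open>y / v\<close>", written without tensors: with
    \<open>\<phi> (w v) \<beta> = \<phi> m\<close> it compares \<open>m x\<close> with \<open>w y\<close>.  It respects the generating relations, hence
    the equality of \<open>x / u\<close> and \<open>y / v\<close> carries it from \<open>(y, 1 / \<phi> v)\<close> to \<open>(x, 1 / \<phi> u)\<close>.\<close>
  define F where "F = (\<lambda>x \<beta>. \<exists>w\<in>H. \<exists>m\<in>carrier M. \<phi> (w \<otimes>\<^bsub>M\<^esub> v) \<otimes>\<^bsub>N\<^esub> \<beta> = \<phi> m \<and> act X m x = act X w y)"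
  have inv: "F (act X a z) \<beta> = F z (\<phi> a \<otimes>\<^bsub>N\<^esub> \<beta>)" if a: "a \<in> carrier M" "z \<in> pts X" "\<beta> \<in> carrier N" for a z \<beta>
  proof
    assume "F (act X a z) \<beta>"
    then obtain w m where w: "w \<in> H" "m \<in> carrier M" "\<phi> (w \<otimes>\<^bsub>M\<^esub> v) \<otimes>\<^bsub>N\<^esub> \<beta> = \<phi> m" "act X m (act X a z) = act X w y"
      unfolding F_def by blast
    have "\<phi> (w \<otimes>\<^bsub>M\<^esub> v) \<otimes>\<^bsub>N\<^esub> (\<phi> a \<otimes>\<^bsub>N\<^esub> \<beta>) = \<phi> a \<otimes>\<^bsub>N\<^esub> (\<phi> (w \<otimes>\<^bsub>M\<^esub> v) \<otimes>\<^bsub>N\<^esub> \<beta>)"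
      using w(1) y a by (intro N.m_lcomm) simp_all
    also have "\<dots> = \<phi> (m \<otimes>\<^bsub>M\<^esub> a)" unfolding w(3) using w(2) a by (simp add: N.m_comm)
    finally show "F z (\<phi> a \<otimes>\<^bsub>N\<^esub> \<beta>)" unfolding F_def
      using w a act_act[OF X] by (intro bexI[of _ w] bexI[of _ "m \<otimes>\<^bsub>M\<^esub> a"]) auto
  next
    assume "F z (\<phi> a \<otimes>\<^bsub>N\<^esub> \<beta>)"
    then obtain w m where w: "w \<in> H" "m \<in> carrier M" "\<phi> (w \<otimes>\<^bsub>M\<^esub> v) \<otimes>\<^bsub>N\<^esub> (\<phi> a \<otimes>\<^bsub>N\<^esub> \<beta>) = \<phi> m" "act X m z = act X w y"
      unfolding F_def by blast
    obtain s k where s: "s \<in> H" "k \<in> carrier M" "\<phi> s \<otimes>\<^bsub>N\<^esub> \<beta> = \<phi> k" using fractions a by blast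
    have "\<phi> (s \<otimes>\<^bsub>M\<^esub> m) = \<phi> s \<otimes>\<^bsub>N\<^esub> (\<phi> (w \<otimes>\<^bsub>M\<^esub> v) \<otimes>\<^bsub>N\<^esub> (\<phi> a \<otimes>\<^bsub>N\<^esub> \<beta>))" using w s by simp
    also have "\<dots> = \<phi> (w \<otimes>\<^bsub>M\<^esub> v) \<otimes>\<^bsub>N\<^esub> (\<phi> a \<otimes>\<^bsub>N\<^esub> (\<phi> s \<otimes>\<^bsub>N\<^esub> \<beta>))"
      using w(1) s(1) a y by (simp add: N.m_ac)
    also have "\<dots> = \<phi> (w \<otimes>\<^bsub>M\<^esub> v \<otimes>\<^bsub>M\<^esub> a \<otimes>\<^bsub>M\<^esub> k)" using w(1) s a y by (simp add: N.m_assoc)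
    finally obtain r where r: "r \<in> H" "r \<otimes>\<^bsub>M\<^esub> (s \<otimes>\<^bsub>M\<^esub> m) = r \<otimes>\<^bsub>M\<^esub> (w \<otimes>\<^bsub>M\<^esub> v \<otimes>\<^bsub>M\<^esub> a \<otimes>\<^bsub>M\<^esub> k)"
      using separated[of "s \<otimes>\<^bsub>M\<^esub> m" "w \<otimes>\<^bsub>M\<^esub> v \<otimes>\<^bsub>M\<^esub> a \<otimes>\<^bsub>M\<^esub> k"] w(1,2) s a y by auto
    let ?w = "r \<otimes>\<^bsub>M\<^esub> s \<otimes>\<^bsub>M\<^esub> w" and ?m = "r \<otimes>\<^bsub>M\<^esub> w \<otimes>\<^bsub>M\<^esub> v \<otimes>\<^bsub>M\<^esub> k"
    have "\<phi> (?w \<otimes>\<^bsub>M\<^esub> v) \<otimes>\<^bsub>N\<^esub> \<beta> = \<phi> (r \<otimes>\<^bsub>M\<^esub> w \<otimes>\<^bsub>M\<^esub> v) \<otimes>\<^bsub>N\<^esub> (\<phi> s \<otimes>\<^bsub>N\<^esub> \<beta>)"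
      using r(1) s(1) w(1) y a by (simp add: N.m_ac)
    also have "\<dots> = \<phi> ?m" unfolding s(3) using r(1) s w(1) y by simp
    finally have 1: "\<phi> (?w \<otimes>\<^bsub>M\<^esub> v) \<otimes>\<^bsub>N\<^esub> \<beta> = \<phi> ?m" .
    have "act X ?m (act X a z) = act X (r \<otimes>\<^bsub>M\<^esub> (w \<otimes>\<^bsub>M\<^esub> v \<otimes>\<^bsub>M\<^esub> a \<otimes>\<^bsub>M\<^esub> k)) z"
      using r(1) s w(1) y a by (simp add: act_act[OF X] M.m_ac)
    also have "\<dots> = act X (r \<otimes>\<^bsub>M\<^esub> s) (act X m z)"
      unfolding r(2)[symmetric] using r(1) s w(2) a by (simp add: act_act[OF X] M.m_assoc)
    also have "\<dots> = act X ?w y" unfolding w(4) using r(1) s w(1) y by (simp add: act_act[OF X])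
    finally have 2: "act X ?m (act X a z) = act X ?w y" .
    show "F (act X a z) \<beta>" unfolding F_def
      by (rule bexI[of _ ?w], rule bexI[of _ ?m]) (use 1 2 r(1) s w(1,2) y in simp_all)
  qed
  have U: "\<phi> u \<in> Units N" "\<phi> v \<in> Units N" using units x y by blast+
  have "F y (inv\<^bsub>N\<^esub> \<phi> v)" unfolding F_def
    using y U by (intro bexI[of _ "\<one>\<^bsub>M\<^esub>"]) auto
  moreover have "F x (inv\<^bsub>N\<^esub> \<phi> u) = F y (inv\<^bsub>N\<^esub> \<phi> v)"
    by (rule tensor_invariant_eq[where F = F, OF inv e y(1)]) (use U in simp_all)
  ultimately have "F x (inv\<^bsub>N\<^esub> \<phi> u)" by simp
  then obtain w m where w: "w \<in> H" "m \<in> carrier M" "\<phi> (w \<otimes>\<^bsub>M\<^esub> v) \<otimes>\<^bsub>N\<^esub> inv\<^bsub>N\<^esub> \<phi> u = \<phi> m" "act X m x = act X w y"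
    unfolding F_def by blast
  have "\<phi> (w \<otimes>\<^bsub>M\<^esub> v) = (\<phi> (w \<otimes>\<^bsub>M\<^esub> v) \<otimes>\<^bsub>N\<^esub> inv\<^bsub>N\<^esub> \<phi> u) \<otimes>\<^bsub>N\<^esub> \<phi> u"
    using w(1) y x U by (simp add: N.m_assoc)
  then have "\<phi> (w \<otimes>\<^bsub>M\<^esub> v) = \<phi> (m \<otimes>\<^bsub>M\<^esub> u)" unfolding w(3) using w(2) x by simp
  then obtain r where r: "r \<in> H" "r \<otimes>\<^bsub>M\<^esub> (w \<otimes>\<^bsub>M\<^esub> v) = r \<otimes>\<^bsub>M\<^esub> (m \<otimes>\<^bsub>M\<^esub> u)"
    using separated[of "w \<otimes>\<^bsub>M\<^esub> v" "m \<otimes>\<^bsub>M\<^esub> u"] w x y by auto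
  have "act X (r \<otimes>\<^bsub>M\<^esub> w \<otimes>\<^bsub>M\<^esub> v) x = act X (r \<otimes>\<^bsub>M\<^esub> (m \<otimes>\<^bsub>M\<^esub> u)) x" 
    using r w(1) y by (simp add: M.m_assoc)
  also have "\<dots> = act X (r \<otimes>\<^bsub>M\<^esub> u) (act X m x)" using r(1) w(2) x by (simp add: act_act[OF X] M.m_ac)
  also have "\<dots> = act X (r \<otimes>\<^bsub>M\<^esub> w \<otimes>\<^bsub>M\<^esub> u) y" unfolding w(4) using r(1) w(1) x y by (simp add: act_act[OF X] M.m_ac)
  finally show "\<exists>w\<in>H. act X (w \<otimes>\<^bsub>M\<^esub> v) x = act X (w \<otimes>\<^bsub>M\<^esub> u) y" using r(1) w(1) by (auto intro: H_mult)
qed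

text \<open>This is where the finiteness of the diagrams enters.\<close>

lemma common_multiple:
  assumes "finite K" "\<And>k. k \<in> K \<Longrightarrow> \<exists>w\<in>H. P k w"
    and "\<And>k w v. k \<in> K \<Longrightarrow> w \<in> H \<Longrightarrow> v \<in> H \<Longrightarrow> P k w \<Longrightarrow> P k (v \<otimes>\<^bsub>M\<^esub> w)"
  shows "\<exists>w\<in>H. \<forall>k\<in>K. P k w"
  using assms
proof (induction K rule: finite_induct)
  case (insert k K)
  then obtain w where w: "w \<in> H" "\<forall>k\<in>K. P k w" by auto
  obtain v where v: "v \<in> H" "P k v" using insert.prems(1)[of k] by blast
  have "P l (v \<otimes>\<^bsub>M\<^esub> w)" if "l \<in> K" for l using insert.prems(2)[of l w v] that w v by simp
  moreover have "P k (w \<otimes>\<^bsub>M\<^esub> v)" using insert.prems(2)[of k v w] w v by simp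
  ultimately show ?case using w v by (intro bexI[of _ "v \<otimes>\<^bsub>M\<^esub> w"]) (auto simp: M.m_comm)
qed (use H_one in blast)

text \<open>Injectivity: two fractions in the limit that agree in each component do so after multiplication by
  some \<open>w \<in> H\<close>, and finitely many components have a common \<open>w\<close>.  Surjectivity: a compatible family is
  first written with one denominator \<open>u\<close>; its numerators satisfy the compatibility equations after
  multiplication by a common \<open>w\<close>, so \<open>(w x\<^sub>j)\<^sub>j\<close> is a point of the limit, over the denominator \<open>w u\<close>.\<close>

lemma flat: "flat TYPE('u) M N \<phi>"
  unfolding flat_def
proof (intro allI impI)
  fix J :: "nat cat" and D :: "nat \<Rightarrow> ('a, 'u) mset" and d
  assume h: "finite_category J \<and> module_diagram M J D d"
  let ?L = "module_limit J D d"
  let ?R = "module_limit J (\<lambda>j. BC (D j)) (\<lambda>f. base_change_map M N \<phi> (D (tgt J f)) (d f))"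
  let ?\<Phi> = "\<lambda>p. \<lambda>j\<in>ob J. base_change_map M N \<phi> (D j) (\<lambda>x. x j) p"
  have fin: "finite (ob J)" "finite (ar J)" using h by (auto simp: finite_category_def)
  have m: "is_module M (D j)" if "j \<in> ob J" for j using h that by (auto simp: module_diagram_def)
  have ar: "src J f \<in> ob J" "tgt J f \<in> ob J" "d f \<in> module_hom M (D (src J f)) (D (tgt J f))" if "f \<in> ar J" for f
    using h that by (auto simp: module_diagram_def finite_category_def)
  have d_act: "d f (act (D (src J f)) a x) = act (D (tgt J f)) a (d f x)" "d f x \<in> pts (D (tgt J f))"
    if "f \<in> ar J" "a \<in> carrier M" "x \<in> pts (D (src J f))" for f a x
    using ar(3)[OF that(1)] that(2,3) by (auto simp: module_hom_def)
  have L: "is_module M ?L" "\<And>j. j \<in> ob J \<Longrightarrow> (\<lambda>x. x j) \<in> module_hom M ?L (D j)"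
    using is_module_limit[of J M D d] h by blast+
  have Lp: "x j \<in> pts (D j)" if "x \<in> pts ?L" "j \<in> ob J" for x j using that by (auto simp: module_limit_def)
  have Ld: "d f (x (src J f)) = x (tgt J f)" if "x \<in> pts ?L" "f \<in> ar J" for x f using that by (auto simp: module_limit_def)
  have \<Phi>: "?\<Phi> (T ?L x \<beta>) = (\<lambda>j\<in>ob J. T (D j) (x j) \<beta>)" if "x \<in> pts ?L" "\<beta> \<in> carrier N" for x \<beta>
    by (intro restrict_ext base_change_map_class[OF L(2) that])
  have "?\<Phi> \<in> module_hom N (BC ?L) ?R"
    unfolding module_hom_def
  proof (safe)
    fix p assume "p \<in> pts (BC ?L)"
    then obtain x \<beta> where x: "x \<in> pts ?L" "\<beta> \<in> carrier N" and p: "p = T ?L x \<beta>" unfolding pts_base_change by blast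
    show "?\<Phi> p \<in> pts ?R" unfolding p \<Phi>[OF x]
      using x Lp ar base_change_map_class[OF ar(3)]
      by (auto simp: module_limit_def pts_base_change)
  next
    fix c p assume c: "c \<in> carrier N" and "p \<in> pts (BC ?L)"
    then obtain x \<beta> where x: "x \<in> pts ?L" "\<beta> \<in> carrier N" and p: "p = T ?L x \<beta>" unfolding pts_base_change by blast
    have "?\<Phi> (act (BC ?L) c p) = (\<lambda>j\<in>ob J. T (D j) (x j) (c \<otimes>\<^bsub>N\<^esub> \<beta>))"
      unfolding p act_base_change[OF x c] using x c by (intro \<Phi>) simp_all
    also have "\<dots> = (\<lambda>j\<in>ob J. act (BC (D j)) c (T (D j) (x j) \<beta>))"
      by (intro restrict_ext act_base_change[symmetric] Lp[OF x(1)] x(2) c)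
    also have "\<dots> = act ?R c (?\<Phi> p)" unfolding p \<Phi>[OF x] by (simp add: module_limit_def cong: restrict_cong)
    finally show "?\<Phi> (act (BC ?L) c p) = act ?R c (?\<Phi> p)" .
  qed
  moreover have "inj_on ?\<Phi> (pts (BC ?L))"
  proof (rule inj_onI)
    fix p q assume p: "p \<in> pts (BC ?L)" and q: "q \<in> pts (BC ?L)" and e: "?\<Phi> p = ?\<Phi> q"
    obtain x u where x: "x \<in> pts ?L" "u \<in> H" "p = tfrac ?L x u" using frac_cases[OF L(1) p] .
    obtain y v where y: "y \<in> pts ?L" "v \<in> H" "q = tfrac ?L y v" using frac_cases[OF L(1) q] .
    have "\<exists>w\<in>H. \<forall>j\<in>ob J. act (D j) (w \<otimes>\<^bsub>M\<^esub> v) (x j) = act (D j) (w \<otimes>\<^bsub>M\<^esub> u) (y j)"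
    proof (rule common_multiple[OF fin(1)])
      fix j assume j: "j \<in> ob J"
      have "(\<lambda>j\<in>ob J. tfrac (D j) (x j) u) j = (\<lambda>j\<in>ob J. tfrac (D j) (y j) v) j"
        using e x y units by (simp only: \<Phi> N.Units_inv_closed)
      then show "\<exists>w\<in>H. act (D j) (w \<otimes>\<^bsub>M\<^esub> v) (x j) = act (D j) (w \<otimes>\<^bsub>M\<^esub> u) (y j)"
        using frac_tensor_eq_iff[OF m[OF j] Lp[OF x(1) j] x(2) Lp[OF y(1) j] y(2)] j by simp
    next
      fix j w z assume j: "j \<in> ob J" and w: "w \<in> H" "z \<in> H"
        and e: "act (D j) (w \<otimes>\<^bsub>M\<^esub> v) (x j) = act (D j) (w \<otimes>\<^bsub>M\<^esub> u) (y j)"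
      show "act (D j) (z \<otimes>\<^bsub>M\<^esub> w \<otimes>\<^bsub>M\<^esub> v) (x j) = act (D j) (z \<otimes>\<^bsub>M\<^esub> w \<otimes>\<^bsub>M\<^esub> u) (y j)"
        using arg_cong[OF e, of "act (D j) z"] w x y Lp j by (simp add: act_act[OF m[OF j]] M.m_assoc)
    qed
    then obtain w where "w \<in> H" "\<forall>j\<in>ob J. act (D j) (w \<otimes>\<^bsub>M\<^esub> v) (x j) = act (D j) (w \<otimes>\<^bsub>M\<^esub> u) (y j)" by blast
    then have "act ?L (w \<otimes>\<^bsub>M\<^esub> v) x = act ?L (w \<otimes>\<^bsub>M\<^esub> u) y" by (auto simp: module_limit_def)
    then show "p = q" unfolding x(3) y(3) using frac_tensor_eq_iff[OF L(1) x(1,2) y(1,2)] \<open>w \<in> H\<close> by blast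
  qed
  moreover have "pts ?R \<subseteq> ?\<Phi> ` pts (BC ?L)"
  proof
    fix z assume z: "z \<in> pts ?R"
    have zp: "z j \<in> pts (BC (D j))" if "j \<in> ob J" for j using z that by (auto simp: module_limit_def)
    have zd: "base_change_map M N \<phi> (D (tgt J f)) (d f) (z (src J f)) = z (tgt J f)" if "f \<in> ar J" for f
      using z that by (auto simp: module_limit_def)
    have zx: "z \<in> extensional (ob J)" using z by (auto simp: module_limit_def PiE_def)
    have "\<exists>u\<in>H. \<forall>j\<in>ob J. \<exists>x\<in>pts (D j). z j = tfrac (D j) x u"
    proof (rule common_multiple[OF fin(1)])
      fix j assume j: "j \<in> ob J"
      then show "\<exists>u\<in>H. \<exists>x\<in>pts (D j). z j = tfrac (D j) x u" using frac_cases[OF m[OF j] zp[OF j]] by metis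
    next
      fix j w v assume j: "j \<in> ob J" and w: "w \<in> H" "v \<in> H" and "\<exists>x\<in>pts (D j). z j = tfrac (D j) x w"
      then obtain x where x: "x \<in> pts (D j)" "z j = tfrac (D j) x w" by blast
      then show "\<exists>x\<in>pts (D j). z j = tfrac (D j) x (v \<otimes>\<^bsub>M\<^esub> w)"
        using frac_expand[OF x(1) w(2,1)] act_closed[OF m[OF j], of v x] w by (intro bexI[of _ "act (D j) v x"]) auto
    qed
    then obtain u where u: "u \<in> H" "\<forall>j\<in>ob J. \<exists>x\<in>pts (D j). z j = tfrac (D j) x u" by blast
    then obtain x where x: "\<And>j. j \<in> ob J \<Longrightarrow> x j \<in> pts (D j)" "\<And>j. j \<in> ob J \<Longrightarrow> z j = tfrac (D j) (x j) u" by metis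
    have iu: "inv\<^bsub>N\<^esub> \<phi> u \<in> carrier N" using units[OF u(1)] by simp
    have "\<exists>w\<in>H. \<forall>f\<in>ar J. act (D (tgt J f)) w (d f (x (src J f))) = act (D (tgt J f)) w (x (tgt J f))"
    proof (rule common_multiple[OF fin(2)])
      fix f assume f: "f \<in> ar J"
      have c: "d f (x (src J f)) \<in> pts (D (tgt J f))" using d_act(2)[of f "\<one>\<^bsub>M\<^esub>"] f x ar by simp
      have "tfrac (D (tgt J f)) (d f (x (src J f))) u = tfrac (D (tgt J f)) (x (tgt J f)) u"
        using zd[OF f] base_change_map_class[OF ar(3)[OF f] x(1) iu] x(2) ar f by simp
      then obtain w where "w \<in> H" "act (D (tgt J f)) (w \<otimes>\<^bsub>M\<^esub> u) (d f (x (src J f))) = act (D (tgt J f)) (w \<otimes>\<^bsub>M\<^esub> u) (x (tgt J f))"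
        using frac_tensor_eq_iff[OF m[OF ar(2)[OF f]] c u(1) x(1)[OF ar(2)[OF f]] u(1)] by blast
      then show "\<exists>w\<in>H. act (D (tgt J f)) w (d f (x (src J f))) = act (D (tgt J f)) w (x (tgt J f))"
        using u(1) H_mult by blast
    next
      fix f w v assume f: "f \<in> ar J" and w: "w \<in> H" "v \<in> H"
        and e: "act (D (tgt J f)) w (d f (x (src J f))) = act (D (tgt J f)) w (x (tgt J f))"
      have c: "d f (x (src J f)) \<in> pts (D (tgt J f))" using d_act(2)[of f "\<one>\<^bsub>M\<^esub>"] f x ar by simp
      show "act (D (tgt J f)) (v \<otimes>\<^bsub>M\<^esub> w) (d f (x (src J f))) = act (D (tgt J f)) (v \<otimes>\<^bsub>M\<^esub> w) (x (tgt J f))"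
        using e c w x ar[OF f] by (simp add: act_act[OF m, symmetric])
    qed
    then obtain w where w: "w \<in> H" "\<And>f. f \<in> ar J \<Longrightarrow> act (D (tgt J f)) w (d f (x (src J f))) = act (D (tgt J f)) w (x (tgt J f))" by blast
    let ?y = "\<lambda>j\<in>ob J. act (D j) w (x j)"
    have y: "?y \<in> pts ?L"
      using x ar d_act w act_closed[OF m] by (auto simp: module_limit_def)
    have wu: "w \<otimes>\<^bsub>M\<^esub> u \<in> H" using w u by simp
    have "?\<Phi> (tfrac ?L ?y (w \<otimes>\<^bsub>M\<^esub> u)) = (\<lambda>j\<in>ob J. tfrac (D j) (?y j) (w \<otimes>\<^bsub>M\<^esub> u))"
      using \<Phi>[OF y] units[OF wu] by blast
    also have "\<dots> = z"
      by (rule extensionalityI[OF _ zx]) (use frac_expand[OF x(1) w(1) u(1)] x(2) in auto)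
    finally have "z = ?\<Phi> (tfrac ?L ?y (w \<otimes>\<^bsub>M\<^esub> u))" by simp
    moreover have "tfrac ?L ?y (w \<otimes>\<^bsub>M\<^esub> u) \<in> pts (BC ?L)"
      unfolding pts_base_change using y units[OF wu] by blast
    ultimately show "z \<in> ?\<Phi> ` pts (BC ?L)" by (rule image_eqI)
  qed
  ultimately show "?\<Phi> \<in> module_iso N (BC ?L) ?R"
    unfolding module_iso_def bij_betw_def by (auto simp: module_hom_def)
qed

end

section \<open>Flat homomorphisms are localizations\<close>

context spec_hom begin

text \<open>The surjectivity of the comparison map, as flatness is used below: a compatible family of pure
  tensors comes from one pure tensor over the limit.\<close>

lemma flat_lift:
  assumes flat: "flat TYPE('u) M N \<phi>" and J: "finite_category J" and D: "module_diagram M J (D :: nat \<Rightarrow> ('a, 'u) mset) d"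
    and x: "\<And>j. j \<in> ob J \<Longrightarrow> x j \<in> pts (D j)" and \<beta>: "\<And>j. j \<in> ob J \<Longrightarrow> \<beta> j \<in> carrier N"
    and compat: "\<And>f. f \<in> ar J \<Longrightarrow> T (D (tgt J f)) (d f (x (src J f))) (\<beta> (src J f)) = T (D (tgt J f)) (x (tgt J f)) (\<beta> (tgt J f))"
  shows "\<exists>y\<in>pts (module_limit J D d). \<exists>c\<in>carrier N. \<forall>j\<in>ob J. T (D j) (y j) c = T (D j) (x j) (\<beta> j)"
proof -
  let ?L = "module_limit J D d"
  let ?R = "module_limit J (\<lambda>j. BC (D j)) (\<lambda>f. base_change_map M N \<phi> (D (tgt J f)) (d f))"
  let ?\<Phi> = "\<lambda>p. \<lambda>j\<in>ob J. base_change_map M N \<phi> (D j) (\<lambda>x. x j) p"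
  let ?z = "\<lambda>j\<in>ob J. T (D j) (x j) (\<beta> j)"
  have "bij_betw ?\<Phi> (pts (BC ?L)) (pts ?R)" using flat J D unfolding flat_def module_iso_def by blast
  moreover have "?z \<in> pts ?R"
  proof -
    have "base_change_map M N \<phi> (D (tgt J f)) (d f) (?z (src J f)) = ?z (tgt J f)" if f: "f \<in> ar J" for f
    proof -
      have o: "src J f \<in> ob J" "tgt J f \<in> ob J" "d f \<in> module_hom M (D (src J f)) (D (tgt J f))"
        using J D f by (auto simp: module_diagram_def finite_category_def)
      show ?thesis using base_change_map_class[OF o(3) x[OF o(1)] \<beta>[OF o(1)]] compat[OF f] o by simp
    qed
    moreover have "?z \<in> (\<Pi>\<^sub>E j\<in>ob J. pts (BC (D j)))" using x \<beta> by (auto simp: pts_base_change)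
    ultimately show ?thesis by (simp add: module_limit_def)
  qed
  ultimately have "?z \<in> ?\<Phi> ` pts (BC ?L)" by (simp only: bij_betw_imp_surj_on)
  then obtain p where p: "?z = ?\<Phi> p" "p \<in> pts (BC ?L)" by (rule imageE)
  obtain y c where y: "y \<in> pts ?L" "c \<in> carrier N" "p = T ?L y c" using p(2) unfolding pts_base_change by blast
  have "T (D j) (y j) c = T (D j) (x j) (\<beta> j)" if j: "j \<in> ob J" for j
  proof -
    have "T (D j) (y j) c = ?\<Phi> p j"
      using base_change_map_class[OF is_module_limit(2)[OF J D j] y(1,2)] j by (simp add: y(3))
    then show ?thesis using p(1)[symmetric] j by simp
  qed
  then show ?thesis using y by blast
qed

text \<open>A copy of \<open>M\<close>, as a module over itself, in the universe of test objects.\<close>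

definition regular :: "('a \<Rightarrow> 'u) \<Rightarrow> ('a, 'u) mset" where
  "regular e = \<lparr>pts = e ` carrier M, act = (\<lambda>m x. e (m \<otimes>\<^bsub>M\<^esub> inv_into (carrier M) e x))\<rparr>"

context
  fixes e :: "'a \<Rightarrow> 'u" assumes e: "inj_on e (carrier M)"
begin

lemma regular_cases:
  assumes "x \<in> pts (regular e)" obtains m where "m \<in> carrier M" "x = e m"
  using assms by (auto simp: regular_def)

lemma regular_mem: "m \<in> carrier M \<Longrightarrow> e m \<in> pts (regular e)"
  by (simp add: regular_def)

lemma regular_act: "n \<in> carrier M \<Longrightarrow> act (regular e) m (e n) = e (m \<otimes>\<^bsub>M\<^esub> n)"
  using e by (simp add: regular_def)

lemma regular_module: "is_module M (regular e)"
  by (auto simp: is_module_def regular_mem regular_act M.m_assoc elim!: regular_cases)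

lemma regular_hom: "m \<in> carrier M \<Longrightarrow> act (regular e) m \<in> module_hom M (regular e) (regular e)"
  by (auto simp: module_hom_def regular_mem regular_act M.m_lcomm elim!: regular_cases)

text \<open>The part of the isomorphism between \<open>M \<otimes> N\<close> and \<open>N\<close> that is needed here.\<close>

lemma regular_tensor_eq:
  assumes "T (regular e) (e m) \<beta> = T (regular e) (e n) c" "m \<in> carrier M" "n \<in> carrier M" "\<beta> \<in> carrier N" "c \<in> carrier N"
  shows "\<phi> m \<otimes>\<^bsub>N\<^esub> \<beta> = \<phi> n \<otimes>\<^bsub>N\<^esub> c"
proof -
  let ?F = "\<lambda>x \<beta>. \<phi> (inv_into (carrier M) e x) \<otimes>\<^bsub>N\<^esub> \<beta>"
  have "?F (e m) \<beta> = ?F (e n) c"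
  proof (rule tensor_invariant_eq[where F = ?F])
    fix k x \<beta> assume k: "k \<in> carrier M" and "x \<in> pts (regular e)" and \<beta>: "\<beta> \<in> carrier N"
    then obtain l where "l \<in> carrier M" "x = e l" by (blast elim: regular_cases)
    then show "?F (act (regular e) k x) \<beta> = ?F x (\<phi> k \<otimes>\<^bsub>N\<^esub> \<beta>)"
      using e k \<beta> by (simp add: regular_act N.m_ac)
  qed (use assms in \<open>auto simp: regular_mem\<close>)
  then show ?thesis using e assms by simp
qed

text \<open>The product of two copies of \<open>M\<close>: the pair of \<open>1 \<otimes> x\<close> and \<open>1 \<otimes> y\<close> comes from some \<open>(m, n) \<otimes> c\<close>.\<close>

lemma flat_common_denominator:
  assumes "flat TYPE('u) M N \<phi>" "x \<in> carrier N" "y \<in> carrier N"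
  shows "\<exists>m\<in>carrier M. \<exists>n\<in>carrier M. \<exists>c\<in>carrier N. \<phi> m \<otimes>\<^bsub>N\<^esub> c = x \<and> \<phi> n \<otimes>\<^bsub>N\<^esub> c = y"
proof -
  define J :: "nat cat" where
    "J = \<lparr>ob = {0, 1}, ar = {0, 1}, src = (\<lambda>f. f), tgt = (\<lambda>f. f), idt = (\<lambda>f. f), cmp = (\<lambda>g f. f)\<rparr>"
  let ?D = "\<lambda>_ :: nat. regular e" and ?d = "\<lambda>(_ :: nat) x. x"
  have J: "finite_category J" unfolding J_def finite_category_def by auto
  have D: "module_diagram M J ?D ?d"
    unfolding module_diagram_def by (auto simp: regular_module module_hom_def)
  have "\<exists>l\<in>pts (module_limit J ?D ?d). \<exists>c\<in>carrier N. \<forall>j\<in>ob J.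
      T (regular e) (l j) c = T (regular e) (e \<one>\<^bsub>M\<^esub>) (if j = 0 then x else y)"
    by (rule flat_lift[OF assms(1) J D]) (use assms(2,3) in \<open>auto simp: regular_mem J_def\<close>)
  then obtain l c where l: "l \<in> pts (module_limit J ?D ?d)" "c \<in> carrier N"
    "\<And>j. j \<in> ob J \<Longrightarrow> T (regular e) (l j) c = T (regular e) (e \<one>\<^bsub>M\<^esub>) (if j = 0 then x else y)"
    by blast
  have "l 0 \<in> pts (regular e)" "l 1 \<in> pts (regular e)" using l(1) by (auto simp: module_limit_def J_def)
  then obtain m n where m: "m \<in> carrier M" "l 0 = e m" "n \<in> carrier M" "l 1 = e n" by (blast elim: regular_cases)
  have "T (regular e) (e m) c = T (regular e) (e \<one>\<^bsub>M\<^esub>) x" "T (regular e) (e n) c = T (regular e) (e \<one>\<^bsub>M\<^esub>) y"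
    using l(3)[of 0] l(3)[of 1] m by (simp_all add: J_def)
  then have "\<phi> m \<otimes>\<^bsub>N\<^esub> c = x" "\<phi> n \<otimes>\<^bsub>N\<^esub> c = y"
    using regular_tensor_eq[of m c "\<one>\<^bsub>M\<^esub>" x] regular_tensor_eq[of n c "\<one>\<^bsub>M\<^esub>" y] m l(2) assms(2,3) by simp_all
  then show ?thesis using m l(2) by blast
qed

text \<open>The equalizer of the multiplications by \<open>m\<close> and \<open>n\<close>: their base changes agree on \<open>1 \<otimes> 1\<close>, which
  therefore comes from some \<open>u \<otimes> c\<close> with \<open>m u = n u\<close> and \<open>\<phi> u c = 1\<close>.\<close>

lemma flat_equalize:
  assumes "flat TYPE('u) M N \<phi>" "m \<in> carrier M" "n \<in> carrier M" "\<phi> m = \<phi> n"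
  shows "\<exists>u\<in>carrier M. \<phi> u \<in> Units N \<and> u \<otimes>\<^bsub>M\<^esub> m = u \<otimes>\<^bsub>M\<^esub> n"
proof -
  \<comment> \<open>Two parallel arrows 2 and 3 from 0 to 1; the objects 0 and 1 serve as their own identities.\<close>
  define J :: "nat cat" where
    "J = \<lparr>ob = {0, 1}, ar = {0, 1, 2, 3}, src = (\<lambda>f. if f = 1 then 1 else 0), tgt = (\<lambda>f. if f = 0 then 0 else 1),
          idt = (\<lambda>f. f), cmp = (\<lambda>g f. if f \<le> 1 then g else f)\<rparr>"
  let ?D = "\<lambda>_ :: nat. regular e"
  define d where "d = (\<lambda>f :: nat. if f \<le> 1 then (\<lambda>x. x) else act (regular e) (if f = 2 then m else n))"
  have J: "finite_category J" unfolding J_def finite_category_def by auto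
  have D: "module_diagram M J ?D d"
    unfolding module_diagram_def
    using regular_hom[OF assms(2)] regular_hom[OF assms(3)]
    by (auto simp: regular_module d_def J_def) (auto simp: module_hom_def)
  have comp: "T (regular e) (d f (e \<one>\<^bsub>M\<^esub>)) (if src J f = 0 then \<one>\<^bsub>N\<^esub> else \<phi> m)
      = T (regular e) (e \<one>\<^bsub>M\<^esub>) (if tgt J f = 0 then \<one>\<^bsub>N\<^esub> else \<phi> m)" if "f \<in> ar J" for f
    using that assms(2,3) tensor_slide[of m "e \<one>\<^bsub>M\<^esub>" "regular e" "\<one>\<^bsub>N\<^esub>"] tensor_slide[of n "e \<one>\<^bsub>M\<^esub>" "regular e" "\<one>\<^bsub>N\<^esub>"]
    by (auto simp: J_def d_def regular_mem assms(4))
  have "\<exists>l\<in>pts (module_limit J ?D d). \<exists>c\<in>carrier N. \<forall>j\<in>ob J.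
      T (regular e) (l j) c = T (regular e) (e \<one>\<^bsub>M\<^esub>) (if j = 0 then \<one>\<^bsub>N\<^esub> else \<phi> m)"
    by (rule flat_lift[OF assms(1) J D _ _ comp]) (use assms(2,3) in \<open>auto simp: regular_mem\<close>)
  then obtain l c where l: "l \<in> pts (module_limit J ?D d)" "c \<in> carrier N"
    "\<And>j. j \<in> ob J \<Longrightarrow> T (regular e) (l j) c = T (regular e) (e \<one>\<^bsub>M\<^esub>) (if j = 0 then \<one>\<^bsub>N\<^esub> else \<phi> m)"
    by blast
  have "l 0 \<in> pts (regular e)" using l(1) by (auto simp: module_limit_def J_def)
  then obtain u where u: "u \<in> carrier M" "l 0 = e u" by (blast elim: regular_cases)
  have lf: "d f (l (src J f)) = l (tgt J f)" if "f \<in> ar J" for f using l(1) that by (auto simp: module_limit_def)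
  have "d 2 (l 0) = l 1" "d 3 (l 0) = l 1" using lf[of 2] lf[of 3] by (simp_all add: J_def)
  then have "e (m \<otimes>\<^bsub>M\<^esub> u) = e (n \<otimes>\<^bsub>M\<^esub> u)" using u by (simp add: d_def regular_act)
  then have 1: "u \<otimes>\<^bsub>M\<^esub> m = u \<otimes>\<^bsub>M\<^esub> n" using e u assms(2,3) by (simp add: inj_on_def M.m_comm)
  have "T (regular e) (e u) c = T (regular e) (e \<one>\<^bsub>M\<^esub>) \<one>\<^bsub>N\<^esub>" using l(3)[of 0] u by (simp add: J_def)
  then have 2: "\<phi> u \<otimes>\<^bsub>N\<^esub> c = \<one>\<^bsub>N\<^esub>" using regular_tensor_eq[of u c "\<one>\<^bsub>M\<^esub>" "\<one>\<^bsub>N\<^esub>"] u l(2) by simp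
  then have "c \<otimes>\<^bsub>N\<^esub> \<phi> u = \<one>\<^bsub>N\<^esub>" using u l(2) by (simp add: N.m_comm)
  then show ?thesis using 1 2 u l(2) unfolding Units_def by auto
qed

end

text \<open>Both lemmas are applied to \<open>1\<close>: a common denominator \<open>c\<close> of \<open>1 = \<phi> s c\<close> and \<open>x = \<phi> m c\<close> is the
  inverse of \<open>\<phi> s\<close>.\<close>

lemma flat_loc_hom:
  assumes "flat TYPE('u) M N \<phi>" "carrier M \<lesssim> (UNIV :: 'u set)"
  shows "loc_hom M N \<phi> {s \<in> carrier M. \<phi> s \<in> Units N}"
proof -
  obtain e :: "'a \<Rightarrow> 'u" where e: "inj_on e (carrier M)" using assms(2) unfolding lepoll_def by blast
  show ?thesis
  proof (rule loc_homI[OF spec_hom_axioms])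
    show "submonoid {s \<in> carrier M. \<phi> s \<in> Units N} M" by (auto simp: submonoid_def)
    fix x assume x: "x \<in> carrier N"
    obtain s m c where h: "s \<in> carrier M" "m \<in> carrier M" "c \<in> carrier N" "\<phi> s \<otimes>\<^bsub>N\<^esub> c = \<one>\<^bsub>N\<^esub>" "\<phi> m \<otimes>\<^bsub>N\<^esub> c = x"
      using flat_common_denominator[OF e assms(1) _ x, of "\<one>\<^bsub>N\<^esub>"] by auto
    have "c \<otimes>\<^bsub>N\<^esub> \<phi> s = \<one>\<^bsub>N\<^esub>" using h by (simp add: N.m_comm)
    then have "\<phi> s \<in> Units N" using h unfolding Units_def by auto
    moreover have "\<phi> s \<otimes>\<^bsub>N\<^esub> x = \<phi> m \<otimes>\<^bsub>N\<^esub> (\<phi> s \<otimes>\<^bsub>N\<^esub> c)" unfolding h(5)[symmetric] using h(1-3) by (simp add: N.m_lcomm)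
    ultimately show "\<exists>s\<in>{s \<in> carrier M. \<phi> s \<in> Units N}. \<exists>m\<in>carrier M. \<phi> s \<otimes>\<^bsub>N\<^esub> x = \<phi> m"
      using h by (intro bexI[of _ s] bexI[of _ m]) auto
  qed (use flat_equalize[OF e assms(1)] in auto)
qed

end

section \<open>Direct limits\<close>

locale directed_sets =
  fixes I :: "'i set" and leq :: "'i \<Rightarrow> 'i \<Rightarrow> bool" and X :: "'i \<Rightarrow> 'x set" and t :: "'i \<Rightarrow> 'i \<Rightarrow> 'x \<Rightarrow> 'x"
  assumes directed: "directed_set I leq"
    and push_closed: "\<lbrakk>i \<in> I; j \<in> I; leq i j; x \<in> X i\<rbrakk> \<Longrightarrow> t i j x \<in> X j"
    and push_refl: "\<lbrakk>i \<in> I; x \<in> X i\<rbrakk> \<Longrightarrow> t i i x = x"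
    and push_push: "\<lbrakk>i \<in> I; j \<in> I; k \<in> I; leq i j; leq j k; x \<in> X i\<rbrakk> \<Longrightarrow> t j k (t i j x) = t i k x"
begin

abbreviation (input) "cls \<equiv> dlim_class I leq X t"

lemma leq_refl: "i \<in> I \<Longrightarrow> leq i i" using directed unfolding directed_set_def by blast

lemma leq_trans: "\<lbrakk>leq i j; leq j k; i \<in> I; j \<in> I; k \<in> I\<rbrakk> \<Longrightarrow> leq i k"
  using directed unfolding directed_set_def by blast

lemma upper_bound:
  assumes "i \<in> I" "j \<in> I" obtains k where "k \<in> I" "leq i k" "leq j k"
  using directed assms unfolding directed_set_def by blast

lemma index: obtains i where "i \<in> I" using directed unfolding directed_set_def by blast

lemma cls_mem: "(j, y) \<in> cls i x \<longleftrightarrow> j \<in> I \<and> y \<in> X j \<and> (\<exists>k\<in>I. leq i k \<and> leq j k \<and> t i k x = t j k y)"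
  by (simp add: dlim_class_def)

lemma cls_self: "i \<in> I \<Longrightarrow> x \<in> X i \<Longrightarrow> (i, x) \<in> cls i x"
  using leq_refl unfolding cls_mem by blast

lemma push_eq_mono:
  assumes "i \<in> I" "j \<in> I" "k \<in> I" "r \<in> I" "x \<in> X i" "y \<in> X j"
    and "leq i k" "leq j k" "leq k r" "t i k x = t j k y"
  shows "t i r x = t j r y"
  using push_push[of i k r x] push_push[of j k r y] assms by simp

lemma cls_sub:
  assumes i: "i \<in> I" "x \<in> X i" and j: "j \<in> I" "y \<in> X j"
    and k: "k \<in> I" "leq i k" "leq j k" "t i k x = t j k y"
  shows "cls i x \<subseteq> cls j y"
proof
  fix p assume "p \<in> cls i x"
  then obtain l z k' where l: "p = (l, z)" "l \<in> I" "z \<in> X l"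
    and k': "k' \<in> I" "leq i k'" "leq l k'" "t i k' x = t l k' z"
    by (cases p) (auto simp: cls_mem)
  obtain r where r: "r \<in> I" "leq k r" "leq k' r" using upper_bound[OF k(1) k'(1)] .
  have "t j r y = t i r x" using push_eq_mono[of i j k r x y] i j k r by simp
  also have "\<dots> = t l r z" using push_eq_mono[of i l k' r x z] i l k' r by simp
  moreover have "leq j r" "leq l r" using leq_trans[of _ k r] leq_trans[of _ k' r] j k l k' r by blast+
  ultimately show "p \<in> cls j y" unfolding l(1) cls_mem using l r by auto
qed

text \<open>Directedness makes the relation "equal at some later index" transitive, so the classes form a
  partition.\<close>

lemma cls_eq_iff:
  assumes i: "i \<in> I" "x \<in> X i" and j: "j \<in> I" "y \<in> X j"
  shows "cls i x = cls j y \<longleftrightarrow> (\<exists>k\<in>I. leq i k \<and> leq j k \<and> t i k x = t j k y)"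
proof
  assume "cls i x = cls j y"
  then have "(j, y) \<in> cls i x" using cls_self[OF j] by simp
  then show "\<exists>k\<in>I. leq i k \<and> leq j k \<and> t i k x = t j k y" by (simp add: cls_mem)
next
  assume "\<exists>k\<in>I. leq i k \<and> leq j k \<and> t i k x = t j k y"
  then obtain k where "k \<in> I" "leq i k" "leq j k" "t i k x = t j k y" by blast
  then show "cls i x = cls j y"
    using cls_sub[OF i j, of k] cls_sub[OF j i, of k] by auto
qed

lemma cls_push:
  assumes "i \<in> I" "j \<in> I" "leq i j" "x \<in> X i"
  shows "cls j (t i j x) = cls i x"
  using cls_eq_iff[of j "t i j x" i x] push_closed[of i j x] push_push[of i j j x] assms leq_refl[of j] by auto

lemma UN_cls:
  assumes "i \<in> I" "x \<in> X i" "\<And>j y. (j, y) \<in> cls i x \<Longrightarrow> F j y = v"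
  shows "(\<Union>(j, y)\<in>cls i x. F j y) = v"
  using UN_pair_const[OF cls_self[OF assms(1,2)], of F v] assms(3) by blast

end

locale direct_algebras =
  fixes A :: "'a monoid" and I :: "'i set" and leq C \<gamma> and t :: "'i \<Rightarrow> 'i \<Rightarrow> 'c \<Rightarrow> 'c"
  assumes direct_system: "direct_system A I leq C \<gamma> t"

sublocale direct_algebras \<subseteq> directed_sets I leq "\<lambda>i. carrier (C i)" t
  by standard (use direct_system in \<open>auto simp: direct_system_def algebra_hom_def monoid_hom_def hom_def Pi_iff\<close>)

context direct_algebras begin

abbreviation (input) "D \<equiv> dlim_monoid I leq C t"
abbreviation (input) "\<delta> \<equiv> dlim_structure_map I leq C \<gamma> t"

lemma comm_monoid_C: "i \<in> I \<Longrightarrow> comm_monoid (C i)"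
  using direct_system by (auto simp: direct_system_def monoid_algebra_def)

lemma structure_hom: "i \<in> I \<Longrightarrow> \<gamma> i \<in> monoid_hom A (C i)"
  using direct_system by (auto simp: direct_system_def monoid_algebra_def)

lemma comm_monoid_A: "comm_monoid A"
  using direct_system index by (auto simp: direct_system_def monoid_algebra_def)

lemma push_hom: "\<lbrakk>i \<in> I; j \<in> I; leq i j\<rbrakk> \<Longrightarrow> t i j \<in> algebra_hom A (C i) (\<gamma> i) (C j) (\<gamma> j)"
  using direct_system by (auto simp: direct_system_def)

lemma push_mult: "\<lbrakk>i \<in> I; j \<in> I; leq i j; x \<in> carrier (C i); y \<in> carrier (C i)\<rbrakk>
    \<Longrightarrow> t i j (x \<otimes>\<^bsub>C i\<^esub> y) = t i j x \<otimes>\<^bsub>C j\<^esub> t i j y"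
  and push_one: "\<lbrakk>i \<in> I; j \<in> I; leq i j\<rbrakk> \<Longrightarrow> t i j \<one>\<^bsub>C i\<^esub> = \<one>\<^bsub>C j\<^esub>"
  and push_structure: "\<lbrakk>i \<in> I; j \<in> I; leq i j; a \<in> carrier A\<rbrakk> \<Longrightarrow> t i j (\<gamma> i a) = \<gamma> j a"
  using push_hom[of i j] by (auto simp: algebra_hom_def monoid_hom_def hom_def)

lemma mult_closed: "i \<in> I \<Longrightarrow> x \<in> carrier (C i) \<Longrightarrow> y \<in> carrier (C i) \<Longrightarrow> x \<otimes>\<^bsub>C i\<^esub> y \<in> carrier (C i)"
  and one_closed: "i \<in> I \<Longrightarrow> \<one>\<^bsub>C i\<^esub> \<in> carrier (C i)"
  by (rule monoid.m_closed[OF comm_monoid.axioms(1)[OF comm_monoid_C]], assumption+)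
     (rule monoid.one_closed[OF comm_monoid.axioms(1)[OF comm_monoid_C]], assumption+)

lemma structure_closed: "i \<in> I \<Longrightarrow> a \<in> carrier A \<Longrightarrow> \<gamma> i a \<in> carrier (C i)"
  using structure_hom[of i] by (auto simp: monoid_hom_def hom_def)

text \<open>The product in the limit is a union over all representatives and all later indices; all members of
  the union agree, because any two of them can be compared at a further index.\<close>

lemma dlim_mult:
  assumes i: "i \<in> I" "x \<in> carrier (C i)" and j: "j \<in> I" "y \<in> carrier (C j)"
    and k: "k \<in> I" "leq i k" "leq j k"
  shows "cls i x \<otimes>\<^bsub>D\<^esub> cls j y = cls k (t i k x \<otimes>\<^bsub>C k\<^esub> t j k y)" (is "_ = ?v")
proof -
  have *: "cls k' (t i' k' x' \<otimes>\<^bsub>C k'\<^esub> t j' k' y') = ?v"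
    if i': "(i', x') \<in> cls i x" and j': "(j', y') \<in> cls j y" and k': "k' \<in> I" "leq i' k'" "leq j' k'" for i' x' j' y' k'
  proof -
    obtain a where a: "i' \<in> I" "x' \<in> carrier (C i')" "a \<in> I" "leq i a" "leq i' a" "t i a x = t i' a x'"
      using i' by (auto simp: cls_mem)
    obtain b where b: "j' \<in> I" "y' \<in> carrier (C j')" "b \<in> I" "leq j b" "leq j' b" "t j b y = t j' b y'"
      using j' by (auto simp: cls_mem)
    obtain c where c: "c \<in> I" "leq a c" "leq b c" using upper_bound[OF a(3) b(3)] .
    obtain d where d: "d \<in> I" "leq k d" "leq k' d" using upper_bound[OF k(1) k'(1)] .
    obtain r where r: "r \<in> I" "leq c r" "leq d r" using upper_bound[OF c(1) d(1)] .
    have le: "leq a r" "leq b r" "leq k r" "leq k' r"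
      using leq_trans[of a c r] leq_trans[of b c r] leq_trans[of k d r] leq_trans[of k' d r] a(3) b(3) c d r k(1) k'(1)
      by simp_all
    have x: "t i r x = t i' r x'" using push_eq_mono[of i i' a r x x'] i a r le by simp
    have y: "t j r y = t j' r y'" using push_eq_mono[of j j' b r y y'] j b r le by simp
    have "t k' r (t i' k' x' \<otimes>\<^bsub>C k'\<^esub> t j' k' y') = t k r (t i k x \<otimes>\<^bsub>C k\<^esub> t j k y)"
      using i j k a(1,2) b(1,2) k' r(1) le(3,4) x y by (simp add: push_mult push_push push_closed)
    moreover have "t i' k' x' \<otimes>\<^bsub>C k'\<^esub> t j' k' y' \<in> carrier (C k')" "t i k x \<otimes>\<^bsub>C k\<^esub> t j k y \<in> carrier (C k)"
      using i j k a(1,2) b(1,2) k' by (simp_all add: mult_closed push_closed)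
    ultimately show ?thesis
      using cls_eq_iff[of k' "t i' k' x' \<otimes>\<^bsub>C k'\<^esub> t j' k' y'" k "t i k x \<otimes>\<^bsub>C k\<^esub> t j k y"]
        k(1) k'(1) r(1) le(3,4) by blast
  qed
  have "cls i x \<otimes>\<^bsub>D\<^esub> cls j y = (\<Union>(i', x')\<in>cls i x. \<Union>(j', y')\<in>cls j y. \<Union>k'\<in>{k' \<in> I. leq i' k' \<and> leq j' k'}.
      cls k' (t i' k' x' \<otimes>\<^bsub>C k'\<^esub> t j' k' y'))" by (simp add: dlim_monoid_def)
  also have "\<dots> = ?v"
  proof (rule UN_cls[OF i], rule UN_cls[OF j])
    fix i' x' j' y' assume h: "(i', x') \<in> cls i x" "(j', y') \<in> cls j y"
    then obtain k' where "k' \<in> I" "leq i' k'" "leq j' k'" using upper_bound[of i' j'] by (auto simp: cls_mem)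
    then show "(\<Union>k'\<in>{k' \<in> I. leq i' k' \<and> leq j' k'}. cls k' (t i' k' x' \<otimes>\<^bsub>C k'\<^esub> t j' k' y')) = ?v"
      using *[OF h] by blast
  qed
  finally show ?thesis .
qed

lemma dlim_mult_same:
  "\<lbrakk>i \<in> I; x \<in> carrier (C i); y \<in> carrier (C i)\<rbrakk> \<Longrightarrow> cls i x \<otimes>\<^bsub>D\<^esub> cls i y = cls i (x \<otimes>\<^bsub>C i\<^esub> y)"
  using dlim_mult[of i x i y i] leq_refl push_refl by simp

lemma dlim_one: "i \<in> I \<Longrightarrow> \<one>\<^bsub>D\<^esub> = cls i \<one>\<^bsub>C i\<^esub>"
proof -
  assume i: "i \<in> I"
  have "cls j \<one>\<^bsub>C j\<^esub> = cls i \<one>\<^bsub>C i\<^esub>" if j: "j \<in> I" for j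
  proof -
    obtain k where "k \<in> I" "leq i k" "leq j k" using upper_bound[OF i j] .
    then show ?thesis using cls_push[of i k "\<one>\<^bsub>C i\<^esub>"] cls_push[of j k "\<one>\<^bsub>C j\<^esub>"] i j by (simp add: push_one one_closed)
  qed
  then have "(\<Union>j\<in>I. cls j \<one>\<^bsub>C j\<^esub>) = cls i \<one>\<^bsub>C i\<^esub>" using i by blast
  then show ?thesis by (simp add: dlim_monoid_def)
qed

lemma dlim_structure: "i \<in> I \<Longrightarrow> a \<in> carrier A \<Longrightarrow> \<delta> a = cls i (\<gamma> i a)"
proof -
  assume i: "i \<in> I" and a: "a \<in> carrier A"
  have "cls j (\<gamma> j a) = cls i (\<gamma> i a)" if j: "j \<in> I" for j
  proof -
    obtain k where "k \<in> I" "leq i k" "leq j k" using upper_bound[OF i j] .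
    then show ?thesis using cls_push[of i k "\<gamma> i a"] cls_push[of j k "\<gamma> j a"] i j a
      by (simp add: push_structure structure_closed)
  qed
  then have "(\<Union>j\<in>I. cls j (\<gamma> j a)) = cls i (\<gamma> i a)" using i by blast
  then show ?thesis by (simp add: dlim_structure_map_def)
qed

lemma cls_closed: "i \<in> I \<Longrightarrow> x \<in> carrier (C i) \<Longrightarrow> cls i x \<in> carrier D"
  by (auto simp: dlim_monoid_def dlim_def)

lemma dlim_cases:
  assumes "p \<in> carrier D" obtains i x where "i \<in> I" "x \<in> carrier (C i)" "p = cls i x"
  using assms by (auto simp: dlim_monoid_def dlim_def)

lemma dlim_cases_above:
  assumes "p \<in> carrier D" "j \<in> I"
  obtains i x where "i \<in> I" "leq j i" "x \<in> carrier (C i)" "p = cls i x"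
proof -
  obtain i x where i: "i \<in> I" "x \<in> carrier (C i)" "p = cls i x" using dlim_cases[OF assms(1)] .
  obtain k where k: "k \<in> I" "leq i k" "leq j k" using upper_bound[OF i(1) assms(2)] .
  then show thesis using that[of k "t i k x"] cls_push[of i k x] push_closed[of i k x] i by simp
qed

lemma dlim_cases3:
  assumes "p \<in> carrier D" "q \<in> carrier D" "r \<in> carrier D"
  obtains i x y z where "i \<in> I" "x \<in> carrier (C i)" "y \<in> carrier (C i)" "z \<in> carrier (C i)"
    "p = cls i x" "q = cls i y" "r = cls i z"
proof -
  obtain i x where i: "i \<in> I" "x \<in> carrier (C i)" "p = cls i x" using dlim_cases[OF assms(1)] .
  obtain j y where j: "j \<in> I" "leq i j" "y \<in> carrier (C j)" "q = cls j y" using dlim_cases_above[OF assms(2) i(1)] .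
  obtain k z where k: "k \<in> I" "leq j k" "z \<in> carrier (C k)" "r = cls k z" using dlim_cases_above[OF assms(3) j(1)] .
  have "leq i k" using leq_trans[of i j k] i j k by blast
  then show thesis
    using that[of k "t i k x" "t j k y" z] i j k cls_push[of i k x] cls_push[of j k y] push_closed by simp
qed

lemma comm_monoid_dlim: "comm_monoid D"
proof (rule comm_monoidI)
  obtain i where i: "i \<in> I" by (rule index)
  show "\<one>\<^bsub>D\<^esub> \<in> carrier D" using i by (simp add: dlim_one one_closed cls_closed)
next
  fix p q assume p: "p \<in> carrier D" and q: "q \<in> carrier D"
  obtain i x y where h: "i \<in> I" "x \<in> carrier (C i)" "y \<in> carrier (C i)" "p = cls i x" "q = cls i y"
    using dlim_cases3[OF p q q] by blast
  interpret C: comm_monoid "C i" using comm_monoid_C[OF h(1)] .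
  show "p \<otimes>\<^bsub>D\<^esub> q \<in> carrier D" "p \<otimes>\<^bsub>D\<^esub> q = q \<otimes>\<^bsub>D\<^esub> p"
    using h by (simp_all add: dlim_mult_same cls_closed C.m_comm)
  show "\<one>\<^bsub>D\<^esub> \<otimes>\<^bsub>D\<^esub> p = p"
    using h by (simp add: dlim_one[OF h(1)] dlim_mult_same)
  fix r assume r: "r \<in> carrier D"
  obtain i x y z where h: "i \<in> I" "x \<in> carrier (C i)" "y \<in> carrier (C i)" "z \<in> carrier (C i)"
    "p = cls i x" "q = cls i y" "r = cls i z"
    using dlim_cases3[OF p q r] .
  interpret C: comm_monoid "C i" using comm_monoid_C[OF h(1)] .
  show "p \<otimes>\<^bsub>D\<^esub> q \<otimes>\<^bsub>D\<^esub> r = p \<otimes>\<^bsub>D\<^esub> (q \<otimes>\<^bsub>D\<^esub> r)"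
    using h by (simp add: dlim_mult_same C.m_assoc)
qed

lemma cls_hom: "i \<in> I \<Longrightarrow> cls i \<in> algebra_hom A (C i) (\<gamma> i) D \<delta>"
  by (simp add: algebra_hom_def monoid_hom_def hom_def cls_closed dlim_mult_same dlim_one dlim_structure)

lemma dlim_structure_hom: "\<delta> \<in> monoid_hom A D"
proof -
  obtain i where i: "i \<in> I" by (rule index)
  interpret A: comm_monoid A by (rule comm_monoid_A)
  have "(\<lambda>a. cls i (\<gamma> i a)) \<in> monoid_hom A D"
    using monoid_hom_comp[OF structure_hom[OF i], of "cls i" D] cls_hom[OF i] by (simp add: algebra_hom_def)
  then show ?thesis using dlim_structure[OF i] by (simp add: monoid_hom_def hom_def Pi_iff)
qed

end

section \<open>Localization at one element is of finite presentation\<close>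

text \<open>There is at most one algebra map from \<open>N\<close> to each \<open>M\<close>-algebra, so both sides have at most one element
  and only existence matters.  If \<open>N\<close> maps to the limit, then \<open>a\<close> has an inverse there, which is
  represented at some index; at a later index it becomes an inverse of the image of \<open>a\<close>, and \<open>N\<close> maps
  to the algebra at that index.\<close>

lemma (in loc_hom) finite_presentation:
  assumes a: "a \<in> carrier M" and Ha: "H = gen_submonoid M {a}"
  shows "finite_presentation TYPE('u) M N \<phi>"
  unfolding finite_presentation_def
proof (intro allI impI)
  fix I :: "'u set" and leq and C :: "'u \<Rightarrow> 'u monoid" and \<gamma> t
  assume "direct_system M I leq C \<gamma> t"
  then interpret direct_algebras M I leq C \<gamma> t by unfold_locales
  let ?Hom = "\<lambda>i. Hom_Alg M N \<phi> (C i) (\<gamma> i)" and ?push = "\<lambda>i j h. \<lambda>b\<in>carrier N. t i j (h b)"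
  have push_Hom: "?push i j h \<in> ?Hom j" if "i \<in> I" "j \<in> I" "leq i j" "h \<in> ?Hom i" for i j h
    using algebra_hom_restrict[OF N.monoid_axioms hom algebra_hom_comp[OF _ push_hom[OF that(1-3)]]] that(4)
    by (simp add: Hom_Alg_def)
  have Hom_closed: "h b \<in> carrier (C i)" if "h \<in> ?Hom i" "b \<in> carrier N" for i h b
    using that by (auto simp: Hom_Alg_def algebra_hom_def monoid_hom_def hom_def)
  interpret Homs: directed_sets I leq ?Hom ?push
  proof
    fix i h assume "i \<in> I" "h \<in> ?Hom i"
    then show "?push i i h = h"
      by (intro extensionalityI[of _ "carrier N"]) (auto simp: push_refl Hom_closed, auto simp: Hom_Alg_def)
  next
    fix i j k h assume h: "i \<in> I" "j \<in> I" "k \<in> I" "leq i j" "leq j k" "h \<in> ?Hom i"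
    then show "?push j k (?push i j h) = ?push i k h"
      by (intro restrict_ext) (simp add: push_push Hom_closed)
  qed (use directed push_Hom in blast)+
  let ?\<Psi> = "\<lambda>p. \<lambda>b\<in>carrier N. \<Union>(i, h)\<in>p. cls i (h b)"
  have \<Psi>: "?\<Psi> (Homs.cls i h) = (\<lambda>b\<in>carrier N. cls i (h b))" if i: "i \<in> I" "h \<in> ?Hom i" for i h
  proof (rule restrict_ext)
    fix b assume b: "b \<in> carrier N"
    show "(\<Union>(i, h)\<in>Homs.cls i h. cls i (h b)) = cls i (h b)"
    proof (rule Homs.UN_cls[OF i])
      fix j h' assume "(j, h') \<in> Homs.cls i h"
      then obtain k where k: "j \<in> I" "h' \<in> ?Hom j" "k \<in> I" "leq i k" "leq j k" "?push i k h = ?push j k h'"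
        unfolding Homs.cls_mem by blast
      then have "t i k (h b) = t j k (h' b)" using b by (metis restrict_apply')
      then show "cls j (h' b) = cls i (h b)"
        using cls_eq_iff[of i "h b" j "h' b"] i k Hom_closed b by metis
    qed
  qed
  \<comment> \<open>Any two maps from \<open>N\<close> to members of the system become equal at every common later index.\<close>
  have same: "Homs.cls i h = Homs.cls j h'" if i: "i \<in> I" "h \<in> ?Hom i" and j: "j \<in> I" "h' \<in> ?Hom j" for i h j h'
  proof -
    obtain k where k: "k \<in> I" "leq i k" "leq j k" using upper_bound[OF i(1) j(1)] .
    have p: "?push i k h \<in> ?Hom k" "?push j k h' \<in> ?Hom k" using push_Hom i j k by blast+
    have "?push i k h b = ?push j k h' b" if "b \<in> carrier N" for b
      by (rule algebra_hom_unique[OF comm_monoid_C[OF k(1)] _ _ _ that])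
         (use p in \<open>simp_all only: Hom_Alg_def algebra_hom_def Int_iff mem_Collect_eq\<close>)
    then have "?push i k h = ?push j k h'" by (intro restrict_ext) (metis restrict_apply')
    then show ?thesis using Homs.cls_eq_iff[OF i j] k by blast
  qed
  show "bij_betw ?\<Psi> (dlim I leq ?Hom ?push) (Hom_Alg M N \<phi> D \<delta>)"
    unfolding bij_betw_def
  proof (intro conjI subset_antisym subsetI)
    show "inj_on ?\<Psi> (dlim I leq ?Hom ?push)"
      using same unfolding inj_on_def dlim_def by blast
    fix g assume "g \<in> ?\<Psi> ` dlim I leq ?Hom ?push"
    then obtain i h where h: "i \<in> I" "h \<in> ?Hom i" "g = (\<lambda>b\<in>carrier N. cls i (h b))"
      using \<Psi> unfolding dlim_def by auto
    show "g \<in> Hom_Alg M N \<phi> D \<delta>"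
      using algebra_hom_restrict[OF N.monoid_axioms hom algebra_hom_comp[OF _ cls_hom[OF h(1)]]] h(2)
      unfolding h(3) by (simp add: Hom_Alg_def)
  next
    fix g assume g: "g \<in> Hom_Alg M N \<phi> D \<delta>"
    then have gh: "g \<in> monoid_hom N D" "\<And>m. m \<in> carrier M \<Longrightarrow> g (\<phi> m) = \<delta> m"
      by (simp_all add: Hom_Alg_def algebra_hom_def)
    have "\<phi> a \<in> Units N" using units subset_gen_submonoid[of "{a}" M] unfolding Ha by blast
    then have "\<delta> a \<in> Units D"
      using monoid_hom_Units[OF N.comm_monoid_axioms comm_monoid_dlim gh(1), of "\<phi> a"] gh(2)[OF a] by simp
    then obtain p where p: "p \<in> carrier D" "\<delta> a \<otimes>\<^bsub>D\<^esub> p = \<one>\<^bsub>D\<^esub>" unfolding Units_def by blast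
    obtain j y where j: "j \<in> I" "y \<in> carrier (C j)" "p = cls j y" using dlim_cases[OF p(1)] .
    have "cls j (\<gamma> j a \<otimes>\<^bsub>C j\<^esub> y) = cls j \<one>\<^bsub>C j\<^esub>"
      using p(2) j a by (simp add: dlim_structure[OF j(1)] dlim_one[OF j(1)] dlim_mult_same structure_closed)
    then obtain k where k: "k \<in> I" "leq j k" "t j k (\<gamma> j a \<otimes>\<^bsub>C j\<^esub> y) = t j k \<one>\<^bsub>C j\<^esub>"
      using cls_eq_iff[of j "\<gamma> j a \<otimes>\<^bsub>C j\<^esub> y" j "\<one>\<^bsub>C j\<^esub>"] j a
      by (auto simp: mult_closed one_closed structure_closed)
    interpret C: comm_monoid "C k" using comm_monoid_C[OF k(1)] .
    have e: "\<gamma> k a \<otimes>\<^bsub>C k\<^esub> t j k y = \<one>\<^bsub>C k\<^esub>"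
      using k j a by (simp add: push_mult push_one push_structure structure_closed)
    then have "t j k y \<otimes>\<^bsub>C k\<^esub> \<gamma> k a = \<one>\<^bsub>C k\<^esub>"
      using C.m_comm[of "\<gamma> k a" "t j k y"] k j a by (simp add: structure_closed push_closed)
    with e have "\<gamma> k a \<in> Units (C k)"
      unfolding Units_def using k j a structure_closed[of k a] push_closed[of j k y] by blast
    then obtain h where h: "h \<in> algebra_hom M N \<phi> (C k) (\<gamma> k)"
      using lift[OF C.comm_monoid_axioms structure_hom[OF k(1)] _ Ha] a by auto
    let ?h = "restrict h (carrier N)"
    have hH: "?h \<in> ?Hom k" using algebra_hom_restrict[OF N.monoid_axioms hom h] by (simp add: Hom_Alg_def)
    have "(\<lambda>b\<in>carrier N. cls k (?h b)) = g"
    proof (rule extensionalityI[of _ "carrier N"])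
      fix b assume b: "b \<in> carrier N"
      have c: "(\<lambda>b. cls k (h b)) \<in> algebra_hom M N \<phi> D \<delta>"
        using algebra_hom_comp[OF h cls_hom[OF k(1)]] .
      have "cls k (h b) = g b"
        by (rule algebra_hom_unique[OF comm_monoid_dlim _ gh(1) _ b]) (use c gh(2) in \<open>auto simp: algebra_hom_def\<close>)
      then show "(\<lambda>b\<in>carrier N. cls k (?h b)) b = g b" using b by simp
    qed (use g in \<open>auto simp: Hom_Alg_def\<close>)
    then have "g = ?\<Psi> (Homs.cls k ?h)" using \<Psi>[OF k(1) hH] by simp
    then show "g \<in> ?\<Psi> ` dlim I leq ?Hom ?push" unfolding dlim_def using k(1) hH by blast
  qed
qed

section \<open>Localizations of finite presentation invert one element\<close>

text \<open>The test objects for finite presentation live on a prescribed type, so the monoids \<open>M\<^sub>s\<close> have to be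
  copied there.\<close>

lemma transport_monoid:
  assumes P: "comm_monoid P" and small: "carrier P \<lesssim> (UNIV :: 'u set)"
  obtains Q :: "'u monoid" and e where "comm_monoid Q" "e \<in> monoid_hom P Q" "bij_betw e (carrier P) (carrier Q)"
proof -
  interpret P: comm_monoid P by fact
  obtain e :: "_ \<Rightarrow> 'u" where e: "inj_on e (carrier P)" using small unfolding lepoll_def by blast
  let ?i = "inv_into (carrier P) e"
  define Q where "Q = \<lparr>carrier = e ` carrier P, monoid.mult = (\<lambda>x y. e (?i x \<otimes>\<^bsub>P\<^esub> ?i y)), one = e \<one>\<^bsub>P\<^esub>\<rparr>"
  have m: "e x \<otimes>\<^bsub>Q\<^esub> e y = e (x \<otimes>\<^bsub>P\<^esub> y)" if "x \<in> carrier P" "y \<in> carrier P" for x y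
    using e that by (simp add: Q_def)
  have c: "carrier Q = e ` carrier P" "\<one>\<^bsub>Q\<^esub> = e \<one>\<^bsub>P\<^esub>" by (simp_all add: Q_def)
  have "comm_monoid Q"
    by (rule comm_monoidI) (auto simp: c m P.m_ac)
  moreover have "e \<in> monoid_hom P Q" by (auto simp: monoid_hom_def hom_def c m)
  moreover have "bij_betw e (carrier P) (carrier Q)" using e by (simp add: bij_betw_def c)
  ultimately show thesis by (rule that)
qed

text \<open>Fractions are classes of pairs, and an infinite type has as many pairs as elements.\<close>

lemma localization_lepoll:
  assumes M: "comm_monoid M" "S \<subseteq> carrier M" and inf: "infinite (UNIV :: 'u set)" and small: "carrier M \<lesssim> (UNIV :: 'u set)"
  shows "carrier (localization M S) \<lesssim> (UNIV :: 'u set)"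
proof -
  interpret monoid_loc M S using M by (simp add: monoid_loc_def monoid_loc_axioms_def)
  have "carrier (localization M S) \<subseteq> (\<lambda>(m, s). loc_frac M S m s) ` (carrier M \<times> carrier M)"
  proof
    fix p assume "p \<in> carrier (localization M S)"
    then obtain m s where "m \<in> carrier M" "s \<in> H" "p = loc_frac M S m s" by (rule loc_cases)
    then show "p \<in> (\<lambda>(m, s). loc_frac M S m s) ` (carrier M \<times> carrier M)" by (intro image_eqI[of _ _ "(m, s)"]) auto
  qed
  then have "carrier (localization M S) \<lesssim> carrier M \<times> carrier M" by (rule subset_image_lepoll)
  also have "\<dots> \<lesssim> (UNIV :: 'u set) \<times> (UNIV :: 'u set)" using small small by (rule times_lepoll_mono)
  also have "\<dots> \<approx> (UNIV :: 'u set)"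
    using card_of_Times_same_infinite[OF inf] by (simp add: eqpoll_iff_card_of_ordIso)
  finally show ?thesis .
qed

context loc_hom begin

text \<open>The direct system consists of copies of the \<open>M\<^sub>s\<close> with \<open>s \<in> H\<close>, ordered by the existence of an algebra
  map.  Such maps are unique, hence functorial, and \<open>M\<^sub>s\<close> and \<open>M\<^sub>t\<close> both map to \<open>M\<^sub>s\<^sub>t\<close>.  Each \<open>s\<close> is
  invertible in the limit, so \<open>N\<close> maps to the limit and therefore, by finite presentation, to some
  \<open>M\<^sub>s\<close>.  As \<open>s\<close> is invertible in \<open>N\<close>, there is also a map from \<open>M\<^sub>s\<close> to \<open>N\<close>, and by uniqueness
  the two maps are mutually inverse.\<close>

lemma finitely_presented_single_element:
  assumes H: "H = {s \<in> carrier M. \<phi> s \<in> Units N}"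
    and fp: "finite_presentation TYPE('u) M N \<phi>"
    and inf: "infinite (UNIV :: 'u set)" and small: "carrier M \<lesssim> (UNIV :: 'u set)"
  shows "\<exists>a\<in>carrier M. algebra_isomorphic M N \<phi> (localization M {a}) (loc_map M {a})"
proof -
  obtain \<iota> :: "'a \<Rightarrow> 'u" where \<iota>: "inj_on \<iota> H"
    using small unfolding lepoll_def by (meson H_closed inj_on_subset subsetI)
  have "\<exists>(Q :: 'u monoid) g. comm_monoid Q \<and> algebra_isomorphic M (localization M {s}) (loc_map M {s}) Q g
      \<and> g \<in> monoid_hom M Q" if s: "s \<in> H" for s
  proof -
    have sM: "{s} \<subseteq> carrier M" using s by simp
    interpret L: loc_hom M "localization M {s}" "loc_map M {s}" "gen_submonoid M {s}"
      by (rule loc_hom_loc_map[OF M.comm_monoid_axioms sM])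
    obtain Q :: "'u monoid" and e where Q: "comm_monoid Q" "e \<in> monoid_hom (localization M {s}) Q"
      "bij_betw e (carrier (localization M {s})) (carrier Q)"
      using transport_monoid[OF L.N.comm_monoid_axioms localization_lepoll[OF M.comm_monoid_axioms sM inf small]] .
    have "algebra_isomorphic M (localization M {s}) (loc_map M {s}) Q (\<lambda>m. e (loc_map M {s} m))"
      unfolding algebra_isomorphic_def algebra_hom_def using Q by auto
    then show ?thesis using Q(1) monoid_hom_comp[OF L.hom Q(2)] by blast
  qed
  then obtain C0 :: "'a \<Rightarrow> 'u monoid" and \<gamma>0 where C0: "\<And>s. s \<in> H \<Longrightarrow> comm_monoid (C0 s)"
    "\<And>s. s \<in> H \<Longrightarrow> algebra_isomorphic M (localization M {s}) (loc_map M {s}) (C0 s) (\<gamma>0 s)"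
    "\<And>s. s \<in> H \<Longrightarrow> \<gamma>0 s \<in> monoid_hom M (C0 s)"
    by metis
  \<comment> \<open>The index set is a copy of \<open>H\<close> in the type of test objects, and \<open>el\<close> recovers the element.\<close>
  define el where "el = inv_into H \<iota>"
  define I where "I = \<iota> ` H"
  define C where "C = (\<lambda>x. C0 (el x))"
  define \<gamma> where "\<gamma> = (\<lambda>x. \<gamma>0 (el x))"
  have el: "el x \<in> H" if "x \<in> I" for x using that inv_into_into[of x \<iota> H] by (simp add: el_def I_def)
  have el\<iota>: "el (\<iota> s) = s" "\<iota> s \<in> I" if "s \<in> H" for s using that \<iota> by (simp_all add: el_def I_def)
  have loc: "loc_hom M (C x) (\<gamma> x) (gen_submonoid M {el x})" if x: "x \<in> I" for x
  proof -
    have sM: "{el x} \<subseteq> carrier M" using el[OF x] by simp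
    interpret L: loc_hom M "localization M {el x}" "loc_map M {el x}" "gen_submonoid M {el x}"
      by (rule loc_hom_loc_map[OF M.comm_monoid_axioms sM])
    show ?thesis unfolding C_def \<gamma>_def
      by (rule algebra_isomorphic_loc_hom[OF M.comm_monoid_axioms C0(1)[OF el[OF x]] C0(3)[OF el[OF x]]
            algebra_isomorphic_sym[OF L.N.monoid_axioms L.hom C0(2)[OF el[OF x]]] L.loc_hom_axioms])
  qed
  have cC: "comm_monoid (C x)" "\<gamma> x \<in> monoid_hom M (C x)" if "x \<in> I" for x
    using C0(1,3)[OF el[OF that]] by (simp_all add: C_def \<gamma>_def)
  have unit: "\<gamma> x (el x) \<in> Units (C x)" if "x \<in> I" for x
    using loc_hom.units[OF loc[OF that]] subset_gen_submonoid[of "{el x}" M] by blast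
  have uniq: "f c = g c" if "x \<in> I" "comm_monoid P" "f \<in> algebra_hom M (C x) (\<gamma> x) P \<pi>" "g \<in> algebra_hom M (C x) (\<gamma> x) P \<pi>"
    "c \<in> carrier (C x)" for x P \<pi> f g c
    by (rule loc_hom.algebra_hom_unique[OF loc[OF that(1)] that(2) _ _ _ that(5)])
      (use that(3,4) in \<open>auto simp: algebra_hom_def\<close>)
  define leq where "leq = (\<lambda>x y. \<exists>h. h \<in> algebra_hom M (C x) (\<gamma> x) (C y) (\<gamma> y))"
  define t where "t = (\<lambda>x y. SOME h. h \<in> algebra_hom M (C x) (\<gamma> x) (C y) (\<gamma> y))"
  have t: "t x y \<in> algebra_hom M (C x) (\<gamma> x) (C y) (\<gamma> y)" if "leq x y" for x y
    using that unfolding leq_def t_def by (rule someI_ex)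
  have idh: "(\<lambda>c. c) \<in> algebra_hom M (C x) (\<gamma> x) (C x) (\<gamma> x)" for x
    by (auto simp: algebra_hom_def monoid_hom_def hom_def)
  have leqI: "leq x y" if x: "x \<in> I" and y: "y \<in> I" and u: "\<gamma> y (el x) \<in> Units (C y)" for x y
    unfolding leq_def
    by (rule loc_hom.lift[OF loc[OF x] cC(1)[OF y] cC(2)[OF y] _ refl]) (use u el[OF x] in auto)
  have directed: "directed_set I leq"
    unfolding directed_set_def
  proof (intro conjI ballI impI)
    show "I \<noteq> {}" using el\<iota>(2)[OF H_one] by blast
    show "leq x x" for x unfolding leq_def using idh by blast
    show "leq x z" if "leq x y \<and> leq y z" for x y z
      using that algebra_hom_comp unfolding leq_def by blast
    fix x y assume x: "x \<in> I" and y: "y \<in> I"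
    let ?z = "\<iota> (el x \<otimes>\<^bsub>M\<^esub> el y)"
    have z: "?z \<in> I" "el ?z = el x \<otimes>\<^bsub>M\<^esub> el y" using el\<iota>[OF H_mult[OF el[OF x] el[OF y]]] by simp_all
    interpret Z: loc_hom M "C ?z" "\<gamma> ?z" "gen_submonoid M {el ?z}" by (rule loc[OF z(1)])
    have e: "el x \<in> carrier M" "el y \<in> carrier M" using el x y by auto
    have "\<gamma> ?z (el x) \<otimes>\<^bsub>C ?z\<^esub> \<gamma> ?z (el y) \<in> Units (C ?z)"
      using unit[OF z(1)] unfolding z(2) using e by simp
    then have "\<gamma> ?z (el x) \<in> Units (C ?z)" "\<gamma> ?z (el y) \<in> Units (C ?z)"
      using Z.N.unit_factor[of "\<gamma> ?z (el x)" "\<gamma> ?z (el y)"] Z.N.unit_factor[of "\<gamma> ?z (el y)" "\<gamma> ?z (el x)"]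
        Z.N.m_comm[of "\<gamma> ?z (el y)" "\<gamma> ?z (el x)"] e by simp_all
    then show "\<exists>z\<in>I. leq x z \<and> leq y z" using leqI x y z(1) by blast
  qed
  have "direct_system M I leq C \<gamma> t"
    unfolding direct_system_def
  proof (intro conjI ballI impI directed)
    show "monoid_algebra M (C x) (\<gamma> x)" if "x \<in> I" for x
      using cC[OF that] M.comm_monoid_axioms by (simp add: monoid_algebra_def)
    show "t x y \<in> algebra_hom M (C x) (\<gamma> x) (C y) (\<gamma> y)" if "leq x y" for x y using t that .
    show "t x x c = c" if x: "x \<in> I" and c: "c \<in> carrier (C x)" for x c
      by (rule uniq[OF x cC(1)[OF x] t idh c]) (use idh in \<open>auto simp: leq_def\<close>)
    show "t x z c = t y z (t x y c)" if "x \<in> I" "y \<in> I" "z \<in> I" "leq x y \<and> leq y z" "c \<in> carrier (C x)" for x y z c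
    proof (rule uniq[OF that(1) cC(1)[OF that(3)] t _ that(5)])
      show "leq x z" using that algebra_hom_comp unfolding leq_def by blast
      show "(\<lambda>c. t y z (t x y c)) \<in> algebra_hom M (C x) (\<gamma> x) (C z) (\<gamma> z)"
        using algebra_hom_comp[OF t t] that(4) by blast
    qed
  qed
  then interpret D: direct_algebras M I leq C \<gamma> t by unfold_locales
  have "\<delta> ` H \<subseteq> Units D.D" if "\<delta> = dlim_structure_map I leq C \<gamma> t" for \<delta>
  proof (clarify)
    fix s assume s: "s \<in> H"
    have x: "\<iota> s \<in> I" "el (\<iota> s) = s" using el\<iota>[OF s] by simp_all
    have "D.cls (\<iota> s) (\<gamma> (\<iota> s) s) \<in> Units D.D"
      using monoid_hom_Units[OF cC(1)[OF x(1)] D.comm_monoid_dlim _ unit[OF x(1)], of "D.cls (\<iota> s)"]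
        D.cls_hom[OF x(1)] x(2) by (simp add: algebra_hom_def)
    then show "\<delta> s \<in> Units D.D" unfolding that using D.dlim_structure[OF x(1), of s] s by simp
  qed
  then obtain g where "g \<in> algebra_hom M N \<phi> D.D (dlim_structure_map I leq C \<gamma> t)"
    using lift[OF D.comm_monoid_dlim D.dlim_structure_hom, of H] gen_submonoid_eq[OF submonoid_H] H_closed by blast
  then have g: "restrict g (carrier N) \<in> Hom_Alg M N \<phi> D.D (dlim_structure_map I leq C \<gamma> t)"
    using algebra_hom_restrict[OF N.monoid_axioms hom] by (simp add: Hom_Alg_def)
  have "dlim I leq (\<lambda>x. Hom_Alg M N \<phi> (C x) (\<gamma> x)) (\<lambda>x y h. \<lambda>c\<in>carrier N. t x y (h c)) \<noteq> {}"
    using fp[unfolded finite_presentation_def] D.direct_system g unfolding bij_betw_def by blast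
  then obtain x h where x: "x \<in> I" and h: "h \<in> algebra_hom M N \<phi> (C x) (\<gamma> x)"
    unfolding dlim_def Hom_Alg_def by blast
  have "\<exists>k. k \<in> algebra_hom M (C x) (\<gamma> x) N \<phi>"
    by (rule loc_hom.lift[OF loc[OF x] N.comm_monoid_axioms hom _ refl]) (use units el[OF x] in auto)
  then obtain k where k: "k \<in> algebra_hom M (C x) (\<gamma> x) N \<phi>" ..
  have hk: "h (k c) = c" if "c \<in> carrier (C x)" for c
    by (rule uniq[OF x cC(1)[OF x] algebra_hom_comp[OF k h] idh that])
  have kh: "k (h y) = y" if "y \<in> carrier N" for y
    by (rule algebra_hom_unique[OF N.comm_monoid_axioms, of "\<lambda>y. k (h y)" "\<lambda>y. y"])
      (use algebra_hom_comp[OF h k] that in \<open>auto simp: algebra_hom_def monoid_hom_def hom_def\<close>)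
  have "bij_betw h (carrier N) (carrier (C x))"
    by (rule bij_betw_byWitness[where f' = k])
      (use h k hk kh in \<open>auto simp: algebra_hom_def monoid_hom_def hom_def\<close>)
  then have "algebra_isomorphic M N \<phi> (C x) (\<gamma> x)" unfolding algebra_isomorphic_def using h by blast
  then have "loc_hom M N \<phi> (gen_submonoid M {el x})"
    using algebra_isomorphic_loc_hom[OF M.comm_monoid_axioms N.comm_monoid_axioms hom _ loc[OF x]] by blast
  then have "algebra_isomorphic M N \<phi> (localization M {el x}) (loc_map M {el x})"
    by (rule loc_hom.algebra_isomorphic_localization) (use el[OF x] in auto)
  then show ?thesis using H_closed[OF el[OF x]] by blast
qed

end

section \<open>Stalks and isomorphisms of monoidal spaces\<close>

text \<open>Invertibility of the germ of \<open>s\<close> at \<open>x\<close>, expressed by sections.  It replaces stalks in the locality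
  condition on morphisms.\<close>

definition unit_near :: "('p, 's) mspace \<Rightarrow> 'p \<Rightarrow> 'p set \<Rightarrow> 's \<Rightarrow> bool" where
  "unit_near X x U s \<longleftrightarrow> (\<exists>W. openin (spc X) W \<and> x \<in> W \<and> W \<subseteq> U \<and> restr X U W s \<in> Units (sect X W))"

locale presheaf_of_monoids =
  fixes X :: "('p, 's) mspace"
  assumes presheaf: "monoid_presheaf X"
begin

abbreviation (input) "opn \<equiv> openin (spc X)"
abbreviation (input) "Sc U \<equiv> carrier (sect X U)"

lemma comm_monoid_sect: "opn U \<Longrightarrow> comm_monoid (sect X U)"
  using presheaf by (simp add: monoid_presheaf_def)

lemma restr_hom: "opn U \<Longrightarrow> opn V \<Longrightarrow> V \<subseteq> U \<Longrightarrow> restr X U V \<in> monoid_hom (sect X U) (sect X V)"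
  using presheaf by (simp add: monoid_presheaf_def)

lemma restr_closed: "opn U \<Longrightarrow> opn V \<Longrightarrow> V \<subseteq> U \<Longrightarrow> s \<in> Sc U \<Longrightarrow> restr X U V s \<in> Sc V"
  and restr_mult: "opn U \<Longrightarrow> opn V \<Longrightarrow> V \<subseteq> U \<Longrightarrow> s \<in> Sc U \<Longrightarrow> t \<in> Sc U \<Longrightarrow>
      restr X U V (s \<otimes>\<^bsub>sect X U\<^esub> t) = restr X U V s \<otimes>\<^bsub>sect X V\<^esub> restr X U V t"
  and restr_one: "opn U \<Longrightarrow> opn V \<Longrightarrow> V \<subseteq> U \<Longrightarrow> restr X U V \<one>\<^bsub>sect X U\<^esub> = \<one>\<^bsub>sect X V\<^esub>"
  using restr_hom[of U V] by (simp_all add: monoid_hom_def hom_def Pi_iff)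

lemma restr_id: "opn U \<Longrightarrow> s \<in> Sc U \<Longrightarrow> restr X U U s = s"
  using presheaf by (simp add: monoid_presheaf_def)

lemma restr_restr: "opn U \<Longrightarrow> opn V \<Longrightarrow> opn W \<Longrightarrow> W \<subseteq> V \<Longrightarrow> V \<subseteq> U \<Longrightarrow> s \<in> Sc U \<Longrightarrow>
    restr X V W (restr X U V s) = restr X U W s"
  using presheaf by (simp add: monoid_presheaf_def)

lemma sect_mult_closed: "opn U \<Longrightarrow> s \<in> Sc U \<Longrightarrow> t \<in> Sc U \<Longrightarrow> s \<otimes>\<^bsub>sect X U\<^esub> t \<in> Sc U"
  by (rule monoid.m_closed[OF comm_monoid.axioms(1)[OF comm_monoid_sect]])

lemma sect_one_closed: "opn U \<Longrightarrow> \<one>\<^bsub>sect X U\<^esub> \<in> Sc U"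
  by (rule monoid.one_closed[OF comm_monoid.axioms(1)[OF comm_monoid_sect]])

lemma germ_mem: "(V, t) \<in> germ X x U s \<longleftrightarrow> opn V \<and> x \<in> V \<and> t \<in> Sc V \<and>
    (\<exists>W. opn W \<and> x \<in> W \<and> W \<subseteq> U \<and> W \<subseteq> V \<and> restr X U W s = restr X V W t)"
  by (simp add: germ_def)

lemma germ_self: "opn U \<Longrightarrow> x \<in> U \<Longrightarrow> s \<in> Sc U \<Longrightarrow> (U, s) \<in> germ X x U s"
  unfolding germ_mem by blast

lemma germ_sub:
  assumes U: "opn U" "s \<in> Sc U" and V: "opn V" "t \<in> Sc V"
    and W: "opn W" "x \<in> W" "W \<subseteq> U" "W \<subseteq> V" "restr X U W s = restr X V W t"
  shows "germ X x U s \<subseteq> germ X x V t"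
proof (clarify)
  fix V' t' assume "(V', t') \<in> germ X x U s"
  then obtain W' where W': "opn V'" "x \<in> V'" "t' \<in> Sc V'" "opn W'" "x \<in> W'" "W' \<subseteq> U" "W' \<subseteq> V'"
    "restr X U W' s = restr X V' W' t'" unfolding germ_mem by blast
  let ?W = "W \<inter> W'"
  have o: "opn ?W" using W W' by blast
  have "restr X V ?W t = restr X W ?W (restr X V W t)" using V W o by (simp add: restr_restr)
  also have "\<dots> = restr X U ?W s" unfolding W(5)[symmetric] using U W(1,3) o by (simp add: restr_restr)
  also have "\<dots> = restr X W' ?W (restr X U W' s)" using U W'(4,6) o by (simp add: restr_restr)
  also have "\<dots> = restr X V' ?W t'" unfolding W'(8) using W' o by (simp add: restr_restr)
  finally have e: "restr X V ?W t = restr X V' ?W t'" .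
  show "(V', t') \<in> germ X x V t"
    unfolding germ_mem by (intro conjI exI[of _ ?W] W' e o) (use W W' in auto)
qed

lemma germ_eq:
  assumes "opn U" "s \<in> Sc U" "opn V" "t \<in> Sc V"
    and "opn W" "x \<in> W" "W \<subseteq> U" "W \<subseteq> V" "restr X U W s = restr X V W t"
  shows "germ X x U s = germ X x V t"
  using germ_sub[of U s V t W x] germ_sub[of V t U s W x] assms by auto

lemma germ_eqD:
  assumes "germ X x U s = germ X x V t" "opn V" "x \<in> V" "t \<in> Sc V"
  obtains W where "opn W" "x \<in> W" "W \<subseteq> U" "W \<subseteq> V" "restr X U W s = restr X V W t"
  using germ_self[OF assms(2-4)] assms(1) unfolding germ_mem[of V t x U s, symmetric] using germ_mem[of V t x U s] by auto

lemma stalk_mult: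
  assumes U: "opn U" "x \<in> U" "s \<in> Sc U" and V: "opn V" "x \<in> V" "t \<in> Sc V"
  shows "germ X x U s \<otimes>\<^bsub>stalk X x\<^esub> germ X x V t =
    germ X x (U \<inter> V) (restr X U (U \<inter> V) s \<otimes>\<^bsub>sect X (U \<inter> V)\<^esub> restr X V (U \<inter> V) t)" (is "_ = ?R")
proof -
  have c: "germ X x (U' \<inter> V') (restr X U' (U' \<inter> V') s' \<otimes>\<^bsub>sect X (U' \<inter> V')\<^esub> restr X V' (U' \<inter> V') t') = ?R"
    if us: "(U', s') \<in> germ X x U s" and vt: "(V', t') \<in> germ X x V t" for U' s' V' t'
  proof -
    from us obtain W where W: "opn U'" "x \<in> U'" "s' \<in> Sc U'" "opn W" "x \<in> W" "W \<subseteq> U" "W \<subseteq> U'" "restr X U W s = restr X U' W s'"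
      unfolding germ_mem by blast
    from vt obtain Z where Z: "opn V'" "x \<in> V'" "t' \<in> Sc V'" "opn Z" "x \<in> Z" "Z \<subseteq> V" "Z \<subseteq> V'" "restr X V Z t = restr X V' Z t'"
      unfolding germ_mem by blast
    let ?W = "W \<inter> Z"
    have o: "opn (U \<inter> V)" "opn (U' \<inter> V')" "opn ?W" using U V W Z by blast+
    have i: "?W \<subseteq> U" "?W \<subseteq> V" "?W \<subseteq> U'" "?W \<subseteq> V'" "?W \<subseteq> U \<inter> V" "?W \<subseteq> U' \<inter> V'" "?W \<subseteq> W" "?W \<subseteq> Z" using W Z by blast+
    have s: "restr X U ?W s = restr X U' ?W s'"
      using restr_restr[of U W ?W s] restr_restr[of U' W ?W s'] U W o i by simp
    have t: "restr X V ?W t = restr X V' ?W t'"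
      using restr_restr[of V Z ?W t] restr_restr[of V' Z ?W t'] V Z o i by simp
    show ?thesis
      by (rule germ_eq[where W = ?W])
        (use U V W Z o i s t in \<open>auto simp: sect_mult_closed restr_closed restr_mult restr_restr\<close>)
  qed
  have "germ X x U s \<otimes>\<^bsub>stalk X x\<^esub> germ X x V t = (\<Union>(U, s)\<in>germ X x U s. \<Union>(V, t)\<in>germ X x V t.
      germ X x (U \<inter> V) (restr X U (U \<inter> V) s \<otimes>\<^bsub>sect X (U \<inter> V)\<^esub> restr X V (U \<inter> V) t))"
    by (simp add: stalk_def)
  also have "\<dots> = ?R"
    by (rule UN_pair_const[OF germ_self[OF U]], rule UN_pair_const[OF germ_self[OF V]]) (rule c)
  finally show ?thesis .
qed

lemma stalk_carrier: "carrier (stalk X x) = {germ X x U s | U s. opn U \<and> x \<in> U \<and> s \<in> Sc U}"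
  by (simp add: stalk_def)

lemma stalk_one: "opn U \<Longrightarrow> x \<in> U \<Longrightarrow> \<one>\<^bsub>stalk X x\<^esub> = germ X x U \<one>\<^bsub>sect X U\<^esub>"
proof -
  assume U: "opn U" "x \<in> U"
  have "germ X x (topspace (spc X)) \<one>\<^bsub>sect X (topspace (spc X))\<^esub> = germ X x U \<one>\<^bsub>sect X U\<^esub>"
    by (rule germ_eq[where W = U]) (use U openin_subset[OF U(1)] in \<open>auto simp: sect_one_closed restr_one\<close>)
  then show ?thesis by (simp add: stalk_def)
qed

text \<open>An inverse of a germ is represented by a section, and the product of representatives is \<open>1\<close> on a
  smaller neighbourhood; conversely an inverse of a restriction represents an inverse germ.\<close>

lemma germ_unit_iff:
  assumes U: "opn U" "x \<in> U" "s \<in> Sc U"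
  shows "germ X x U s \<in> Units (stalk X x) \<longleftrightarrow> unit_near X x U s"
proof
  assume "germ X x U s \<in> Units (stalk X x)"
  then obtain V t where V: "opn V" "x \<in> V" "t \<in> Sc V"
    and e: "germ X x U s \<otimes>\<^bsub>stalk X x\<^esub> germ X x V t = \<one>\<^bsub>stalk X x\<^esub>"
    unfolding Units_def stalk_carrier by blast
  let ?I = "U \<inter> V"
  have I: "opn ?I" "x \<in> ?I" using U V by blast+
  have "germ X x ?I (restr X U ?I s \<otimes>\<^bsub>sect X ?I\<^esub> restr X V ?I t) = germ X x ?I \<one>\<^bsub>sect X ?I\<^esub>"
    using e unfolding stalk_mult[OF U V] stalk_one[OF I] .
  then obtain W where W: "opn W" "x \<in> W" "W \<subseteq> ?I"
    "restr X ?I W (restr X U ?I s \<otimes>\<^bsub>sect X ?I\<^esub> restr X V ?I t) = restr X ?I W \<one>\<^bsub>sect X ?I\<^esub>"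
    by (rule germ_eqD) (use I sect_one_closed in auto)
  interpret W: comm_monoid "sect X W" using comm_monoid_sect[OF W(1)] .
  have c: "restr X U W s \<in> Sc W" "restr X V W t \<in> Sc W" using U V W restr_closed by auto
  have m: "restr X U W s \<otimes>\<^bsub>sect X W\<^esub> restr X V W t = \<one>\<^bsub>sect X W\<^esub>"
    using W U V I by (simp add: restr_mult restr_one restr_closed restr_restr)
  have "restr X U W s \<in> Units (sect X W)"
    using c m W.m_comm[OF c] unfolding Units_def by auto
  then show "unit_near X x U s" unfolding unit_near_def using W by blast
next
  assume "unit_near X x U s"
  then obtain W where W: "opn W" "x \<in> W" "W \<subseteq> U" "restr X U W s \<in> Units (sect X W)"
    unfolding unit_near_def by blast
  then obtain t where t: "t \<in> Sc W" "restr X U W s \<otimes>\<^bsub>sect X W\<^esub> t = \<one>\<^bsub>sect X W\<^esub>"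
    "t \<otimes>\<^bsub>sect X W\<^esub> restr X U W s = \<one>\<^bsub>sect X W\<^esub>" unfolding Units_def by blast
  have UW: "U \<inter> W = W" "W \<inter> U = W" using W by blast+
  have "germ X x U s \<otimes>\<^bsub>stalk X x\<^esub> germ X x W t = \<one>\<^bsub>stalk X x\<^esub>"
    unfolding stalk_mult[OF U W(1,2) t(1)] UW stalk_one[OF W(1,2)] using t W by (simp add: restr_id)
  moreover have "germ X x W t \<otimes>\<^bsub>stalk X x\<^esub> germ X x U s = \<one>\<^bsub>stalk X x\<^esub>"
    unfolding stalk_mult[OF W(1,2) t(1) U] UW stalk_one[OF W(1,2)] using t W by (simp add: restr_id)
  ultimately show "germ X x U s \<in> Units (stalk X x)"
    unfolding Units_def stalk_carrier using U W t by blast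
qed

end

lemma monoidal_space_presheaf: "monoidal_space X \<Longrightarrow> presheaf_of_monoids X"
  by (simp add: monoidal_space_def presheaf_of_monoids_def)

lemma openin_preim:
  assumes "continuous_map (spc X) (spc Y) (base f)" "openin (spc Y) V"
  shows "openin (spc X) (preim X f V)"
  using openin_continuous_map_preimage[OF assms] by (simp add: preim_def)

lemma stalk_map_germ:
  assumes X: "monoidal_space X" and cont: "continuous_map (spc X) (spc Y) (base f)"
    and hom: "\<And>V. openin (spc Y) V \<Longrightarrow> shf f V \<in> monoid_hom (sect Y V) (sect X (preim X f V))"
    and nat: "\<And>V W t. \<lbrakk>openin (spc Y) V; openin (spc Y) W; W \<subseteq> V; t \<in> carrier (sect Y V)\<rbrakk> \<Longrightarrow>
           shf f W (restr Y V W t) = restr X (preim X f V) (preim X f W) (shf f V t)"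
    and Y: "monoidal_space Y" and x: "x \<in> topspace (spc X)"
    and V: "openin (spc Y) V" "base f x \<in> V" "t \<in> carrier (sect Y V)"
  shows "stalk_map X f x (germ Y (base f x) V t) = germ X x (preim X f V) (shf f V t)"
proof -
  interpret X: presheaf_of_monoids X using monoidal_space_presheaf[OF X] .
  interpret Y: presheaf_of_monoids Y using monoidal_space_presheaf[OF Y] .
  have closed: "shf f V t \<in> carrier (sect X (preim X f V))" if "openin (spc Y) V" "t \<in> carrier (sect Y V)" for V t
    using hom[OF that(1)] that(2) by (auto simp: monoid_hom_def hom_def)
  note op = openin_preim[of X Y f, OF cont]
  show ?thesis unfolding stalk_map_def
  proof (rule UN_pair_const[OF Y.germ_self[OF V]])
    fix V' t' assume "(V', t') \<in> germ Y (base f x) V t"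
    then obtain W where W: "openin (spc Y) V'" "t' \<in> carrier (sect Y V')" "openin (spc Y) W" "base f x \<in> W" "W \<subseteq> V" "W \<subseteq> V'"
      "restr Y V W t = restr Y V' W t'" unfolding Y.germ_mem by blast
    have e: "restr X (preim X f V') (preim X f W) (shf f V' t') = restr X (preim X f V) (preim X f W) (shf f V t)"
      using nat[of V W t] nat[of V' W t'] V W by simp
    show "germ X x (preim X f V') (shf f V' t') = germ X x (preim X f V) (shf f V t)"
      by (rule X.germ_eq[OF op[OF W(1)] closed[OF W(1,2)] op[OF V(1)] closed[OF V(1,3)] op[OF W(3)] _ _ _ e])
        (use W x in \<open>auto simp: preim_def\<close>)
  qed
qed

text \<open>Homomorphisms preserve units, so half of the locality condition holds for every map of sheaves;
  what remains is that invertibility near \<open>x\<close> descends to invertibility near the image of \<open>x\<close>.\<close>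

lemma mspace_morphism_iff:
  "mspace_morphism X Y f \<longleftrightarrow>
     monoidal_space X \<and> monoidal_space Y \<and>
     continuous_map (spc X) (spc Y) (base f) \<and>
     (\<forall>V. openin (spc Y) V \<longrightarrow> shf f V \<in> monoid_hom (sect Y V) (sect X (preim X f V))) \<and>
     (\<forall>V W. openin (spc Y) V \<and> openin (spc Y) W \<and> W \<subseteq> V \<longrightarrow>
        (\<forall>t\<in>carrier (sect Y V).
           shf f W (restr Y V W t) = restr X (preim X f V) (preim X f W) (shf f V t))) \<and>
     (\<forall>x\<in>topspace (spc X). \<forall>V. openin (spc Y) V \<and> base f x \<in> V \<longrightarrow>
        (\<forall>t\<in>carrier (sect Y V). unit_near X x (preim X f V) (shf f V t) \<longrightarrow> unit_near Y (base f x) V t))"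
  (is "_ \<longleftrightarrow> ?X \<and> ?Y \<and> ?c \<and> ?h \<and> ?n \<and> ?u")
proof -
  have key: "(\<forall>x\<in>topspace (spc X).
        {p \<in> carrier (stalk Y (base f x)). stalk_map X f x p \<in> Units (stalk X x)} = Units (stalk Y (base f x)))
    \<longleftrightarrow> ?u" (is "(\<forall>x\<in>_. ?S x) \<longleftrightarrow> _") if h: ?X ?Y ?c ?h ?n
  proof (intro ball_cong refl)
    interpret X: presheaf_of_monoids X using monoidal_space_presheaf[OF h(1)] .
    interpret Y: presheaf_of_monoids Y using monoidal_space_presheaf[OF h(2)] .
    fix x assume x: "x \<in> topspace (spc X)"
    let ?y = "base f x"
    have st: "stalk_map X f x (germ Y ?y V t) \<in> Units (stalk X x) \<longleftrightarrow> unit_near X x (preim X f V) (shf f V t)"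
      if V: "openin (spc Y) V" "?y \<in> V" "t \<in> carrier (sect Y V)" for V t
    proof -
      have c: "shf f V t \<in> carrier (sect X (preim X f V))" using h(4) V by (auto simp: monoid_hom_def hom_def)
      have m: "x \<in> preim X f V" using x V by (simp add: preim_def)
      have "stalk_map X f x (germ Y ?y V t) = germ X x (preim X f V) (shf f V t)"
        by (rule stalk_map_germ[OF h(1,3) _ _ h(2) x V]) (use h(4,5) in blast)+
      then show ?thesis using X.germ_unit_iff[OF openin_preim[of X Y f, OF h(3) V(1)] m c] by simp
    qed
    have up: "unit_near X x (preim X f V) (shf f V t)" if V: "openin (spc Y) V" "t \<in> carrier (sect Y V)"
      and u: "unit_near Y ?y V t" for V t
    proof -
      obtain W where W: "openin (spc Y) W" "?y \<in> W" "W \<subseteq> V" "restr Y V W t \<in> Units (sect Y W)"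
        using u unfolding unit_near_def by blast
      have "shf f W (restr Y V W t) \<in> Units (sect X (preim X f W))"
        by (rule monoid_hom_Units[OF Y.comm_monoid_sect[OF W(1)]
             X.comm_monoid_sect[OF openin_preim[of X Y f, OF h(3) W(1)]] _ W(4)]) (use h(4) W in blast)
      then have "restr X (preim X f V) (preim X f W) (shf f V t) \<in> Units (sect X (preim X f W))"
        using h(5) W V by (metis (no_types, lifting))
      then show ?thesis unfolding unit_near_def using openin_preim[of X Y f, OF h(3) W(1)] x W
        by (intro exI[of _ "preim X f W"]) (auto simp: preim_def)
    qed
    have U: "Units (stalk Y ?y) \<subseteq> carrier (stalk Y ?y)" unfolding Units_def by blast
    show "?S x \<longleftrightarrow> (\<forall>V. openin (spc Y) V \<and> ?y \<in> V \<longrightarrow>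
        (\<forall>t\<in>carrier (sect Y V). unit_near X x (preim X f V) (shf f V t) \<longrightarrow> unit_near Y ?y V t))"
    proof (intro iffI allI impI ballI)
      fix V t assume S: "?S x" and V: "openin (spc Y) V \<and> ?y \<in> V" and t: "t \<in> carrier (sect Y V)"
        and u: "unit_near X x (preim X f V) (shf f V t)"
      have "germ Y ?y V t \<in> {p \<in> carrier (stalk Y (base f x)). stalk_map X f x p \<in> Units (stalk X x)}"
        using st[of V t] V t u by (auto simp: Y.stalk_carrier)
      then show "unit_near Y ?y V t" unfolding S using Y.germ_unit_iff[of V ?y t] V t by blast
    next
      assume a: "\<forall>V. openin (spc Y) V \<and> ?y \<in> V \<longrightarrow>
        (\<forall>t\<in>carrier (sect Y V). unit_near X x (preim X f V) (shf f V t) \<longrightarrow> unit_near Y ?y V t)"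
      have "stalk_map X f x p \<in> Units (stalk X x) \<longleftrightarrow> p \<in> Units (stalk Y ?y)" if p: "p \<in> carrier (stalk Y ?y)" for p
      proof -
        obtain V t where V: "openin (spc Y) V" "?y \<in> V" "t \<in> carrier (sect Y V)" "p = germ Y ?y V t"
          using p unfolding Y.stalk_carrier by blast
        show ?thesis unfolding V(4) st[OF V(1-3)] Y.germ_unit_iff[OF V(1-3)] using a up V by blast
      qed
      then show "?S x" using U by blast
    qed
  qed
  show ?thesis unfolding mspace_morphism_def by (intro conj_cong refl, rule key)
qed

lemma mspace_morphismD:
  assumes "mspace_morphism X Y f"
  shows "monoidal_space X" "monoidal_space Y" "continuous_map (spc X) (spc Y) (base f)"
    "openin (spc Y) V \<Longrightarrow> shf f V \<in> monoid_hom (sect Y V) (sect X (preim X f V))"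
    "\<lbrakk>openin (spc Y) V; openin (spc Y) W; W \<subseteq> V; t \<in> carrier (sect Y V)\<rbrakk> \<Longrightarrow>
       shf f W (restr Y V W t) = restr X (preim X f V) (preim X f W) (shf f V t)"
    "\<lbrakk>x \<in> topspace (spc X); openin (spc Y) V; base f x \<in> V; t \<in> carrier (sect Y V);
       unit_near X x (preim X f V) (shf f V t)\<rbrakk> \<Longrightarrow> unit_near Y (base f x) V t"
  using assms[unfolded mspace_morphism_iff] by simp_all

text \<open>The maps on sections of the inverse are the inverse functions.  They preserve and reflect units, so
  the inverse automatically satisfies the locality condition.\<close>

lemma mspace_isoI:
  assumes f: "mspace_morphism X Y f" and e: "continuous_map (spc Y) (spc X) e"
    and ef: "\<And>x. x \<in> topspace (spc X) \<Longrightarrow> e (base f x) = x"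
    and fe: "\<And>y. y \<in> topspace (spc Y) \<Longrightarrow> base f (e y) = y"
    and bij: "\<And>V. openin (spc Y) V \<Longrightarrow> bij_betw (shf f V) (carrier (sect Y V)) (carrier (sect X (preim X f V)))"
  shows "mspace_iso X Y f"
proof -
  note F = mspace_morphismD[OF f]
  interpret X: presheaf_of_monoids X using monoidal_space_presheaf[OF F(1)] .
  interpret Y: presheaf_of_monoids Y using monoidal_space_presheaf[OF F(2)] .
  \<comment> \<open>\<open>q\<close> takes preimages under the inverse \<open>e\<close> of the base map of \<open>f\<close>.\<close>
  define q where "q = (\<lambda>U. {y \<in> topspace (spc Y). e y \<in> U})"
  define g where "g = \<lparr>base = e, shf = (\<lambda>U. inv_into (carrier (sect Y (q U))) (shf f (q U)))\<rparr>"
  have g: "base g = e" "\<And>U. shf g U = inv_into (carrier (sect Y (q U))) (shf f (q U))"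
    "\<And>U. preim Y g U = q U" by (simp_all add: g_def q_def preim_def)
  have oq: "openin (spc Y) (q U)" if "openin (spc X) U" for U
    using openin_continuous_map_preimage[OF e that] by (simp add: q_def)
  have cf: "base f x \<in> topspace (spc Y)" if "x \<in> topspace (spc X)" for x
    using F(3) that by (auto simp: continuous_map_def Pi_iff)
  have ce: "e y \<in> topspace (spc X)" if "y \<in> topspace (spc Y)" for y
    using e that by (auto simp: continuous_map_def Pi_iff)
  have pq: "preim X f (q U) = U" if "openin (spc X) U" for U
    using openin_subset[OF that] cf ef by (auto simp: preim_def q_def)
  have qp: "q (preim X f V) = V" if "openin (spc Y) V" for V
    using openin_subset[OF that] ce fe by (auto simp: preim_def q_def)
  have fV: "shf f V \<in> monoid_hom (sect Y V) (sect X (preim X f V))" if "openin (spc Y) V" for V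
    using F(4) that .
  have nat: "shf f W (restr Y V W t) = restr X (preim X f V) (preim X f W) (shf f V t)"
    if "openin (spc Y) V" "openin (spc Y) W" "W \<subseteq> V" "t \<in> carrier (sect Y V)" for V W t
    using F(5) that .
  have gc: "shf g U s \<in> carrier (sect Y (q U))" "shf f (q U) (shf g U s) = s"
    if "openin (spc X) U" "s \<in> carrier (sect X U)" for U s
  proof -
    have b: "bij_betw (shf f (q U)) (carrier (sect Y (q U))) (carrier (sect X U))"
      using bij[OF oq[OF that(1)]] pq[OF that(1)] by simp
    show "shf g U s \<in> carrier (sect Y (q U))" "shf f (q U) (shf g U s) = s"
      unfolding g using bij_betw_apply[OF bij_betw_inv_into[OF b]] bij_betw_inv_into_right[OF b] that(2) by blast+
  qed
  have gu: "shf g U s = t" if "openin (spc X) U" "t \<in> carrier (sect Y (q U))" "shf f (q U) t = s" for U s t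
    unfolding g using bij_betw_inv_into_left[OF bij[OF oq[OF that(1)]] that(2)] that(3) by simp
  have gm: "mspace_morphism Y X g"
    unfolding mspace_morphism_iff
  proof (intro conjI allI impI ballI)
    show "monoidal_space Y" "monoidal_space X" by (rule F)+
    show "continuous_map (spc Y) (spc X) (base g)" using e by (simp add: g)
  next
    fix U assume U: "openin (spc X) U"
    note o = oq[OF U]
    have fm: "shf f (q U) (s \<otimes>\<^bsub>sect Y (q U)\<^esub> t) = shf f (q U) s \<otimes>\<^bsub>sect X U\<^esub> shf f (q U) t"
      "shf f (q U) \<one>\<^bsub>sect Y (q U)\<^esub> = \<one>\<^bsub>sect X U\<^esub>"
      if "s \<in> carrier (sect Y (q U))" "t \<in> carrier (sect Y (q U))" for s t
      using fV[OF o] that unfolding pq[OF U] by (simp_all add: monoid_hom_def hom_def)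
    have "shf g U (s \<otimes>\<^bsub>sect X U\<^esub> t) = shf g U s \<otimes>\<^bsub>sect Y (q U)\<^esub> shf g U t"
      if "s \<in> carrier (sect X U)" "t \<in> carrier (sect X U)" for s t
      using that gc[OF U] by (intro gu U) (simp_all add: fm Y.sect_mult_closed[OF o])
    moreover have "shf g U \<one>\<^bsub>sect X U\<^esub> = \<one>\<^bsub>sect Y (q U)\<^esub>"
      using Y.sect_one_closed[OF o] by (intro gu U fm(2))
    ultimately show "shf g U \<in> monoid_hom (sect X U) (sect Y (preim Y g U))"
      unfolding g(3) monoid_hom_def hom_def using gc(1)[OF U] by blast
  next
    fix U W s assume "openin (spc X) U \<and> openin (spc X) W \<and> W \<subseteq> U" and s: "s \<in> carrier (sect X U)"
    then have U: "openin (spc X) U" "openin (spc X) W" "W \<subseteq> U" by blast+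
    have sub: "q W \<subseteq> q U" using U by (auto simp: q_def)
    show "shf g W (restr X U W s) = restr Y (preim Y g U) (preim Y g W) (shf g U s)"
      unfolding g(3)
      using nat[OF oq[OF U(1)] oq[OF U(2)] sub gc(1)[OF U(1) s]] gc[OF U(1) s] pq U
      by (intro gu Y.restr_closed oq sub) simp_all
  next
    fix y U s assume y: "y \<in> topspace (spc Y)" and "openin (spc X) U \<and> base g y \<in> U" and s: "s \<in> carrier (sect X U)"
      and u: "unit_near Y y (preim Y g U) (shf g U s)"
    then have U: "openin (spc X) U" "e y \<in> U" by (auto simp: g)
    obtain W where W: "openin (spc Y) W" "y \<in> W" "W \<subseteq> q U" "restr Y (q U) W (shf g U s) \<in> Units (sect Y W)"
      using u unfolding unit_near_def g(3) by blast
    let ?P = "preim X f W"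
    have o: "openin (spc X) ?P" using openin_preim[of X Y f, OF F(3) W(1)] .
    have "shf f W (restr Y (q U) W (shf g U s)) \<in> Units (sect X ?P)"
      by (rule monoid_hom_Units[OF Y.comm_monoid_sect[OF W(1)] X.comm_monoid_sect[OF o] fV[OF W(1)] W(4)])
    also have "shf f W (restr Y (q U) W (shf g U s)) = restr X U ?P s"
      using nat[OF oq[OF U(1)] W(1) W(3) gc(1)[OF U(1) s]] gc(2)[OF U(1) s] pq[OF U(1)] by simp
    finally have "restr X U ?P s \<in> Units (sect X ?P)" .
    moreover have "e y \<in> ?P" using W(2) y ce fe by (simp add: preim_def)
    moreover have "?P \<subseteq> U" using W(3) pq[OF U(1)] unfolding preim_def by blast
    ultimately show "unit_near X (base g y) U s" unfolding unit_near_def g(1) using o by blast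
  qed
  have "mspace_map_eq X X (mspace_comp Y g f) mspace_id"
    unfolding mspace_map_eq_def mspace_comp_def mspace_id_def using ef gc(2) by (simp add: g)
  moreover have "mspace_map_eq Y Y (mspace_comp X f g) mspace_id"
    unfolding mspace_map_eq_def mspace_comp_def mspace_id_def
  proof (intro conjI allI impI ballI)
    fix V t assume V: "openin (spc Y) V" and t: "t \<in> carrier (sect Y V)"
    have "shf g (preim X f V) (shf f V t) = t"
      by (rule gu[OF openin_preim[of X Y f, OF F(3) V]]) (use t qp[OF V] in auto)
    then show "shf \<lparr>base = \<lambda>x. base f (base g x), shf = \<lambda>W t. shf g (preim X f W) (shf f W t)\<rparr> V t =
       shf \<lparr>base = \<lambda>x. x, shf = \<lambda>V t. t\<rparr> V t" by simp
  qed (simp add: g fe)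
  ultimately show ?thesis unfolding mspace_iso_def using f gm by blast
qed

section \<open>Open immersions\<close>

lemma openin_open_subspace:
  "openin (spc Y) U \<Longrightarrow> openin (spc (open_subspace Y U)) V \<longleftrightarrow> openin (spc Y) V \<and> V \<subseteq> U"
  by (simp add: open_subspace_def openin_open_subtopology)

lemma open_subspace_simps [simp]:
  "sect (open_subspace Y U) = sect Y" "restr (open_subspace Y U) = restr Y"
  by (simp_all add: open_subspace_def)

lemma topspace_open_subspace: "openin (spc Y) U \<Longrightarrow> topspace (spc (open_subspace Y U)) = U"
  using openin_subset[of "spc Y" U] by (auto simp: open_subspace_def)

lemma monoidal_space_open_subspace:
  assumes Y: "monoidal_space Y" and U: "openin (spc Y) U"
  shows "monoidal_space (open_subspace Y U)"
proof -
  have pre: "monoid_presheaf (open_subspace Y U)"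
    using Y unfolding monoidal_space_def monoid_presheaf_def openin_open_subspace[OF U] by auto
  have glue: "\<exists>!s. s \<in> carrier (sect Y (\<Union>\<U>)) \<and> (\<forall>V\<in>\<U>. restr Y (\<Union>\<U>) V s = \<sigma> V)"
    if "\<forall>V\<in>\<U>. openin (spc Y) V \<and> V \<subseteq> U \<and> \<sigma> V \<in> carrier (sect Y V)"
      "\<forall>V\<in>\<U>. \<forall>W\<in>\<U>. restr Y V (V \<inter> W) (\<sigma> V) = restr Y W (V \<inter> W) (\<sigma> W)" for \<U> \<sigma>
    by (rule conjunct2[OF Y[unfolded monoidal_space_def], THEN spec, THEN spec, THEN mp]) (use that in blast)
  show ?thesis
    unfolding monoidal_space_def openin_open_subspace[OF U] open_subspace_simps
  proof (intro conjI allI impI pre)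
    fix \<U> \<sigma>
    assume "(\<forall>V\<in>\<U>. (openin (spc Y) V \<and> V \<subseteq> U) \<and> \<sigma> V \<in> carrier (sect Y V)) \<and>
      (\<forall>V\<in>\<U>. \<forall>W\<in>\<U>. restr Y V (V \<inter> W) (\<sigma> V) = restr Y W (V \<inter> W) (\<sigma> W))"
    then show "\<exists>!s. s \<in> carrier (sect Y (\<Union>\<U>)) \<and> (\<forall>V\<in>\<U>. restr Y (\<Union>\<U>) V s = \<sigma> V)"
      by (elim conjE) (rule glue, simp_all)
  qed
qed

lemma mspace_morphism_into_open:
  assumes f: "mspace_morphism X Y f" and U: "openin (spc Y) U"
    and fU: "\<And>x. x \<in> topspace (spc X) \<Longrightarrow> base f x \<in> U"
  shows "mspace_morphism X (open_subspace Y U) f"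
proof -
  note F = mspace_morphismD[OF f]
  have cont: "continuous_map (spc X) (spc (open_subspace Y U)) (base f)"
    using F(3) fU by (auto simp: open_subspace_def continuous_map_in_subtopology)
  have near: "unit_near (open_subspace Y U) (base f x) V t"
    if "unit_near Y (base f x) V t" "V \<subseteq> U" for x V t
    using that unfolding unit_near_def openin_open_subspace[OF U] open_subspace_simps by blast
  show ?thesis
    unfolding mspace_morphism_iff openin_open_subspace[OF U] open_subspace_simps
  proof (intro conjI allI impI ballI)
    show "monoidal_space X" "monoidal_space (open_subspace Y U)"
      using F(1) monoidal_space_open_subspace[OF F(2) U] .
    show "continuous_map (spc X) (spc (open_subspace Y U)) (base f)" by (rule cont)
  next
    fix V assume "openin (spc Y) V \<and> V \<subseteq> U"
    then show "shf f V \<in> monoid_hom (sect Y V) (sect X (preim X f V))" using F(4) by simp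
  next
    fix V W t assume "(openin (spc Y) V \<and> V \<subseteq> U) \<and> (openin (spc Y) W \<and> W \<subseteq> U) \<and> W \<subseteq> V" "t \<in> carrier (sect Y V)"
    then show "shf f W (restr Y V W t) = restr X (preim X f V) (preim X f W) (shf f V t)" using F(5) by simp
  next
    fix x V t assume x: "x \<in> topspace (spc X)" and V: "(openin (spc Y) V \<and> V \<subseteq> U) \<and> base f x \<in> V"
      and t: "t \<in> carrier (sect Y V)" and u: "unit_near X x (preim X f V) (shf f V t)"
    show "unit_near (open_subspace Y U) (base f x) V t"
      by (rule near[OF F(6)[OF x _ _ t u]]) (use V in simp_all)
  qed
qed

lemma open_immersionI:
  assumes f: "mspace_morphism X Y f" and U: "openin (spc Y) U"
    and fU: "\<And>x. x \<in> topspace (spc X) \<Longrightarrow> base f x \<in> U"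
    and iso: "mspace_iso X (open_subspace Y U) f"
  shows "open_immersion X Y f"
proof -
  note F = mspace_morphismD[OF f]
  interpret X: presheaf_of_monoids X using monoidal_space_presheaf[OF F(1)] .
  have "mspace_map_eq X Y f (mspace_comp (open_subspace Y U) (open_inclusion Y U) f)"
    unfolding mspace_map_eq_def
  proof (intro conjI allI impI ballI)
    fix V t assume V: "openin (spc Y) V" and t: "t \<in> carrier (sect Y V)"
    have p: "preim X f (U \<inter> V) = preim X f V" using fU by (auto simp: preim_def)
    have q: "preim (open_subspace Y U) (open_inclusion Y U) V = U \<inter> V"
      by (auto simp: preim_def topspace_open_subspace[OF U] open_inclusion_def)
    have "shf f (U \<inter> V) (restr Y V (U \<inter> V) t) = restr X (preim X f V) (preim X f V) (shf f V t)"
      using F(5)[OF V openin_Int[OF U V] _ t] unfolding p by simp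
    also have "\<dots> = shf f V t"
      by (rule X.restr_id[OF openin_preim[of X Y f, OF F(3) V]])
        (use F(4)[OF V] t in \<open>auto simp: monoid_hom_def hom_def\<close>)
    finally show "shf f V t = shf (mspace_comp (open_subspace Y U) (open_inclusion Y U) f) V t"
      unfolding mspace_comp_def mspace_map.simps q by (simp add: open_inclusion_def)
  qed (simp add: mspace_comp_def open_inclusion_def)
  then show ?thesis unfolding open_immersion_def using f U iso by blast
qed

text \<open>The auxiliary isomorphism onto the open subspace and its inverse are eliminated: \<open>f\<close> itself compares
  the points and the global sections of \<open>X\<close> with those of \<open>U\<close>.\<close>

lemma open_immersionE:
  assumes "open_immersion X Y f"
  obtains U where "openin (spc Y) U" "\<And>x. x \<in> topspace (spc X) \<Longrightarrow> base f x \<in> U"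
    "\<And>y. y \<in> U \<Longrightarrow> \<exists>x\<in>topspace (spc X). base f x = y"
    "bij_betw (shf f U) (carrier (sect Y U)) (carrier (sect X (topspace (spc X))))"
proof -
  obtain U g where U: "openin (spc Y) U" and g: "mspace_iso X (open_subspace Y U) g"
    and fg: "mspace_map_eq X Y f (mspace_comp (open_subspace Y U) (open_inclusion Y U) g)"
    and f: "mspace_morphism X Y f"
    using assms unfolding open_immersion_def by blast
  let ?U = "open_subspace Y U" and ?P = "topspace (spc X)"
  obtain h where gm: "mspace_morphism X ?U g" and hm: "mspace_morphism ?U X h"
    and gh: "mspace_map_eq X X (mspace_comp ?U h g) mspace_id"
    and hg: "mspace_map_eq ?U ?U (mspace_comp X g h) mspace_id"
    using g unfolding mspace_iso_def by blast
  note T = topspace_open_subspace[OF U]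
  interpret Y: presheaf_of_monoids Y using monoidal_space_presheaf[OF mspace_morphismD(2)[OF f]] .
  have b: "base f x = base g x" if "x \<in> ?P" for x
    using fg that by (simp add: mspace_map_eq_def mspace_comp_def open_inclusion_def)
  have gU: "base g x \<in> U" if "x \<in> ?P" for x
    using mspace_morphismD(3)[OF gm] that T by (auto simp: continuous_map_def Pi_iff)
  have hP: "base h y \<in> ?P" "base g (base h y) = y" if "y \<in> U" for y
    using mspace_morphismD(3)[OF hm] hg that T
    by (auto simp: continuous_map_def mspace_map_eq_def Pi_iff mspace_comp_def mspace_id_def)
  have pg: "preim X g U = ?P" using gU by (auto simp: preim_def)
  have ph: "preim ?U h ?P = U" using hP T by (auto simp: preim_def)
  have oU: "openin (spc ?U) U" using U by (simp add: openin_open_subspace)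
  have gc: "shf g U t \<in> carrier (sect X ?P)" if "t \<in> carrier (sect Y U)" for t
    using mspace_morphismD(4)[OF gm oU] that pg by (auto simp: monoid_hom_def hom_def)
  have hc: "shf h ?P s \<in> carrier (sect Y U)" if "s \<in> carrier (sect X ?P)" for s
    using mspace_morphismD(4)[OF hm openin_topspace] that ph by (auto simp: monoid_hom_def hom_def)
  have 1: "shf g U (shf h ?P s) = s" if "s \<in> carrier (sect X ?P)" for s
    using gh that ph unfolding mspace_map_eq_def mspace_comp_def mspace_id_def by auto
  have 2: "shf h ?P (shf g U t) = t" if "t \<in> carrier (sect Y U)" for t
    using hg that pg oU unfolding mspace_map_eq_def mspace_comp_def mspace_id_def by auto
  have "bij_betw (shf g U) (carrier (sect Y U)) (carrier (sect X ?P))"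
    by (rule bij_betw_byWitness[where f' = "shf h ?P"]) (use gc hc 1 2 in auto)
  moreover have "shf f U t = shf g U t" if t: "t \<in> carrier (sect Y U)" for t
  proof -
    have q: "preim ?U (open_inclusion Y U) U = U" using T by (auto simp: preim_def open_inclusion_def)
    have "shf f U t = shf g (preim ?U (open_inclusion Y U) U) (shf (open_inclusion Y U) U t)"
      using fg U t by (simp add: mspace_map_eq_def mspace_comp_def)
    then show ?thesis using Y.restr_id[OF U t] unfolding q by (simp add: open_inclusion_def)
  qed
  ultimately have "bij_betw (shf f U) (carrier (sect Y U)) (carrier (sect X ?P))"
    by (simp cong: bij_betw_cong)
  then show thesis using that[OF U] b gU hP by metis
qed

section \<open>The spectrum of a localization\<close>

lemma prime_disjoint_gen:
  assumes "prime_ideal M p" "a \<in> carrier M"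
  shows "gen_submonoid M {a} \<inter> p = {} \<longleftrightarrow> a \<notin> p"
proof
  show "gen_submonoid M {a} \<inter> p = {} \<Longrightarrow> a \<notin> p" using subset_gen_submonoid[of "{a}" M] by blast
  assume "a \<notin> p"
  then have "gen_submonoid M {a} \<subseteq> carrier M - p"
    unfolding gen_submonoid_def using assms by (intro hull_minimal) (auto simp: prime_ideal_def)
  then show "gen_submonoid M {a} \<inter> p = {}" by blast
qed

context spec_monoid begin

lemma prime_idealI:
  assumes "p \<subseteq> carrier G" "\<one> \<notin> p"
    and "\<And>x y. x \<in> carrier G \<Longrightarrow> y \<in> carrier G \<Longrightarrow> x \<otimes> y \<in> p \<longleftrightarrow> x \<in> p \<or> y \<in> p"
  shows "prime_ideal G p"
  unfolding prime_ideal_def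
proof (intro conjI subset_antisym subsetI)
  fix x assume "x \<in> p <#> carrier G" then show "x \<in> p" using assms(1,3) unfolding set_mult_def by blast
next
  fix x assume x: "x \<in> p"
  then have "x = x \<otimes> \<one>" using assms(1) r_one[of x] by auto
  then show "x \<in> p <#> carrier G" unfolding set_mult_def using x by blast
next
  show "submonoid (carrier G - p) G" unfolding submonoid_def using assms(2,3) by auto
qed (use assms(1) in auto)

lemma prime_nonunits: "prime_ideal G (carrier G - Units G)"
proof (rule prime_idealI)
  fix x y assume x: "x \<in> carrier G" and y: "y \<in> carrier G"
  have "x \<otimes> y \<in> Units G \<Longrightarrow> y \<in> Units G"
    using unit_factor[of y x] x y m_comm[of x y] by simp
  then show "x \<otimes> y \<in> carrier G - Units G \<longleftrightarrow> x \<in> carrier G - Units G \<or> y \<in> carrier G - Units G"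
    using unit_factor[of x y] x y by auto
qed auto

lemma prime_avoids_units:
  assumes q: "prime_ideal G q" shows "q \<subseteq> carrier G - Units G"
proof
  fix x assume x: "x \<in> q"
  have "x \<notin> Units G"
  proof
    assume u: "x \<in> Units G"
    have "\<one> \<in> q" using prime_mult_closed[OF q x Units_inv_closed[OF u]] Units_r_inv[OF u] by simp
    then show False using prime_one[OF q] by blast
  qed
  then show "x \<in> carrier G - Units G" using prime_subset[OF q x] by blast
qed

text \<open>The largest prime ideal disjoint from \<open>H\<close>.\<close>

lemma prime_nondivisors:
  assumes H: "submonoid H G"
  shows "prime_ideal G {c \<in> carrier G. \<forall>d\<in>carrier G. c \<otimes> d \<notin> H}"
proof (rule prime_idealI)
  have "\<one> \<otimes> \<one> \<in> H" using submonoid.one_closed[OF H] by simp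
  then show "\<one> \<notin> {c \<in> carrier G. \<forall>d\<in>carrier G. c \<otimes> d \<notin> H}" by blast
  fix x y assume x: "x \<in> carrier G" and y: "y \<in> carrier G"
  have "(\<exists>d\<in>carrier G. (x \<otimes> y) \<otimes> d \<in> H) \<longleftrightarrow> (\<exists>d\<in>carrier G. x \<otimes> d \<in> H) \<and> (\<exists>d\<in>carrier G. y \<otimes> d \<in> H)"
  proof (intro iffI)
    assume "\<exists>d\<in>carrier G. (x \<otimes> y) \<otimes> d \<in> H"
    then obtain d where d: "d \<in> carrier G" "(x \<otimes> y) \<otimes> d \<in> H" by blast
    have "x \<otimes> (y \<otimes> d) = (x \<otimes> y) \<otimes> d" "y \<otimes> (x \<otimes> d) = (x \<otimes> y) \<otimes> d" using x y d(1) by (simp_all add: m_ac)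
    then have "x \<otimes> (y \<otimes> d) \<in> H" "y \<otimes> (x \<otimes> d) \<in> H" using d(2) by simp_all
    then show "(\<exists>d\<in>carrier G. x \<otimes> d \<in> H) \<and> (\<exists>d\<in>carrier G. y \<otimes> d \<in> H)" using x y d(1) by blast
  next
    assume "(\<exists>d\<in>carrier G. x \<otimes> d \<in> H) \<and> (\<exists>d\<in>carrier G. y \<otimes> d \<in> H)"
    then obtain d e where d: "d \<in> carrier G" "e \<in> carrier G" "x \<otimes> d \<in> H" "y \<otimes> e \<in> H" by blast
    have "(x \<otimes> y) \<otimes> (d \<otimes> e) = (x \<otimes> d) \<otimes> (y \<otimes> e)" using x y d(1,2) by (simp add: m_ac)
    then have "(x \<otimes> y) \<otimes> (d \<otimes> e) \<in> H" using submonoid.m_closed[OF H d(3,4)] by simp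
    then show "\<exists>d\<in>carrier G. (x \<otimes> y) \<otimes> d \<in> H" using d(1,2) by blast
  qed
  then show "x \<otimes> y \<in> {c \<in> carrier G. \<forall>d\<in>carrier G. c \<otimes> d \<notin> H} \<longleftrightarrow>
      x \<in> {c \<in> carrier G. \<forall>d\<in>carrier G. c \<otimes> d \<notin> H} \<or> y \<in> {c \<in> carrier G. \<forall>d\<in>carrier G. c \<otimes> d \<notin> H}"
    using x y by auto
qed auto

lemma frac_one_section:
  assumes U: "openin (Spec_topology G) U" and x: "x \<in> carrier G"
  shows "(\<lambda>q\<in>U. loc_frac G (carrier G - q) x \<one>) \<in> carrier (Spec_sections G U)"
proof (rule secI)
  fix p assume p: "p \<in> U"
  show "\<exists>V m a. openin (Spec_topology G) V \<and> p \<in> V \<and> V \<subseteq> U \<and> m \<in> carrier G \<and> a \<in> carrier G \<and>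
     (\<forall>q\<in>V. a \<notin> q \<and> (\<lambda>q\<in>U. loc_frac G (carrier G - q) x \<one>) q = loc_frac G (carrier G - q) m a)"
    by (rule locI[OF U p _ x, of _ \<one>]) (use opn_pt[OF U] prime_one in auto)
qed simp

end

context loc_hom begin

text \<open>The inverse of contraction, \<open>p \<mapsto> H\<^sup>-\<^sup>1p\<close>, on the primes disjoint from \<open>H\<close>.\<close>

definition extend :: "'a set \<Rightarrow> 'b set" where
  "extend p = {x \<in> carrier N. \<exists>s\<in>H. \<exists>m\<in>p. \<phi> s \<otimes>\<^bsub>N\<^esub> x = \<phi> m}"

abbreviation (input) "disjoint_primes \<equiv> {p \<in> Spec_points M. H \<inter> p = {}}"

text \<open>Membership of a fraction can be read off from any of its numerators, because elements of \<open>H\<close> can be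
  cancelled modulo \<open>p\<close>.  All properties of \<open>extend\<close> follow from this.\<close>

lemma extend_iff:
  assumes p: "prime_ideal M p" "H \<inter> p = {}" and s: "s \<in> H" "m \<in> carrier M" "x \<in> carrier N" "\<phi> s \<otimes>\<^bsub>N\<^esub> x = \<phi> m"
  shows "x \<in> extend p \<longleftrightarrow> m \<in> p"
proof
  assume "x \<in> extend p"
  then obtain t n where t: "t \<in> H" "n \<in> p" "\<phi> t \<otimes>\<^bsub>N\<^esub> x = \<phi> n" unfolding extend_def by blast
  have n: "n \<in> carrier M" using M.prime_subset[OF p(1) t(2)] .
  have "\<phi> (t \<otimes>\<^bsub>M\<^esub> m) = \<phi> (s \<otimes>\<^bsub>M\<^esub> n)"
    using s t n by (simp add: s(4)[symmetric] t(3)[symmetric] N.m_lcomm)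
  then obtain u where u: "u \<in> H" "u \<otimes>\<^bsub>M\<^esub> (t \<otimes>\<^bsub>M\<^esub> m) = u \<otimes>\<^bsub>M\<^esub> (s \<otimes>\<^bsub>M\<^esub> n)"
    using separated[of "t \<otimes>\<^bsub>M\<^esub> m" "s \<otimes>\<^bsub>M\<^esub> n"] s t n by auto
  have "u \<otimes>\<^bsub>M\<^esub> (s \<otimes>\<^bsub>M\<^esub> n) \<in> p"
    using M.prime_mult_iff[OF p(1)] u(1) s t(2) n by simp
  then have "u \<otimes>\<^bsub>M\<^esub> (t \<otimes>\<^bsub>M\<^esub> m) \<in> p" using u(2) by simp
  then have "u \<in> p \<or> t \<in> p \<or> m \<in> p" using M.prime_mult_iff[OF p(1)] u(1) s(2) t(1) by simp
  then show "m \<in> p" using p(2) u(1) t(1) by blast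
qed (use s in \<open>auto simp: extend_def\<close>)

lemma extend_prime:
  assumes p: "prime_ideal M p" "H \<inter> p = {}" shows "prime_ideal N (extend p)"
proof -
  have mult: "x \<otimes>\<^bsub>N\<^esub> y \<in> extend p \<longleftrightarrow> x \<in> extend p \<or> y \<in> extend p" if x: "x \<in> carrier N" and y: "y \<in> carrier N" for x y
  proof -
    obtain s m where s: "s \<in> H" "m \<in> carrier M" "\<phi> s \<otimes>\<^bsub>N\<^esub> x = \<phi> m" using fractions[OF x] by blast
    obtain t n where t: "t \<in> H" "n \<in> carrier M" "\<phi> t \<otimes>\<^bsub>N\<^esub> y = \<phi> n" using fractions[OF y] by blast
    have "\<phi> (s \<otimes>\<^bsub>M\<^esub> t) \<otimes>\<^bsub>N\<^esub> (x \<otimes>\<^bsub>N\<^esub> y) = (\<phi> s \<otimes>\<^bsub>N\<^esub> x) \<otimes>\<^bsub>N\<^esub> (\<phi> t \<otimes>\<^bsub>N\<^esub> y)"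
      using s(1) t(1) x y by (simp add: N.m_ac)
    also have "\<dots> = \<phi> (m \<otimes>\<^bsub>M\<^esub> n)" unfolding s(3) t(3) using s t by simp
    finally have "x \<otimes>\<^bsub>N\<^esub> y \<in> extend p \<longleftrightarrow> m \<otimes>\<^bsub>M\<^esub> n \<in> p"
      using extend_iff[OF p, of "s \<otimes>\<^bsub>M\<^esub> t" "m \<otimes>\<^bsub>M\<^esub> n" "x \<otimes>\<^bsub>N\<^esub> y"] s t x y by simp
    then show ?thesis
      using extend_iff[OF p s(1,2) x s(3)] extend_iff[OF p t(1,2) y t(3)] M.prime_mult_iff[OF p(1)] s t by simp
  qed
  show ?thesis
  proof (rule N.prime_idealI)
    show "\<one>\<^bsub>N\<^esub> \<notin> extend p"
      using extend_iff[OF p, of "\<one>\<^bsub>M\<^esub>" "\<one>\<^bsub>M\<^esub>" "\<one>\<^bsub>N\<^esub>"] M.prime_one[OF p(1)] by simp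
  qed (use mult in \<open>auto simp: extend_def\<close>)
qed

lemma contract_extend:
  assumes p: "prime_ideal M p" "H \<inter> p = {}" shows "b (extend p) = p"
  using extend_iff[OF p, of "\<one>\<^bsub>M\<^esub>"] M.prime_subset[OF p(1)] by auto

lemma contract_disjoint: "prime_ideal N q \<Longrightarrow> H \<inter> b q = {}"
  using units N.prime_avoids_units by blast

lemma extend_contract:
  assumes q: "prime_ideal N q" shows "extend (b q) = q"
proof -
  have "x \<in> extend (b q) \<longleftrightarrow> x \<in> q" if x: "x \<in> carrier N" for x
  proof -
    obtain s m where s: "s \<in> H" "m \<in> carrier M" "\<phi> s \<otimes>\<^bsub>N\<^esub> x = \<phi> m" using fractions[OF x] by blast
    have "x \<in> extend (b q) \<longleftrightarrow> \<phi> s \<otimes>\<^bsub>N\<^esub> x \<in> q"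
      using extend_iff[OF b_prime[OF q] contract_disjoint[OF q] s(1,2) x s(3)] s by simp
    then show ?thesis using N.prime_mult_iff[OF q _ x, of "\<phi> s"] s(1) contract_disjoint[OF q] by auto
  qed
  then show ?thesis using N.prime_subset[OF q] by (auto simp: extend_def)
qed

lemma openin_extend:
  assumes D: "M.opn disjoint_primes" and V: "N.opn V"
  shows "M.opn {p \<in> disjoint_primes. extend p \<in> V}"
proof -
  obtain I where I: "I \<subseteq> carrier N" "V = Spec_points N - {q \<in> Spec_points N. I \<subseteq> q}"
    using V unfolding N.openin_Spec by blast
  define J where "J = {m \<in> carrier M. \<exists>s\<in>H. \<exists>x\<in>I. \<phi> s \<otimes>\<^bsub>N\<^esub> x = \<phi> m}"
  have "I \<subseteq> extend p \<longleftrightarrow> J \<subseteq> p" if p: "p \<in> disjoint_primes" for p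
  proof -
    have p': "prime_ideal M p" "H \<inter> p = {}" using p by (auto simp: Spec_points_def)
    show ?thesis
    proof
      assume i: "I \<subseteq> extend p"
      show "J \<subseteq> p"
      proof
        fix m assume "m \<in> J"
        then obtain s x where "m \<in> carrier M" "s \<in> H" "x \<in> I" "\<phi> s \<otimes>\<^bsub>N\<^esub> x = \<phi> m" unfolding J_def by blast
        then show "m \<in> p" using extend_iff[OF p', of s m x] i I(1) by blast
      qed
    next
      assume j: "J \<subseteq> p"
      show "I \<subseteq> extend p"
      proof
        fix x assume x: "x \<in> I"
        then obtain s m where "s \<in> H" "m \<in> carrier M" "\<phi> s \<otimes>\<^bsub>N\<^esub> x = \<phi> m" using fractions I(1) by blast
        then show "x \<in> extend p" using extend_iff[OF p', of s m x] j x I(1) unfolding J_def by blast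
      qed
    qed
  qed
  moreover have "extend p \<in> Spec_points N" if "p \<in> disjoint_primes" for p
    using that extend_prime by (auto simp: Spec_points_def)
  ultimately have "{p \<in> disjoint_primes. extend p \<in> V} =
      disjoint_primes \<inter> (Spec_points M - {p \<in> Spec_points M. J \<subseteq> p})"
    unfolding I(2) by blast
  moreover have "M.opn (Spec_points M - {p \<in> Spec_points M. J \<subseteq> p})"
    unfolding M.openin_Spec by (intro exI[of _ J]) (auto simp: J_def)
  ultimately show ?thesis using D by (simp add: openin_Int)
qed

text \<open>An equation between fractions in \<open>N\<^sub>q\<close> is witnessed by some \<open>u \<notin> q\<close>.  Clearing its denominator gives an
  element \<open>k\<close> of \<open>M\<close> outside the contraction of \<open>q\<close>, and \<open>separated\<close> lifts the resulting equation to \<open>M\<close>.\<close>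

lemma stalk_injective:
  assumes q: "prime_ideal N q" and z: "z \<in> carrier (M.L (b q))" and w: "w \<in> carrier (M.L (b q))"
    and e: "loc_induced N (carrier N - q) \<phi> z = loc_induced N (carrier N - q) \<phi> w"
  shows "z = w"
proof -
  note p = b_prime[OF q]
  obtain m c where m: "m \<in> carrier M" "c \<in> carrier M" "c \<notin> b q" "z = M.fr (b q) m c" using M.L_cases[OF p z] .
  obtain n d where n: "n \<in> carrier M" "d \<in> carrier M" "d \<notin> b q" "w = M.fr (b q) n d" using M.L_cases[OF p w] .
  have cd: "\<phi> c \<notin> q" "\<phi> d \<notin> q" using m n by auto
  have "N.fr q (\<phi> m) (\<phi> c) = N.fr q (\<phi> n) (\<phi> d)"
    using e unfolding m(4) n(4) induced_frac[OF q m(1-3)] induced_frac[OF q n(1-3)] .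
  then obtain u where u: "u \<in> carrier N" "u \<notin> q" "u \<otimes>\<^bsub>N\<^esub> (\<phi> d \<otimes>\<^bsub>N\<^esub> \<phi> m) = u \<otimes>\<^bsub>N\<^esub> (\<phi> c \<otimes>\<^bsub>N\<^esub> \<phi> n)"
    using N.L_eq_iff[OF q, of "\<phi> m" "\<phi> n" "\<phi> c" "\<phi> d"] m n cd by auto
  obtain s k where k: "s \<in> H" "k \<in> carrier M" "\<phi> s \<otimes>\<^bsub>N\<^esub> u = \<phi> k" using fractions[OF u(1)] by blast
  have "\<phi> s \<notin> q" using contract_disjoint[OF q] k(1) by auto
  then have kq: "k \<notin> b q" using k u N.prime_mult_iff[OF q, of "\<phi> s" u] by auto
  have l: "\<phi> (k \<otimes>\<^bsub>M\<^esub> (d \<otimes>\<^bsub>M\<^esub> m)) = \<phi> s \<otimes>\<^bsub>N\<^esub> (u \<otimes>\<^bsub>N\<^esub> (\<phi> d \<otimes>\<^bsub>N\<^esub> \<phi> m))"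
    using k m n u(1) by (simp add: k(3)[symmetric] N.m_assoc)
  have r: "\<phi> (k \<otimes>\<^bsub>M\<^esub> (c \<otimes>\<^bsub>M\<^esub> n)) = \<phi> s \<otimes>\<^bsub>N\<^esub> (u \<otimes>\<^bsub>N\<^esub> (\<phi> c \<otimes>\<^bsub>N\<^esub> \<phi> n))"
    using k m n u(1) by (simp add: k(3)[symmetric] N.m_assoc)
  have "\<phi> (k \<otimes>\<^bsub>M\<^esub> (d \<otimes>\<^bsub>M\<^esub> m)) = \<phi> (k \<otimes>\<^bsub>M\<^esub> (c \<otimes>\<^bsub>M\<^esub> n))" unfolding l r u(3) ..
  then obtain v where v: "v \<in> H" "v \<otimes>\<^bsub>M\<^esub> (k \<otimes>\<^bsub>M\<^esub> (d \<otimes>\<^bsub>M\<^esub> m)) = v \<otimes>\<^bsub>M\<^esub> (k \<otimes>\<^bsub>M\<^esub> (c \<otimes>\<^bsub>M\<^esub> n))"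
    using separated[of "k \<otimes>\<^bsub>M\<^esub> (d \<otimes>\<^bsub>M\<^esub> m)" "k \<otimes>\<^bsub>M\<^esub> (c \<otimes>\<^bsub>M\<^esub> n)"] k m n by auto
  have "v \<otimes>\<^bsub>M\<^esub> k \<notin> b q"
    using M.prime_mult_iff[OF p, of v k] kq v(1) k(2) contract_disjoint[OF q] by auto
  moreover have "(v \<otimes>\<^bsub>M\<^esub> k) \<otimes>\<^bsub>M\<^esub> (d \<otimes>\<^bsub>M\<^esub> m) = (v \<otimes>\<^bsub>M\<^esub> k) \<otimes>\<^bsub>M\<^esub> (c \<otimes>\<^bsub>M\<^esub> n)"
    using v k m n by (simp add: M.m_assoc)
  ultimately have "\<exists>u\<in>carrier M - b q. u \<otimes>\<^bsub>M\<^esub> (d \<otimes>\<^bsub>M\<^esub> m) = u \<otimes>\<^bsub>M\<^esub> (c \<otimes>\<^bsub>M\<^esub> n)"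
    using v(1) k(2) by (intro bexI[of _ "v \<otimes>\<^bsub>M\<^esub> k"]) simp_all
  then show ?thesis unfolding m(4) n(4) using M.L_eq_iff[OF p m(1) n(1) m(2) n(2) m(3) n(3)] by blast
qed

text \<open>A section of \<open>Spec N\<close> is pulled back pointwise: at \<open>p\<close> it has a preimage in \<open>M\<^sub>p\<close>, which is unique by
  \<open>stalk_injective\<close>.  If the section is \<open>x / y\<close> near \<open>extend p\<close>, with \<open>x = \<phi> m / \<phi> s\<close> and
  \<open>y = \<phi> n / \<phi> r\<close>, then the preimage is the fraction \<open>r m / s n\<close> near \<open>p\<close>.\<close>

lemma pull_bij:
  assumes D: "M.opn disjoint_primes" and V: "M.opn V" "V \<subseteq> disjoint_primes"
  shows "bij_betw (shf (Spec_map M N \<phi>) V) (carrier (M.Sc V)) (carrier (N.Sc (pre V)))"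
  unfolding bij_betw_def
proof (intro conjI)
  have Vp: "prime_ideal M p" "H \<inter> p = {}" "prime_ideal N (extend p)" "extend p \<in> pre V" "b (extend p) = p" if "p \<in> V" for p
  proof -
    show p: "prime_ideal M p" "H \<inter> p = {}" using that V(2) by (auto simp: Spec_points_def)
    show "prime_ideal N (extend p)" "b (extend p) = p" using extend_prime[OF p] contract_extend[OF p] by blast+
    then show "extend p \<in> pre V" using that by (simp add: Spec_points_def)
  qed
  show "inj_on (shf (Spec_map M N \<phi>) V) (carrier (M.Sc V))"
  proof (rule inj_onI)
    fix s t assume s: "s \<in> carrier (M.Sc V)" and t: "t \<in> carrier (M.Sc V)" and e: "pull V s = pull V t"
    show "s = t"
    proof (rule extensionalityI[OF M.sec_ext[OF s] M.sec_ext[OF t]])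
      fix p assume p: "p \<in> V"
      have z: "s p \<in> carrier (M.L (b (extend p)))" "t p \<in> carrier (M.L (b (extend p)))"
        unfolding Vp(5)[OF p] using M.sec_pt[OF s p] M.sec_pt[OF t p] .
      have "loc_induced N (carrier N - extend p) \<phi> (s p) = loc_induced N (carrier N - extend p) \<phi> (t p)"
        using fun_cong[OF e, of "extend p"] unfolding pull_pt[OF Vp(4)[OF p]] Vp(5)[OF p] .
      then show "s p = t p" by (rule stalk_injective[OF Vp(3)[OF p] z])
    qed
  qed
  show "shf (Spec_map M N \<phi>) V ` carrier (M.Sc V) = carrier (N.Sc (pre V))"
  proof (intro subset_antisym subsetI)
    fix t assume "t \<in> pull V ` carrier (M.Sc V)"
    then show "t \<in> carrier (N.Sc (pre V))" using pull_closed[OF V(1)] by blast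
  next
    fix t assume t: "t \<in> carrier (N.Sc (pre V))"
    define \<sigma> where "\<sigma> = (\<lambda>p\<in>V. SOME z. z \<in> carrier (M.L p) \<and> loc_induced N (carrier N - extend p) \<phi> z = t (extend p))"
    have \<sigma>I: "\<sigma> p = z"
      if "p \<in> V" "z \<in> carrier (M.L p)" "loc_induced N (carrier N - extend p) \<phi> z = t (extend p)" for p z
    proof -
      let ?P = "\<lambda>z. z \<in> carrier (M.L p) \<and> loc_induced N (carrier N - extend p) \<phi> z = t (extend p)"
      have P: "?P (Eps ?P)" by (rule someI[of ?P z]) (use that in simp)
      have "Eps ?P = z"
        by (rule stalk_injective[OF Vp(3)[OF that(1)]]) (use P that Vp(5)[OF that(1)] in simp_all)
      then show ?thesis using that(1) by (simp add: \<sigma>_def)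
    qed
    have local: "\<exists>W m a. M.opn W \<and> p \<in> W \<and> W \<subseteq> V \<and> m \<in> carrier M \<and> a \<in> carrier M \<and>
        (\<forall>p'\<in>W. a \<notin> p' \<and> \<sigma> p' = M.fr p' m a \<and> loc_induced N (carrier N - extend p') \<phi> (\<sigma> p') = t (extend p'))"
      if p: "p \<in> V" for p
    proof -
      obtain W x y where W: "N.opn W" "extend p \<in> W" "W \<subseteq> pre V" "x \<in> carrier N" "y \<in> carrier N"
        "\<forall>q\<in>W. y \<notin> q \<and> t q = N.fr q x y" using N.secE[OF t Vp(4)[OF p]] by blast
      obtain s m where s: "s \<in> H" "m \<in> carrier M" "\<phi> s \<otimes>\<^bsub>N\<^esub> x = \<phi> m" using fractions[OF W(4)] by blast
      obtain r n where r: "r \<in> H" "n \<in> carrier M" "\<phi> r \<otimes>\<^bsub>N\<^esub> y = \<phi> n" using fractions[OF W(5)] by blast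
      let ?W = "{p \<in> disjoint_primes. extend p \<in> W}" and ?m = "r \<otimes>\<^bsub>M\<^esub> m" and ?a = "s \<otimes>\<^bsub>M\<^esub> n"
      have c: "?m \<in> carrier M" "?a \<in> carrier M" using s r by simp_all
      have sub: "?W \<subseteq> V"
      proof
        fix p' assume p': "p' \<in> ?W"
        then have "b (extend p') \<in> V" using W(3) by blast
        then show "p' \<in> V" using contract_extend[of p'] p' by (simp add: Spec_points_def)
      qed
      have "?a \<notin> p' \<and> \<sigma> p' = M.fr p' ?m ?a \<and> loc_induced N (carrier N - extend p') \<phi> (\<sigma> p') = t (extend p')"
        if p': "p' \<in> ?W" for p'
      proof -
        have p'V: "p' \<in> V" using sub p' by blast
        note P = Vp[OF p'V]
        let ?q = "extend p'"
        have y: "y \<notin> ?q" "t ?q = N.fr ?q x y" using W(6) p' by auto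
        have "n \<notin> p'" using extend_iff[OF P(1,2) r(1,2) W(5) r(3)] y(1) by blast
        then have a: "?a \<notin> p'" using M.prime_mult_iff[OF P(1)] s r P(2) by auto
        have \<phi>a: "\<phi> ?a \<notin> ?q" using a P(5) c by blast
        have i: "loc_induced N (carrier N - ?q) \<phi> (M.fr p' ?m ?a) = N.fr ?q (\<phi> ?m) (\<phi> ?a)"
          using induced_frac[OF P(3), of ?m ?a] a c unfolding P(5) by blast
        have "y \<otimes>\<^bsub>N\<^esub> \<phi> ?m = \<phi> ?a \<otimes>\<^bsub>N\<^esub> x"
        proof -
          have "y \<otimes>\<^bsub>N\<^esub> \<phi> ?m = y \<otimes>\<^bsub>N\<^esub> (\<phi> r \<otimes>\<^bsub>N\<^esub> (\<phi> s \<otimes>\<^bsub>N\<^esub> x))" using s r by simp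
          also have "\<dots> = (\<phi> s \<otimes>\<^bsub>N\<^esub> (\<phi> r \<otimes>\<^bsub>N\<^esub> y)) \<otimes>\<^bsub>N\<^esub> x" using s(1) r(1) W(4,5) by (simp add: N.m_ac)
          also have "\<dots> = \<phi> ?a \<otimes>\<^bsub>N\<^esub> x" unfolding r(3) using s r by simp
          finally show ?thesis .
        qed
        then have "N.fr ?q (\<phi> ?m) (\<phi> ?a) = N.fr ?q x y"
          using N.L_eq_iff[OF P(3) hom_simps(1)[OF c(1)] W(4) hom_simps(1)[OF c(2)] W(5) \<phi>a y(1)] N.prime_one[OF P(3)]
          by (auto intro!: bexI[of _ "\<one>\<^bsub>N\<^esub>"])
        then have j: "loc_induced N (carrier N - ?q) \<phi> (M.fr p' ?m ?a) = t ?q" using i y(2) by simp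
        have "\<sigma> p' = M.fr p' ?m ?a" by (rule \<sigma>I[OF p'V M.L_closed[OF P(1) c a] j])
        then show ?thesis using a j by simp
      qed
      moreover have "p \<in> ?W" using p V(2) W(2) by blast
      ultimately show ?thesis using openin_extend[OF D W(1)] sub c by blast
    qed
    have "\<sigma> \<in> carrier (M.Sc V)"
    proof (rule M.secI)
      show "\<sigma> \<in> extensional V" by (simp add: \<sigma>_def)
      fix p assume p: "p \<in> V"
      obtain W m a where W: "M.opn W" "p \<in> W" "W \<subseteq> V" "m \<in> carrier M" "a \<in> carrier M"
        "\<forall>p'\<in>W. a \<notin> p' \<and> \<sigma> p' = M.fr p' m a \<and> loc_induced N (carrier N - extend p') \<phi> (\<sigma> p') = t (extend p')"
        using local[OF p] by (elim exE conjE)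
      show "\<exists>W m a. M.opn W \<and> p \<in> W \<and> W \<subseteq> V \<and> m \<in> carrier M \<and> a \<in> carrier M \<and> (\<forall>q\<in>W. a \<notin> q \<and> \<sigma> q = M.fr q m a)"
        by (rule M.locI[OF W(1-5)]) (use W(6) in simp)
    qed
    moreover have "pull V \<sigma> = t"
    proof (rule extensionalityI[OF pull_ext N.sec_ext[OF t]])
      fix q assume q: "q \<in> pre V"
      then have e: "extend (b q) = q" using extend_contract by (simp add: Spec_points_def)
      have "loc_induced N (carrier N - extend (b q)) \<phi> (\<sigma> (b q)) = t (extend (b q))"
      proof -
        have "b q \<in> V" using q by simp
        then obtain W m a where "b q \<in> W" and W: "\<forall>p'\<in>W. a \<notin> p' \<and> \<sigma> p' = M.fr p' m a \<and> loc_induced N (carrier N - extend p') \<phi> (\<sigma> p') = t (extend p')"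
          using local[OF \<open>b q \<in> V\<close>] by (elim exE conjE)
        then show ?thesis using bspec[OF W \<open>b q \<in> W\<close>] by blast
      qed
      then show "pull V \<sigma> q = t q" unfolding pull_pt[OF q] e .
    qed
    ultimately show "t \<in> pull V ` carrier (M.Sc V)" by blast
  qed
qed

text \<open>The base map is a homeomorphism onto the primes disjoint from \<open>H\<close>, with inverse \<open>extend\<close>, and sections
  correspond by \<open>pull_bij\<close>.  For general \<open>H\<close> this set of primes need not be open.\<close>

lemma Spec_open_immersion:
  assumes D: "M.opn disjoint_primes"
  shows "open_immersion (Spec N) (Spec M) (Spec_map M N \<phi>)"
proof (rule open_immersionI[OF Spec_map_morphism, where U = disjoint_primes])
  let ?f = "Spec_map M N \<phi>" and ?S = "open_subspace (Spec M) disjoint_primes"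
  have DS: "openin (spc (Spec M)) disjoint_primes" using D by (simp add: Spec_def)
  show "openin (spc (Spec M)) disjoint_primes" by (rule DS)
  have fD: "base ?f q \<in> disjoint_primes" if "q \<in> topspace (spc (Spec N))" for q
    using that b_prime contract_disjoint by (simp add: Spec_def N.topspace_Spec Spec_points_def Spec_map_def)
  then show "\<And>q. q \<in> topspace (spc (Spec N)) \<Longrightarrow> base ?f q \<in> disjoint_primes" .
  show "mspace_iso (Spec N) ?S ?f"
  proof (rule mspace_isoI[where e = extend])
    show "mspace_morphism (Spec N) ?S ?f"
      by (rule mspace_morphism_into_open[OF Spec_map_morphism DS fD])
    have T: "topspace (spc ?S) = disjoint_primes" by (rule topspace_open_subspace[OF DS])
    have o: "openin (spc ?S) V \<longleftrightarrow> M.opn V \<and> V \<subseteq> disjoint_primes" for V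
      using openin_open_subspace[OF DS] by (simp add: Spec_def)
    show "continuous_map (spc ?S) (spc (Spec N)) extend"
      unfolding continuous_map_def T o
      using extend_prime openin_extend[OF D] by (auto simp: Spec_def N.topspace_Spec Spec_points_def)
    show "extend (base ?f q) = q" if "q \<in> topspace (spc (Spec N))" for q
      using that extend_contract by (simp add: Spec_def N.topspace_Spec Spec_points_def Spec_map_def)
    show "base ?f (extend p) = p" if "p \<in> topspace (spc ?S)" for p
      using that contract_extend unfolding T by (simp add: Spec_points_def Spec_map_def)
    fix V assume "openin (spc ?S) V"
    then show "bij_betw (shf ?f V) (carrier (sect ?S V)) (carrier (sect (Spec N) (preim (Spec N) ?f V)))"
      using pull_bij[OF D, of V] unfolding o preim_eq by (simp add: Spec_def)
  qed
qed

end

section \<open>Open immersions of spectra are localizations at one element\<close>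

context spec_hom begin

text \<open>Let \<open>n\<close> be the ideal of non-units of \<open>N\<close>, \<open>p\<^sub>0\<close> its contraction, and \<open>a \<notin> p\<^sub>0\<close> such that all primes
  avoiding \<open>a\<close> lie in \<open>U\<close>.  Every point of \<open>U\<close> is contained in \<open>p\<^sub>0\<close>, since every prime of \<open>N\<close> is
  contained in \<open>n\<close>.  An element \<open>c \<notin> p\<^sub>0\<close> divides a power of \<open>a\<close>: otherwise the non-divisors of powers
  of \<open>a\<close> form a prime that avoids \<open>a\<close> and contains \<open>c\<close>.  The global section given by \<open>x \<in> N\<close> comes from a
  section over \<open>U\<close>, and its value \<open>m / c\<close> at \<open>p\<^sub>0\<close> satisfies \<open>\<phi> m / \<phi> c = x\<close>; if \<open>\<phi> m = \<phi> k\<close>, then the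
  sections given by \<open>m\<close> and \<open>k\<close> agree over \<open>U\<close>, in particular at \<open>p\<^sub>0\<close>.\<close>

lemma open_immersion_loc_hom:
  assumes "open_immersion (Spec N) (Spec M) (Spec_map M N \<phi>)"
  shows "\<exists>a\<in>carrier M. loc_hom M N \<phi> (gen_submonoid M {a})"
proof -
  let ?n = "carrier N - Units N"
  have T: "topspace (spc (Spec N)) = Spec_points N" by (simp add: Spec_def N.topspace_Spec)
  obtain U where U: "M.opn U" and into: "\<And>q. q \<in> Spec_points N \<Longrightarrow> b q \<in> U"
    and onto: "\<And>p. p \<in> U \<Longrightarrow> \<exists>q\<in>Spec_points N. b q = p"
    and bij: "bij_betw (shf (Spec_map M N \<phi>) U) (carrier (M.Sc U)) (carrier (N.Sc (Spec_points N)))"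
    using open_immersionE[OF assms] unfolding T by (auto simp: Spec_def Spec_map_def)
  have n: "prime_ideal N ?n" "?n \<in> Spec_points N" using N.prime_nonunits by (auto simp: Spec_points_def)
  have preU: "pre U = Spec_points N" using into by blast
  define p0 where "p0 = b ?n"
  have p0: "prime_ideal M p0" "p0 \<in> U" using b_prime[OF n(1)] into[OF n(2)] by (simp_all add: p0_def)
  obtain I where I: "I \<subseteq> carrier M" "U = Spec_points M - {p \<in> Spec_points M. I \<subseteq> p}"
    using U unfolding M.openin_Spec by blast
  obtain a where a: "a \<in> I" "a \<notin> p0" using p0(2) unfolding I(2) by blast
  have aM: "a \<in> carrier M" using a(1) I(1) by blast
  let ?H = "gen_submonoid M {a}"
  interpret monoid_loc M "{a}" using aM M.comm_monoid_axioms by (simp add: monoid_loc_def monoid_loc_axioms_def)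
  have below: "p \<subseteq> p0" if "p \<in> U" for p
  proof -
    obtain q where q: "q \<in> Spec_points N" "b q = p" using onto[OF \<open>p \<in> U\<close>] by blast
    then have "q \<subseteq> ?n" using N.prime_avoids_units by (simp add: Spec_points_def)
    then show ?thesis using q(2) unfolding p0_def by blast
  qed
  have divides: "\<exists>d\<in>carrier M. c \<otimes>\<^bsub>M\<^esub> d \<in> ?H" if c: "c \<in> carrier M" "c \<notin> p0" for c
  proof (rule ccontr)
    assume no: "\<not> (\<exists>d\<in>carrier M. c \<otimes>\<^bsub>M\<^esub> d \<in> ?H)"
    let ?p = "{c \<in> carrier M. \<forall>d\<in>carrier M. c \<otimes>\<^bsub>M\<^esub> d \<notin> ?H}"
    have "a \<otimes>\<^bsub>M\<^esub> \<one>\<^bsub>M\<^esub> \<in> ?H" using aM subset_gen_submonoid[of "{a}" M] by simp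
    then have "a \<notin> ?p" by blast
    then have "?p \<in> U" unfolding I(2) using M.prime_nondivisors[OF H] a(1) by (auto simp: Spec_points_def)
    then have "?p \<subseteq> p0" by (rule below)
    then show False using c no by blast
  qed
  have unit: "\<phi> s \<in> Units N" if "s \<in> carrier M" "s \<notin> p0" for s
    using that by (simp add: p0_def)
  have H0: "s \<notin> p0" if "s \<in> ?H" for s
    using that prime_disjoint_gen[OF p0(1) aM] a(2) by blast
  have pull1: "pull U (\<lambda>q\<in>U. M.fr q m \<one>\<^bsub>M\<^esub>) = (\<lambda>q\<in>Spec_points N. N.fr q (\<phi> m) \<one>\<^bsub>N\<^esub>)" if m: "m \<in> carrier M" for m
  proof (rule extensionalityI[OF pull_ext])
    fix q assume q: "q \<in> pre U"
    then have pq: "prime_ideal N q" "b q \<in> U" by (auto simp: Spec_points_def)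
    have "\<one>\<^bsub>M\<^esub> \<notin> b q" using N.prime_one[OF pq(1)] by simp
    then show "pull U (\<lambda>q\<in>U. M.fr q m \<one>\<^bsub>M\<^esub>) q = (\<lambda>q\<in>Spec_points N. N.fr q (\<phi> m) \<one>\<^bsub>N\<^esub>) q"
      unfolding pull_pt[OF q] using induced_frac[OF pq(1) m, of "\<one>\<^bsub>M\<^esub>"] pq q by simp
  qed (simp add: preU)
  have "loc_hom M N \<phi> ?H"
  proof (rule loc_homI[OF spec_hom_axioms H])
    show "\<phi> s \<in> Units N" if "s \<in> ?H" for s using unit H0[OF that] H_carrier[OF that] by blast
  next
    fix x assume x: "x \<in> carrier N"
    have "(\<lambda>q\<in>Spec_points N. N.fr q x \<one>\<^bsub>N\<^esub>) \<in> carrier (N.Sc (Spec_points N))"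
      by (rule N.frac_one_section[OF _ x]) (metis N.topspace_Spec openin_topspace)
    then obtain s where s: "s \<in> carrier (M.Sc U)" "pull U s = (\<lambda>q\<in>Spec_points N. N.fr q x \<one>\<^bsub>N\<^esub>)"
      using bij unfolding bij_betw_def by (metis (no_types, lifting) imageE)
    obtain m c where m: "m \<in> carrier M" "c \<in> carrier M" "c \<notin> p0" "s p0 = M.fr p0 m c"
      using M.L_cases[OF p0(1) M.sec_pt[OF s(1) p0(2)]] .
    have "N.fr ?n (\<phi> m) (\<phi> c) = pull U s ?n"
      using pull_pt[of ?n U s] induced_frac[OF n(1) m(1,2)] m(3,4) n(2) p0(2) unfolding p0_def by simp
    also have "\<dots> = N.fr ?n x \<one>\<^bsub>N\<^esub>" unfolding s(2) using n(2) by simp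
    finally have "\<exists>u\<in>carrier N - ?n. u \<otimes>\<^bsub>N\<^esub> (\<one>\<^bsub>N\<^esub> \<otimes>\<^bsub>N\<^esub> \<phi> m) = u \<otimes>\<^bsub>N\<^esub> (\<phi> c \<otimes>\<^bsub>N\<^esub> x)"
      using N.L_eq_iff[OF n(1), of "\<phi> m" x "\<phi> c" "\<one>\<^bsub>N\<^esub>"] m(1-3) x unit[OF m(2,3)] N.prime_one[OF n(1)] by simp
    then obtain u where u: "u \<in> Units N" "u \<otimes>\<^bsub>N\<^esub> (\<one>\<^bsub>N\<^esub> \<otimes>\<^bsub>N\<^esub> \<phi> m) = u \<otimes>\<^bsub>N\<^esub> (\<phi> c \<otimes>\<^bsub>N\<^esub> x)" by blast
    have cx: "\<phi> m = \<phi> c \<otimes>\<^bsub>N\<^esub> x"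
      using N.Units_l_cancel[OF u(1), of "\<phi> m" "\<phi> c \<otimes>\<^bsub>N\<^esub> x"] u(2) m(1,2) x by simp
    obtain d where d: "d \<in> carrier M" "c \<otimes>\<^bsub>M\<^esub> d \<in> ?H" using divides[OF m(2,3)] by blast
    have "\<phi> (c \<otimes>\<^bsub>M\<^esub> d) \<otimes>\<^bsub>N\<^esub> x = \<phi> d \<otimes>\<^bsub>N\<^esub> (\<phi> c \<otimes>\<^bsub>N\<^esub> x)" using m(2) d(1) x by (simp add: N.m_ac)
    also have "\<dots> = \<phi> (d \<otimes>\<^bsub>M\<^esub> m)" unfolding cx[symmetric] using d(1) m(1) by simp
    finally show "\<exists>s\<in>?H. \<exists>m\<in>carrier M. \<phi> s \<otimes>\<^bsub>N\<^esub> x = \<phi> m" using d m(1) by (metis M.m_closed)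
  next
    fix m k assume m: "m \<in> carrier M" and k: "k \<in> carrier M" and e: "\<phi> m = \<phi> k"
    have "(\<lambda>q\<in>U. M.fr q m \<one>\<^bsub>M\<^esub>) = (\<lambda>q\<in>U. M.fr q k \<one>\<^bsub>M\<^esub>)"
      by (rule inj_onD[OF bij_betw_imp_inj_on[OF bij]])
        (simp_all only: pull1[OF m] pull1[OF k] e M.frac_one_section[OF U m] M.frac_one_section[OF U k])
    then have "M.fr p0 m \<one>\<^bsub>M\<^esub> = M.fr p0 k \<one>\<^bsub>M\<^esub>" using p0(2) by (metis (mono_tags, lifting) restrict_apply')
    then obtain u where u: "u \<in> carrier M" "u \<notin> p0" "u \<otimes>\<^bsub>M\<^esub> m = u \<otimes>\<^bsub>M\<^esub> k"
      using M.L_eq_iff[OF p0(1) m k, of "\<one>\<^bsub>M\<^esub>" "\<one>\<^bsub>M\<^esub>"] M.prime_one[OF p0(1)] m k by auto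
    obtain d where d: "d \<in> carrier M" "u \<otimes>\<^bsub>M\<^esub> d \<in> ?H" using divides[OF u(1,2)] by blast
    have "(u \<otimes>\<^bsub>M\<^esub> d) \<otimes>\<^bsub>M\<^esub> l = d \<otimes>\<^bsub>M\<^esub> (u \<otimes>\<^bsub>M\<^esub> l)" if "l \<in> carrier M" for l
      using u(1) d(1) that by (simp add: M.m_ac)
    then have "(u \<otimes>\<^bsub>M\<^esub> d) \<otimes>\<^bsub>M\<^esub> m = (u \<otimes>\<^bsub>M\<^esub> d) \<otimes>\<^bsub>M\<^esub> k" using m k u(3) by simp
    then show "\<exists>u\<in>?H. u \<otimes>\<^bsub>M\<^esub> m = u \<otimes>\<^bsub>M\<^esub> k" using d(2) by blast
  qed
  then show ?thesis using aM by blast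
qed

end

section \<open>The equivalence\<close>

lemma (in loc_hom) epimorphism: "epimorphism TYPE('u) M N \<phi>"
  unfolding epimorphism_def using algebra_hom_unique by blast

lemma (in loc_hom) open_immersion_single_element:
  assumes a: "a \<in> carrier M" and Ha: "H = gen_submonoid M {a}"
  shows "open_immersion (Spec N) (Spec M) (Spec_map M N \<phi>)"
proof (rule Spec_open_immersion)
  have "disjoint_primes = {p \<in> Spec_points M. a \<notin> p}"
    using prime_disjoint_gen[OF _ a] by (auto simp: Ha Spec_points_def)
  then show "M.opn disjoint_primes" using M.openin_D[OF a] by simp
qed

theorem theorem30:
  fixes M :: "'a monoid" and N :: "'b monoid" and \<phi> :: "'a \<Rightarrow> 'b"
  assumes "comm_monoid M" and "comm_monoid N" and "\<phi> \<in> monoid_hom M N"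
    and "infinite (UNIV :: 'u set)"
    and "carrier M \<lesssim> (UNIV :: 'u set)" and "carrier N \<lesssim> (UNIV :: 'u set)"
  shows "(flat TYPE('u) M N \<phi> \<and> epimorphism TYPE('u) M N \<phi> \<and> finite_presentation TYPE('u) M N \<phi>
            \<longleftrightarrow> (\<exists>a\<in>carrier M. algebra_isomorphic M N \<phi> (localization M {a}) (loc_map M {a})))
       \<and> ((\<exists>a\<in>carrier M. algebra_isomorphic M N \<phi> (localization M {a}) (loc_map M {a}))
            \<longleftrightarrow> open_immersion (Spec N) (Spec M) (Spec_map M N \<phi>))"
proof -
  interpret spec_hom M N \<phi> by (rule spec_homI[OF assms(1-3)])
  have loc: "loc_hom M N \<phi> (gen_submonoid M {a})"
    if "a \<in> carrier M" "algebra_isomorphic M N \<phi> (localization M {a}) (loc_map M {a})" for a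
    by (rule algebra_isomorphic_loc_hom[OF assms(1-3) that(2) loc_hom_loc_map[OF assms(1)]]) (use that(1) in simp)
  show ?thesis
  proof (intro conjI iffI)
    assume h: "flat TYPE('u) M N \<phi> \<and> epimorphism TYPE('u) M N \<phi> \<and> finite_presentation TYPE('u) M N \<phi>"
    interpret L: loc_hom M N \<phi> "{s \<in> carrier M. \<phi> s \<in> Units N}"
      by (rule flat_loc_hom[OF conjunct1[OF h] assms(5)])
    show "\<exists>a\<in>carrier M. algebra_isomorphic M N \<phi> (localization M {a}) (loc_map M {a})"
      by (rule L.finitely_presented_single_element[OF refl conjunct2[OF conjunct2[OF h]] assms(4,5)])
  next
    assume "\<exists>a\<in>carrier M. algebra_isomorphic M N \<phi> (localization M {a}) (loc_map M {a})"
    then obtain a where a: "a \<in> carrier M" "algebra_isomorphic M N \<phi> (localization M {a}) (loc_map M {a})" by blast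
    interpret L: loc_hom M N \<phi> "gen_submonoid M {a}" by (rule loc[OF a])
    show "flat TYPE('u) M N \<phi>" by (rule L.flat)
    show "epimorphism TYPE('u) M N \<phi>" by (rule L.epimorphism)
    show "finite_presentation TYPE('u) M N \<phi>" by (rule L.finite_presentation[OF a(1) refl])
    show "open_immersion (Spec N) (Spec M) (Spec_map M N \<phi>)"
      by (rule L.open_immersion_single_element[OF a(1) refl])
  next
    assume "open_immersion (Spec N) (Spec M) (Spec_map M N \<phi>)"
    then obtain a where a: "a \<in> carrier M" "loc_hom M N \<phi> (gen_submonoid M {a})"
      using open_immersion_loc_hom by blast
    have "algebra_isomorphic M N \<phi> (localization M {a}) (loc_map M {a})"
      by (rule loc_hom.algebra_isomorphic_localization[OF a(2)]) (use a(1) in simp_all)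
    then show "\<exists>a\<in>carrier M. algebra_isomorphic M N \<phi> (localization M {a}) (loc_map M {a})" using a(1) by blast
  qed
qed

end
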